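(* Let $G$ be a finitely generated group, and let $p$ be a prime such that $b_2(G;\mathbb{F}_p)$ is finite. Let $K$ be a finite index normal subgroup of $G$ such that $G/K$ is an elementary abelian $p$-group of rank $n$. Then, for any integer $\ell$ between $0$ and $n$ (inclusive), $$b_1(K;\mathbb{F}_p) \geq \sum_{r=2}^{\ell+1} \binom{n}{r}(r-1) + (b_1(G;\mathbb{F}_p)-n)\sum_{r=0}^{\ell}\binom{n}{r} - b_2(G;\mathbb{F}_p)\sum_{r=0}^{\ell-1}\binom{n}{r}.$$ Moreover, if $p=2$, $$b_1(K;\mathbb{F}_2) \geq b_1(G;\mathbb{F}_2)\sum_{r=0}^{\ell}\binom{n}{r} - \sum_{r=1}^{\ell+1}\binom{n}{r} - b_2(G;\mathbb{F}_2)\sum_{r=0}^{\ell-1}\binom{n}{r}.$$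
   Context: $\mathbb{F}_p$ is the field of order $p$, and for $r=1,2$, $b_r(G;\mathbb{F}_p)$ denotes the dimension over $\mathbb{F}_p$ of the group homology $H_r(G;\mathbb{F}_p)$. When $\ell=0$, the sums $\sum_{r=2}^{\ell+1}$ and $\sum_{r=0}^{\ell-1}$ are taken to be zero. $\binom{n}{r}=0$ for $r>n$. *)

theory Defs
  imports
    "Jordan_Normal_Form.Missing_VectorSpace"
    "HOL-Number_Theory.Residues"
    "HOL-Algebra.Generated_Groups"
    "HOL-Algebra.Elementary_Groups"
    "HOL-Algebra.Product_Groups"
begin

section \<open>Quotient modules\<close>

text \<open>Only the additive structure and the scalar action of a module record matter; the
  multiplicative fields hold arbitrary values.\<close>

definition quotient_module ::
    "('r, 'b, 'c) module_scheme \<Rightarrow> 'b set \<Rightarrow> ('r, 'b set) module"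
  where "quotient_module M N =
    \<lparr>carrier = a_rcosets\<^bsub>M\<^esub> N,
     monoid.mult = (\<lambda>X Y. undefined),
     one = undefined,
     zero = N,
     add = (\<lambda>X Y. X <+>\<^bsub>M\<^esub> Y),
     smult = (\<lambda>a X. \<Union>x\<in>X. N +>\<^bsub>M\<^esub> (a \<odot>\<^bsub>M\<^esub> x))\<rparr>"

section \<open>Group homology with trivial coefficients\<close>

text \<open>The homology of a group \<open>G\<close> with coefficients in the trivial \<open>G\<close>-module \<open>R\<close> is computed
  from the unnormalised, inhomogeneous bar complex: \<open>C\<^sub>n\<close> is the free \<open>R\<close>-module on the
  \<open>n\<close>-tuples \<open>[g\<^sub>1|...|g\<^sub>n]\<close> of elements of \<open>G\<close>, with differential
  \<open>\<partial>[g\<^sub>1|...|g\<^sub>n] = [g\<^sub>2|...|g\<^sub>n] + (\<Sum>0<i<n. (-1)\<^sup>i [g\<^sub>1|...|g\<^sub>i g\<^sub>i\<^sub>+\<^sub>1|...|g\<^sub>n])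
     + (-1)\<^sup>n [g\<^sub>1|...|g\<^sub>n\<^sub>-\<^sub>1]\<close>.
  Tuples are represented as lists.\<close>

definition bar_cells :: "('g, 'm) monoid_scheme \<Rightarrow> nat \<Rightarrow> 'g list set"
  where "bar_cells G n = {xs. length xs = n \<and> set xs \<subseteq> carrier G}"

text \<open>List positions start at 0, so \<open>g\<^sub>i\<close> is \<open>xs ! (i - 1)\<close>.\<close>

definition bar_face :: "('g, 'm) monoid_scheme \<Rightarrow> nat \<Rightarrow> 'g list \<Rightarrow> 'g list"
  where "bar_face G i xs =
    (if i = 0 then tl xs
     else if i = length xs then butlast xs
     else take (i - 1) xs @ [xs ! (i - 1) \<otimes>\<^bsub>G\<^esub> xs ! i] @ drop (i + 1) xs)"

definition bar_chains ::
    "('r, 'k) ring_scheme \<Rightarrow> ('g, 'm) monoid_scheme \<Rightarrow> nat \<Rightarrow> ('r, 'g list \<Rightarrow> 'r) module"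
  where "bar_chains R G n =
    \<lparr>carrier = {c. range c \<subseteq> carrier R \<and> finite {xs. c xs \<noteq> \<zero>\<^bsub>R\<^esub>}
                   \<and> {xs. c xs \<noteq> \<zero>\<^bsub>R\<^esub>} \<subseteq> bar_cells G n},
     monoid.mult = (\<lambda>c d. undefined),
     one = undefined,
     zero = (\<lambda>xs. \<zero>\<^bsub>R\<^esub>),
     add = (\<lambda>c d xs. c xs \<oplus>\<^bsub>R\<^esub> d xs),
     smult = (\<lambda>a c xs. a \<otimes>\<^bsub>R\<^esub> c xs)\<rparr>"

definition bar_basis :: "('r, 'k) ring_scheme \<Rightarrow> 'g list \<Rightarrow> 'g list \<Rightarrow> 'r"
  where "bar_basis R xs = (\<lambda>ys. if ys = xs then \<one>\<^bsub>R\<^esub> else \<zero>\<^bsub>R\<^esub>)"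

definition bar_boundary_cell ::
    "('r, 'k) ring_scheme \<Rightarrow> ('g, 'm) monoid_scheme \<Rightarrow> nat \<Rightarrow> 'g list \<Rightarrow> 'g list \<Rightarrow> 'r"
  where "bar_boundary_cell R G n xs =
    (\<Oplus>\<^bsub>bar_chains R G (n - 1)\<^esub> i \<in> {0..n}.
       ((\<ominus>\<^bsub>R\<^esub> \<one>\<^bsub>R\<^esub>) [^]\<^bsub>R\<^esub> i) \<odot>\<^bsub>bar_chains R G (n - 1)\<^esub> bar_basis R (bar_face G i xs))"

text \<open>The differential \<open>C\<^sub>n \<rightarrow> C\<^sub>n\<^sub>-\<^sub>1\<close>; meaningful for \<open>n \<ge> 1\<close> only.\<close>

definition bar_boundary ::
    "('r, 'k) ring_scheme \<Rightarrow> ('g, 'm) monoid_scheme \<Rightarrow> nat \<Rightarrow> ('g list \<Rightarrow> 'r) \<Rightarrow> 'g list \<Rightarrow> 'r"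
  where "bar_boundary R G n c =
    (\<Oplus>\<^bsub>bar_chains R G (n - 1)\<^esub> xs \<in> {xs. c xs \<noteq> \<zero>\<^bsub>R\<^esub>}.
       c xs \<odot>\<^bsub>bar_chains R G (n - 1)\<^esub> bar_boundary_cell R G n xs)"

definition bar_cycles ::
    "('r, 'k) ring_scheme \<Rightarrow> ('g, 'm) monoid_scheme \<Rightarrow> nat \<Rightarrow> ('g list \<Rightarrow> 'r) set"
  where "bar_cycles R G n =
    {c \<in> carrier (bar_chains R G n).
       n = 0 \<or> bar_boundary R G n c = \<zero>\<^bsub>bar_chains R G (n - 1)\<^esub>}"

definition bar_boundaries ::
    "('r, 'k) ring_scheme \<Rightarrow> ('g, 'm) monoid_scheme \<Rightarrow> nat \<Rightarrow> ('g list \<Rightarrow> 'r) set"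
  where "bar_boundaries R G n = bar_boundary R G (n + 1) ` carrier (bar_chains R G (n + 1))"

definition group_homology ::
    "('r, 'k) ring_scheme \<Rightarrow> ('g, 'm) monoid_scheme \<Rightarrow> nat \<Rightarrow> ('r, ('g list \<Rightarrow> 'r) set) module"
  where "group_homology R G n =
    quotient_module ((bar_chains R G n)\<lparr>carrier := bar_cycles R G n\<rparr>) (bar_boundaries R G n)"

section \<open>Mod-\<open>p\<close> Betti numbers\<close>

abbreviation prime_field :: "nat \<Rightarrow> int ring"
  where "prime_field p \<equiv> residue_ring (int p)"

definition finite_betti :: "nat \<Rightarrow> nat \<Rightarrow> ('g, 'm) monoid_scheme \<Rightarrow> bool"
  where "finite_betti r p G \<longleftrightarrow>
    vectorspace.fin_dim (prime_field p) (group_homology (prime_field p) G r)"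

text \<open>The value of \<open>vectorspace.dim\<close> carries no information for an infinite-dimensional space, so
  \<open>betti r p G\<close> is to be read together with \<open>finite_betti r p G\<close>. For \<open>r = 1\<close> and \<open>G\<close> finitely
  generated, finiteness is automatic.\<close>

definition betti :: "nat \<Rightarrow> nat \<Rightarrow> ('g, 'm) monoid_scheme \<Rightarrow> nat"
  where "betti r p G =
    vectorspace.dim (prime_field p) (group_homology (prime_field p) G r)"

section \<open>Group-theoretic notions\<close>

definition finitely_generated_group :: "('g, 'm) monoid_scheme \<Rightarrow> bool"
  where "finitely_generated_group G \<longleftrightarrow>
    group G \<and> (\<exists>S. finite S \<and> S \<subseteq> carrier G \<and> generate G S = carrier G)"

definition elementary_abelian_of_rank :: "nat \<Rightarrow> nat \<Rightarrow> ('g, 'm) monoid_scheme \<Rightarrow> bool"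
  where "elementary_abelian_of_rank p n A \<longleftrightarrow>
    A \<cong> product_group {..<n} (\<lambda>_. integer_mod_group p)"

end

theory Submission
  imports Defs
begin

text \<open>
  The first homology of \<open>K\<close> is bounded below through its dual, \<open>Hom(K, F\<^sub>p)\<close>, which by Shapiro's
  lemma is the first cohomology of \<open>G\<close> with coefficients in the functions on \<open>A = G/K\<close>. Choose
  coordinates \<open>\<pi>\<^sub>0, ..., \<pi>\<^sub>n\<^sub>-\<^sub>1\<close> identifying \<open>A\<close> with \<open>F\<^sub>p\<^sup>n\<close>. Among all functions on \<open>A\<close> only the
  square-free polynomials are used: the span \<open>M\<close> of the monomials \<open>x\<^sup>S = \<Prod>i\<in>S. x\<^sub>i\<close> with
  \<open>S \<subseteq> {..<n}\<close> and \<open>card S \<le> l\<close>. It is closed under translation and has dimension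
  \<open>\<Sum>r\<le>l. n choose r\<close>, for every prime \<open>p\<close>; this is where the binomial coefficients come from.
  Let \<open>Z\<close> be the space of crossed homomorphisms \<open>G \<rightarrow> M\<close>. Its dimension is estimated from both sides.

  From below: translation changes \<open>x\<^sup>S\<close> only by monomials \<open>x\<^sup>U\<close> with \<open>U \<subset> S\<close>, so a crossed
  homomorphism can be built one coefficient at a time, larger sets first. Given the coefficients
  already chosen, the new one has to split a two-cocycle of \<open>G\<close> with trivial coefficients. This
  imposes at most \<open>b\<^sub>2(G)\<close> linear conditions on the earlier choices, and none for the sets with exactly
  \<open>l\<close> elements, whose coefficients are homomorphisms; the new coefficient is then free up to
  \<open>Hom(G, F\<^sub>p)\<close>, of dimension \<open>b\<^sub>1(G)\<close>. Hence
  \<open>dim Z \<ge> b\<^sub>1(G) (\<Sum>r\<le>l. n choose r) - b\<^sub>2(G) (\<Sum>r<l. n choose r)\<close>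
  (\<open>crossed_homs_extend\<close>, \<open>card_crossed_homs\<close>).

  From above: the value at the origin of a crossed homomorphism restricts to a homomorphism on \<open>K\<close>.
  If the latter is zero, then the crossed homomorphism factors through \<open>A\<close> and is determined by its
  values on generators of \<open>A\<close>. That the generators commute leaves one parameter for each set \<open>W\<close> with
  \<open>1 \<le> card W \<le> l + 1\<close>, and, if \<open>l \<ge> 1\<close>, one more for each generator, which vanishes for \<open>p = 2\<close>
  because the generators are then involutions. Hence
  \<open>dim Z \<le> b\<^sub>1(K) + (\<Sum>r=1..l+1. n choose r) + e\<close> with \<open>e = n\<close> if \<open>p \<noteq> 2\<close> and \<open>l \<ge> 1\<close>, and
  \<open>e = 0\<close> otherwise (\<open>inflated_zero\<close>, \<open>card_crossed_homs_le\<close>).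

  Comparing the two estimates gives the inequality for \<open>p = 2\<close> at once, and an inequality for all \<open>p\<close>
  that implies the general one by an identity between binomial sums (\<open>weighted_binomial_sum\<close>).

  Since \<open>G\<close> is finitely generated, all these spaces are finite, and dimensions are compared through
  cardinalities. The link with the bar complex consists of two facts: there are \<open>p\<close> to the power
  \<open>b\<^sub>1\<close> homomorphisms to \<open>F\<^sub>p\<close> (\<open>card_mod_homs\<close>), and a two-cocycle splits as soon as it
  vanishes on \<open>b\<^sub>2\<close> suitable chains (\<open>cocycle_splits\<close>).
\<close>

section \<open>Quotient spaces and their coordinates\<close>

context
  fixes R :: "('r, 'k) ring_scheme" (structure) and M :: "('r, 'b, 'c) module_scheme" and N :: "'b set"
  assumes sub: "submodule R N M"
begin

interpretation submodule R N M by (fact sub)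
interpretation M: Module.module R M by (fact module)

lemma submodule_abelian_subgroup: "abelian_subgroup N M"
proof -
  have "subgroup N (add_monoid M)"
  proof (rule group.subgroupI)
    show "group (add_monoid M)" using M.abelian_group_axioms
      by (simp add: M.a_group)
    show "N \<subseteq> carrier (add_monoid M)" using subset by simp
    show "N \<noteq> {}" using zero_closed by blast
    fix a assume a: "a \<in> N"
    have "\<ominus>\<^bsub>R\<^esub> \<one>\<^bsub>R\<^esub> \<odot>\<^bsub>M\<^esub> a = \<ominus>\<^bsub>M\<^esub> a"
      using a subset M.smult_minus_1[of a] by auto
    moreover have "\<ominus>\<^bsub>R\<^esub> \<one>\<^bsub>R\<^esub> \<odot>\<^bsub>M\<^esub> a \<in> N" using a by (intro smult_closed) auto
    ultimately show "inv\<^bsub>add_monoid M\<^esub> a \<in> N" by (simp add: a_inv_def)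
    fix b assume "b \<in> N"
    then show "a \<otimes>\<^bsub>add_monoid M\<^esub> b \<in> N" using a by simp
  qed
  then have "additive_subgroup N M" by (simp add: additive_subgroup_def)
  then show ?thesis
    by (intro abelian_subgroupI2) (auto simp: additive_subgroup_def M.a_comm_group)
qed

interpretation abelian_subgroup N M by (fact submodule_abelian_subgroup)

lemma quotient_smult:
  assumes "a \<in> carrier R" "x \<in> carrier M"
  shows "a \<odot>\<^bsub>quotient_module M N\<^esub> (N +>\<^bsub>M\<^esub> x) = N +>\<^bsub>M\<^esub> (a \<odot>\<^bsub>M\<^esub> x)"
proof -
  have *: "N +>\<^bsub>M\<^esub> (a \<odot>\<^bsub>M\<^esub> y) = N +>\<^bsub>M\<^esub> (a \<odot>\<^bsub>M\<^esub> x)" if y: "y \<in> N +>\<^bsub>M\<^esub> x" for y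
  proof -
    obtain n where n: "n \<in> N" "y = n \<oplus>\<^bsub>M\<^esub> x" using y by (auto simp: a_r_coset_def')
    have "a \<odot>\<^bsub>M\<^esub> y = a \<odot>\<^bsub>M\<^esub> n \<oplus>\<^bsub>M\<^esub> a \<odot>\<^bsub>M\<^esub> x"
      using n assms subset by (auto simp: M.smult_r_distr)
    then have "a \<odot>\<^bsub>M\<^esub> y \<in> N +>\<^bsub>M\<^esub> (a \<odot>\<^bsub>M\<^esub> x)"
      using n assms by (auto simp: a_r_coset_def')
    then show ?thesis using assms by (intro a_repr_independence'[symmetric]) auto
  qed
  have "x \<in> N +>\<^bsub>M\<^esub> x" using assms by (intro a_rcos_self) auto
  then have "(\<Union>y\<in>N +>\<^bsub>M\<^esub> x. N +>\<^bsub>M\<^esub> (a \<odot>\<^bsub>M\<^esub> y)) = N +>\<^bsub>M\<^esub> (a \<odot>\<^bsub>M\<^esub> x)"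
  proof (intro equalityI UN_least)
    show "N +>\<^bsub>M\<^esub> (a \<odot>\<^bsub>M\<^esub> y) \<subseteq> N +>\<^bsub>M\<^esub> (a \<odot>\<^bsub>M\<^esub> x)" if "y \<in> N +>\<^bsub>M\<^esub> x" for y
      using *[OF that] by (rule equalityD1)
  qed (rule UN_upper)
  then show ?thesis by (simp add: quotient_module_def)
qed

lemma quotient_add:
  assumes "x \<in> carrier M" "y \<in> carrier M"
  shows "(N +>\<^bsub>M\<^esub> x) \<oplus>\<^bsub>quotient_module M N\<^esub> (N +>\<^bsub>M\<^esub> y) = N +>\<^bsub>M\<^esub> (x \<oplus>\<^bsub>M\<^esub> y)"
  using assms by (simp add: quotient_module_def a_rcos_sum)

lemma carrier_quotient: "carrier (quotient_module M N) = (\<lambda>x. N +>\<^bsub>M\<^esub> x) ` carrier M"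
  by (auto simp: quotient_module_def A_RCOSETS_def')

lemma zero_quotient: "\<zero>\<^bsub>quotient_module M N\<^esub> = N +>\<^bsub>M\<^esub> \<zero>\<^bsub>M\<^esub>"
  using subset by (simp add: quotient_module_def M.a_coset_add_zero)

lemma module_quotient: "Module.module R (quotient_module M N)"
proof (rule module_criteria, goal_cases)
  case 1
  show ?case using M.R.is_cring .
next
  case 4
  show ?case
  proof (intro ballI)
    fix v assume "v \<in> carrier (quotient_module M N)"
    then obtain x where x: "x \<in> carrier M" "v = N +>\<^bsub>M\<^esub> x" by (auto simp: carrier_quotient)
    then show "\<exists>w\<in>carrier (quotient_module M N). v \<oplus>\<^bsub>quotient_module M N\<^esub> w = \<zero>\<^bsub>quotient_module M N\<^esub>"
      by (intro bexI[of _ "N +>\<^bsub>M\<^esub> (\<ominus>\<^bsub>M\<^esub> x)"])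
         (auto simp: carrier_quotient quotient_add zero_quotient M.r_neg)
  qed
qed (auto simp: carrier_quotient quotient_add quotient_smult zero_quotient
       M.a_ac M.smult_assoc1 M.smult_l_distr M.smult_r_distr intro!: imageI)

lemma quotient_map_hom: "mod_hom R M (quotient_module M N) (\<lambda>x. N +>\<^bsub>M\<^esub> x)"
  using module_quotient module
  by (auto simp: mod_hom_def mod_hom_axioms_def LinearCombinations.module_hom_def quotient_add quotient_smult carrier_quotient)

lemma quotient_map_eq_iff:
  assumes "x \<in> carrier M" "y \<in> carrier M"
  shows "N +>\<^bsub>M\<^esub> x = N +>\<^bsub>M\<^esub> y \<longleftrightarrow> (\<exists>n\<in>N. x = n \<oplus>\<^bsub>M\<^esub> y)"
proof
  assume "N +>\<^bsub>M\<^esub> x = N +>\<^bsub>M\<^esub> y"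
  then have "x \<in> N +>\<^bsub>M\<^esub> y" using a_rcos_self[of x] assms by auto
  then show "\<exists>n\<in>N. x = n \<oplus>\<^bsub>M\<^esub> y" by (auto simp: a_r_coset_def')
next
  assume "\<exists>n\<in>N. x = n \<oplus>\<^bsub>M\<^esub> y"
  then have "x \<in> N +>\<^bsub>M\<^esub> y" by (auto simp: a_r_coset_def')
  then show "N +>\<^bsub>M\<^esub> x = N +>\<^bsub>M\<^esub> y" using assms by (intro a_repr_independence'[symmetric]) auto
qed

end

lemma (in mod_hom) hom_finsum:
  assumes "finite X" "F \<in> X \<rightarrow> carrier M"
  shows "f (\<Oplus>\<^bsub>M\<^esub>x\<in>X. F x) = (\<Oplus>\<^bsub>N\<^esub>x\<in>X. f (F x))"
  using assms
proof (induction X rule: finite_induct)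
  case empty
  then show ?case by simp
next
  case (insert x X)
  then have "(\<lambda>x. f (F x)) \<in> X \<rightarrow> carrier N" "F \<in> X \<rightarrow> carrier M" "F x \<in> carrier M" by auto
  with insert show ?case by simp
qed

text \<open>The basis of the quotient is lifted to vectors \<open>rep i\<close> of \<open>V\<close>, and the coordinate functions are pulled
back to functionals on \<open>V\<close> that vanish on \<open>N\<close>. With them, classes are computed in \<open>V\<close>
itself rather than with cosets.\<close>

lemma quotient_coordinates:
  fixes K :: "('r, 'k) ring_scheme" and V :: "('r, 'b, 'c) module_scheme"
  assumes vs: "vectorspace K V" and sub: "submodule K N V"
    and fin: "vectorspace.fin_dim K (quotient_module V N)"
  obtains rep :: "nat \<Rightarrow> 'b" and \<kappa> :: "nat \<Rightarrow> 'b \<Rightarrow> 'r"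
  where "\<And>i. i < vectorspace.dim K (quotient_module V N) \<Longrightarrow> rep i \<in> carrier V"
    and "\<And>i x. x \<in> carrier V \<Longrightarrow> i < vectorspace.dim K (quotient_module V N) \<Longrightarrow> \<kappa> i x \<in> carrier K"
    and "\<And>i x y. x \<in> carrier V \<Longrightarrow> y \<in> carrier V \<Longrightarrow> i < vectorspace.dim K (quotient_module V N) \<Longrightarrow>
           \<kappa> i (x \<oplus>\<^bsub>V\<^esub> y) = \<kappa> i x \<oplus>\<^bsub>K\<^esub> \<kappa> i y"
    and "\<And>i a x. a \<in> carrier K \<Longrightarrow> x \<in> carrier V \<Longrightarrow> i < vectorspace.dim K (quotient_module V N) \<Longrightarrow>
           \<kappa> i (a \<odot>\<^bsub>V\<^esub> x) = a \<otimes>\<^bsub>K\<^esub> \<kappa> i x"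
    and "\<And>i x. x \<in> N \<Longrightarrow> i < vectorspace.dim K (quotient_module V N) \<Longrightarrow> \<kappa> i x = \<zero>\<^bsub>K\<^esub>"
    and "\<And>i j. i < vectorspace.dim K (quotient_module V N) \<Longrightarrow> j < vectorspace.dim K (quotient_module V N) \<Longrightarrow>
           \<kappa> i (rep j) = (if i = j then \<one>\<^bsub>K\<^esub> else \<zero>\<^bsub>K\<^esub>)"
    and "\<And>x. x \<in> carrier V \<Longrightarrow> \<exists>n\<in>N. x = n \<oplus>\<^bsub>V\<^esub>
           (\<Oplus>\<^bsub>V\<^esub>i\<in>{..<vectorspace.dim K (quotient_module V N)}. \<kappa> i x \<odot>\<^bsub>V\<^esub> rep i)"
proof -
  interpret V: vectorspace K V by (fact vs)
  let ?Q = "quotient_module V N"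
  let ?T = "\<lambda>x. N +>\<^bsub>V\<^esub> x"
  have "Module.module K ?Q" using module_quotient[OF sub] .
  then interpret Q: vectorspace K ?Q using V.field_axioms by (simp add: vectorspace_def)
  interpret T: mod_hom K V ?Q ?T by (rule quotient_map_hom[OF sub])
  define d where "d = Q.dim"
  obtain B where B: "finite B" "Q.basis B" using fin Q.finite_basis_exists by blast
  have Bc: "B \<subseteq> carrier ?Q" using B by (simp add: Q.basis_def)
  have "card B = d" using B Q.dim_basis by (simp add: d_def)
  then obtain e where e: "bij_betw e {..<d} B" using B(1) 
    by (metis bij_betw_from_nat_into_finite)
  have crit: "\<And>v. v \<in> carrier ?Q \<Longrightarrow> \<exists>!a. a \<in> B \<rightarrow>\<^sub>E carrier K \<and> Q.lincomb a B = v"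
    using Q.basis_criterion[OF B(1) Bc] B(2) by simp
  define co where "co x = (THE a. a \<in> B \<rightarrow>\<^sub>E carrier K \<and> Q.lincomb a B = ?T x)" for x
  have co: "co x \<in> B \<rightarrow>\<^sub>E carrier K" "Q.lincomb (co x) B = ?T x" if "x \<in> carrier V" for x
    using theI'[OF crit[of "?T x"]] that unfolding co_def by auto
  have co_unique: "co x b = a b"
    if "x \<in> carrier V" "a \<in> B \<rightarrow> carrier K" "Q.lincomb a B = ?T x" "b \<in> B" for a x b
  proof -
    have "Q.lincomb (restrict a B) B = Q.lincomb a B"
      using that Bc by (intro Q.lincomb_cong) auto
    then have "restrict a B = co x" using crit[of "?T x"] that co[of x] by auto
    then show ?thesis using that(4) by (metis restrict_apply')
  qed
  have "\<forall>b\<in>B. \<exists>x\<in>carrier V. ?T x = b"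
    using Bc by (auto simp: carrier_quotient[OF sub])
  then obtain r where r: "\<And>b. b \<in> B \<Longrightarrow> r b \<in> carrier V \<and> ?T (r b) = b" by metis
  have eB: "i < d \<Longrightarrow> e i \<in> B" for i using e by (auto simp: bij_betw_def)
  show ?thesis
  proof (rule that[of "\<lambda>i. r (e i)" "\<lambda>i x. co x (e i)"], unfold d_def[symmetric])
    fix i assume i: "i < d"
    show "r (e i) \<in> carrier V" using r eB i by auto
    fix x assume x: "x \<in> carrier V"
    show "co x (e i) \<in> carrier K" using co[OF x] eB i by auto
  next
    fix i x y assume i: "i < d" and x: "x \<in> carrier V" and y: "y \<in> carrier V"
    show "co (x \<oplus>\<^bsub>V\<^esub> y) (e i) = co x (e i) \<oplus>\<^bsub>K\<^esub> co y (e i)"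
    proof (rule co_unique)
      have "Q.lincomb (\<lambda>b. co x b \<oplus>\<^bsub>K\<^esub> co y b) B = Q.lincomb (co x) B \<oplus>\<^bsub>?Q\<^esub> Q.lincomb (co y) B"
        using co[OF x] co[OF y] B Bc by (intro Q.lincomb_sum) auto
      then show "Q.lincomb (\<lambda>b. co x b \<oplus>\<^bsub>K\<^esub> co y b) B = ?T (x \<oplus>\<^bsub>V\<^esub> y)"
        using co x y by simp
    qed (use x y co[OF x] co[OF y] eB[OF i] in auto)
  next
    fix i a x assume i: "i < d" and x: "x \<in> carrier V" and a: "a \<in> carrier K"
    show "co (a \<odot>\<^bsub>V\<^esub> x) (e i) = a \<otimes>\<^bsub>K\<^esub> co x (e i)"
    proof (rule co_unique)
      have "Q.lincomb (\<lambda>b. a \<otimes>\<^bsub>K\<^esub> co x b) B = a \<odot>\<^bsub>?Q\<^esub> Q.lincomb (co x) B"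
        using co[OF x] a B Bc by (intro Q.lincomb_smult) auto
      then show "Q.lincomb (\<lambda>b. a \<otimes>\<^bsub>K\<^esub> co x b) B = ?T (a \<odot>\<^bsub>V\<^esub> x)"
        using co x a by simp
    qed (use x a co[OF x] eB[OF i] in auto)
  next
    fix i x assume i: "i < d" and x: "x \<in> N"
    have xV: "x \<in> carrier V" using sub x by (auto simp: submodule_def)
    have "?T x = ?T \<zero>\<^bsub>V\<^esub>"
      using quotient_map_eq_iff[OF sub xV, of "\<zero>\<^bsub>V\<^esub>"] x xV by (auto intro!: bexI[of _ x])
    then have Tx: "?T x = \<zero>\<^bsub>?Q\<^esub>" by (simp only: zero_quotient[OF sub])
    show "co x (e i) = \<zero>\<^bsub>K\<^esub>"
    proof (rule co_unique)
      have "Q.lincomb (\<lambda>b. \<zero>\<^bsub>K\<^esub>) B = \<zero>\<^bsub>?Q\<^esub>"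
        unfolding Q.lincomb_def using Bc
        by (subst Q.M.finsum_cong'[where g = "\<lambda>_. \<zero>\<^bsub>?Q\<^esub>" and B = B]) auto
      then show "Q.lincomb (\<lambda>b. \<zero>\<^bsub>K\<^esub>) B = ?T x" using Tx by simp
    qed (use xV eB[OF i] in auto)
  next
    fix i j assume i: "i < d" and j: "j < d"
    let ?a = "\<lambda>b. if b = e j then \<one>\<^bsub>K\<^esub> else \<zero>\<^bsub>K\<^esub>"
    have "co (r (e j)) (e i) = ?a (e i)"
    proof (rule co_unique)
      have "Q.lincomb ?a B = (\<Oplus>\<^bsub>?Q\<^esub>b\<in>B. if e j = b then b else \<zero>\<^bsub>?Q\<^esub>)"
        unfolding Q.lincomb_def using Bc by (intro Q.M.finsum_cong') auto
      also have "\<dots> = e j" using eB[OF j] B Bc by (intro Q.M.finsum_singleton) auto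
      finally show "Q.lincomb ?a B = ?T (r (e j))" using r eB[OF j] by simp
    qed (use r eB[OF i] eB[OF j] in auto)
    moreover have "e i = e j \<longleftrightarrow> i = j" using inj_on_eq_iff[OF bij_betw_imp_inj_on[OF e]] i j by simp
    ultimately show "co (r (e j)) (e i) = (if i = j then \<one>\<^bsub>K\<^esub> else \<zero>\<^bsub>K\<^esub>)" by simp
  next
    fix x assume x: "x \<in> carrier V"
    have in1: "co x (e i) \<odot>\<^bsub>V\<^esub> r (e i) \<in> carrier V" if "i < d" for i
      using co[OF x] eB[OF that] r by auto
    let ?s = "\<Oplus>\<^bsub>V\<^esub>i\<in>{..<d}. co x (e i) \<odot>\<^bsub>V\<^esub> r (e i)"
    have "?T ?s = (\<Oplus>\<^bsub>?Q\<^esub>i\<in>{..<d}. ?T (co x (e i) \<odot>\<^bsub>V\<^esub> r (e i)))"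
      using in1 by (intro T.hom_finsum) auto
    also have "\<dots> = (\<Oplus>\<^bsub>?Q\<^esub>i\<in>{..<d}. co x (e i) \<odot>\<^bsub>?Q\<^esub> e i)"
      using co[OF x] r eB Bc
      by (intro Q.M.finsum_cong') (auto simp: PiE_iff intro!: Q.smult_closed dest: subsetD)
    also have "\<dots> = (\<Oplus>\<^bsub>?Q\<^esub>b\<in>e ` {..<d}. co x b \<odot>\<^bsub>?Q\<^esub> b)"
      using co[OF x] Bc eB e by (intro Q.M.add.finprod_reindex[symmetric]) (auto simp: bij_betw_def PiE_iff)
    also have "\<dots> = Q.lincomb (co x) B" using e by (simp add: Q.lincomb_def bij_betw_def)
    also have "\<dots> = ?T x" using co[OF x] by simp
    finally have "?T x = ?T ?s" by simp
    moreover have "?s \<in> carrier V" using in1 by (intro V.M.finsum_closed) auto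
    ultimately show "\<exists>n\<in>N. x = n \<oplus>\<^bsub>V\<^esub> ?s"
      using quotient_map_eq_iff[OF sub x] by blast
  qed
qed

section \<open>Bar chains modulo a prime\<close>

text \<open>The value of the linear extension of the cochain \<open>f\<close> on the chain \<open>c\<close>. Cochains are functions to the
integers that matter only modulo \<open>p\<close>, so that integer arithmetic and congruences apply to them.\<close>

definition chain_pairing :: "nat \<Rightarrow> ('g list \<Rightarrow> int) \<Rightarrow> ('g list \<Rightarrow> int) \<Rightarrow> int"
  where "chain_pairing p f c = (\<Sum>xs | c xs \<noteq> 0. c xs * f xs) mod int p"

definition bar_coboundary ::
    "('g, 'm) monoid_scheme \<Rightarrow> nat \<Rightarrow> ('g list \<Rightarrow> int) \<Rightarrow> 'g list \<Rightarrow> int"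
  where "bar_coboundary G n f xs = (\<Sum>i\<le>n. (-1) ^ i * f (bar_face G i xs))"

text \<open>Chains are handled through their pairings with cochains: a chain is determined by them
(\<open>chain_eqI\<close>), and the differential becomes the explicit transposed formula \<open>bar_coboundary\<close>
(\<open>pair_boundary\<close>).\<close>

locale prime_bar_complex = group G for G (structure) +
  fixes p :: nat
  assumes prime_p: "prime p"
begin

sublocale F: residues_prime p "prime_field p"
  by unfold_locales (simp_all add: prime_p)

abbreviation "C n \<equiv> bar_chains (prime_field p) G n"
abbreviation "pair \<equiv> chain_pairing p"

lemma p_pos: "int p > 0"
  using prime_p prime_gt_0_nat by simp

lemma p_gt_1: "int p > 1"
  using prime_p prime_gt_1_nat by auto

lemma carrier_F: "carrier (prime_field p) = {0..<int p}"
  by (auto simp: F.res_carrier_eq)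

lemma chains_iff:
  "c \<in> carrier (C n) \<longleftrightarrow>
     (\<forall>xs. 0 \<le> c xs \<and> c xs < int p) \<and> finite {xs. c xs \<noteq> 0} \<and> {xs. c xs \<noteq> 0} \<subseteq> bar_cells G n"
  by (auto simp: bar_chains_def carrier_F F.res_zero_eq image_subset_iff)

lemma chains_add: "c \<oplus>\<^bsub>C n\<^esub> d = (\<lambda>xs. (c xs + d xs) mod int p)"
  by (simp add: bar_chains_def F.res_add_eq)

lemma chains_smult: "a \<odot>\<^bsub>C n\<^esub> c = (\<lambda>xs. (a * c xs) mod int p)"
  by (simp add: bar_chains_def F.res_mult_eq)

lemma chains_zero: "\<zero>\<^bsub>C n\<^esub> = (\<lambda>xs. 0)"
  by (simp add: bar_chains_def F.res_zero_eq)

lemma chains_supportI: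
  assumes "c \<in> carrier (C n)" "d \<in> carrier (C n)"
    and "\<And>xs. 0 \<le> e xs \<and> e xs < int p" "\<And>xs. c xs = 0 \<Longrightarrow> d xs = 0 \<Longrightarrow> e xs = 0"
  shows "e \<in> carrier (C n)"
proof -
  let ?X = "{xs. c xs \<noteq> 0} \<union> {xs. d xs \<noteq> 0}"
  have X: "finite ?X" "?X \<subseteq> bar_cells G n" using assms(1,2) by (simp_all add: chains_iff)
  have sub: "{xs. e xs \<noteq> 0} \<subseteq> ?X" using assms(4) by blast
  show ?thesis
    unfolding chains_iff using assms(3) finite_subset[OF sub X(1)] subset_trans[OF sub X(2)] by blast
qed

lemma chains_add_closed:
  assumes "c \<in> carrier (C n)" "d \<in> carrier (C n)"
  shows "c \<oplus>\<^bsub>C n\<^esub> d \<in> carrier (C n)"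
  unfolding chains_add by (rule chains_supportI[OF assms]) (use p_pos in auto)

lemma chains_smult_closed:
  assumes "c \<in> carrier (C n)"
  shows "a \<odot>\<^bsub>C n\<^esub> c \<in> carrier (C n)"
  unfolding chains_smult by (rule chains_supportI[OF assms assms]) (use p_pos in auto)

lemma chains_module: "Module.module (prime_field p) (C n)"
proof (rule module_criteria, goal_cases)
  case 1
  show ?case using F.cring .
next
  case 4
  show ?case
  proof
    fix c assume c: "c \<in> carrier (C n)"
    have "(c xs + (- 1 * c xs) mod int p) mod int p = 0" for xs
      by (simp add: mod_simps)
    then show "\<exists>d\<in>carrier (C n). c \<oplus>\<^bsub>C n\<^esub> d = \<zero>\<^bsub>C n\<^esub>"
      using chains_smult_closed[OF c, of "-1"]
      by (intro bexI[of _ "(-1) \<odot>\<^bsub>C n\<^esub> c"]) (auto simp: chains_add chains_smult chains_zero)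
  qed
next
  case 2
  then show ?case using p_pos by (auto simp: chains_iff chains_zero)
next
  case 3
  then show ?case using chains_add_closed by blast
next
  case 5
  then show ?case using chains_smult_closed by blast
qed (auto simp: chains_add chains_smult chains_zero chains_iff F.res_add_eq F.res_mult_eq F.res_one_eq
       mod_simps algebra_simps fun_eq_iff)

lemma chains_vectorspace: "vectorspace (prime_field p) (C n)"
  using chains_module F.is_field by (simp add: vectorspace_def)

sublocale C: vectorspace "prime_field p" "C n" for n
  by (rule chains_vectorspace)

lemma pair_eq_sum:
  assumes "finite X" "{xs. c xs \<noteq> 0} \<subseteq> X"
  shows "pair f c = (\<Sum>xs\<in>X. c xs * f xs) mod int p"
  unfolding chain_pairing_def using assms
  by (intro arg_cong[where f = "\<lambda>x. x mod int p"] sum.mono_neutral_left) auto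

lemma pair_range: "0 \<le> pair f c" "pair f c < int p"
  using p_pos by (auto simp: chain_pairing_def)

lemma pair_mod: "pair f c mod int p = pair f c"
  by (simp add: chain_pairing_def)

lemma pair_add:
  assumes "c \<in> carrier (C n)" "d \<in> carrier (C n)"
  shows "[pair f (c \<oplus>\<^bsub>C n\<^esub> d) = pair f c + pair f d] (mod int p)"
proof -
  define X where "X = {xs. c xs \<noteq> 0} \<union> {xs. d xs \<noteq> 0}"
  have X: "finite X" "{xs. c xs \<noteq> 0} \<subseteq> X" "{xs. d xs \<noteq> 0} \<subseteq> X"
    "{xs. (c \<oplus>\<^bsub>C n\<^esub> d) xs \<noteq> 0} \<subseteq> X"
    using assms by (auto simp: X_def chains_iff chains_add)
  have "[(\<Sum>xs\<in>X. (c \<oplus>\<^bsub>C n\<^esub> d) xs * f xs) = (\<Sum>xs\<in>X. c xs * f xs + d xs * f xs)] (mod int p)"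
    by (intro cong_sum) (simp add: chains_add cong_def mod_simps algebra_simps)
  then show ?thesis
    using X by (simp add: pair_eq_sum cong_def mod_simps sum.distrib)
qed

lemma pair_smult:
  assumes "c \<in> carrier (C n)"
  shows "[pair f (a \<odot>\<^bsub>C n\<^esub> c) = a * pair f c] (mod int p)"
proof -
  define X where "X = {xs. c xs \<noteq> 0}"
  have X: "finite X" "{xs. c xs \<noteq> 0} \<subseteq> X" "{xs. (a \<odot>\<^bsub>C n\<^esub> c) xs \<noteq> 0} \<subseteq> X"
    using assms by (auto simp: X_def chains_iff chains_smult)
  have "[(\<Sum>xs\<in>X. (a \<odot>\<^bsub>C n\<^esub> c) xs * f xs) = (\<Sum>xs\<in>X. a * (c xs * f xs))] (mod int p)"
    by (intro cong_sum) (simp add: chains_smult cong_def mod_simps algebra_simps)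
  then show ?thesis
    using X by (simp add: pair_eq_sum cong_def mod_simps sum_distrib_left)
qed

lemma pair_zero: "pair f \<zero>\<^bsub>C n\<^esub> = 0"
  by (simp add: chain_pairing_def chains_zero)

lemma pair_cong:
  assumes "c \<in> carrier (C n)" "\<And>xs. xs \<in> bar_cells G n \<Longrightarrow> [f xs = g xs] (mod int p)"
  shows "pair f c = pair g c"
proof -
  have "[(\<Sum>xs | c xs \<noteq> 0. c xs * f xs) = (\<Sum>xs | c xs \<noteq> 0. c xs * g xs)] (mod int p)"
    using assms by (intro cong_sum cong_mult) (auto simp: chains_iff)
  then show ?thesis by (simp add: chain_pairing_def cong_def)
qed

lemma pair_diff: "[pair (\<lambda>xs. f xs - g xs) c = pair f c - pair g c] (mod int p)"
  by (simp add: chain_pairing_def cong_def mod_simps right_diff_distrib sum_subtractf)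

lemma pair_sum_left:
  "[pair (\<lambda>xs. \<Sum>i\<in>I. t i * f i xs) c = (\<Sum>i\<in>I. t i * pair (f i) c)] (mod int p)"
proof -
  have "(\<Sum>xs | c xs \<noteq> 0. c xs * (\<Sum>i\<in>I. t i * f i xs))
      = (\<Sum>i\<in>I. t i * (\<Sum>xs | c xs \<noteq> 0. c xs * f i xs))"
    unfolding sum_distrib_left by (subst sum.swap) (simp add: mult_ac)
  moreover have "[(\<Sum>i\<in>I. t i * (\<Sum>xs | c xs \<noteq> 0. c xs * f i xs)) = (\<Sum>i\<in>I. t i * pair (f i) c)] (mod int p)"
    by (intro cong_sum cong_mult) (auto simp: chain_pairing_def cong_def)
  ultimately show ?thesis by (simp add: chain_pairing_def cong_def mod_simps)
qed

lemma pair_finsum: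
  assumes "finite X" "F \<in> X \<rightarrow> carrier (C n)"
  shows "[pair f (\<Oplus>\<^bsub>C n\<^esub>x\<in>X. F x) = (\<Sum>x\<in>X. pair f (F x))] (mod int p)"
  using assms
proof (induction X rule: finite_induct)
  case empty
  then show ?case by (simp add: pair_zero)
next
  case (insert x X)
  then have F: "F \<in> X \<rightarrow> carrier (C n)" "F x \<in> carrier (C n)" by auto
  then have "[pair f (F x \<oplus>\<^bsub>C n\<^esub> (\<Oplus>\<^bsub>C n\<^esub>x\<in>X. F x)) = pair f (F x) + pair f (\<Oplus>\<^bsub>C n\<^esub>x\<in>X. F x)] (mod int p)"
    by (intro pair_add C.M.finsum_closed)
  also have "[pair f (F x) + pair f (\<Oplus>\<^bsub>C n\<^esub>x\<in>X. F x) = pair f (F x) + (\<Sum>x\<in>X. pair f (F x))] (mod int p)"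
    using insert.IH F by (intro cong_add) auto
  finally show ?case using insert F by simp
qed

text \<open>Pairing with the indicator function of one cell reads off the coefficient of that cell.\<close>

lemma chain_eqI:
  assumes "c \<in> carrier (C n)" "d \<in> carrier (C n)"
    and "\<And>f. [pair f c = pair f d] (mod int p)"
  shows "c = d"
proof
  fix ys
  have *: "pair (\<lambda>xs. if xs = ys then 1 else 0) e = e ys" if "e \<in> carrier (C n)" for e
    using that pair_eq_sum[of "insert ys {xs. e xs \<noteq> 0}" e "\<lambda>xs. if xs = ys then 1 else 0"]
    by (auto simp: chains_iff if_distrib[of "\<lambda>x. _ * x"] cong: if_cong)
  show "c ys = d ys"
    using assms(3)[of "\<lambda>xs. if xs = ys then 1 else 0"] assms(1,2) *
    by (auto simp: chains_iff cong_def)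
qed

lemma basis_closed:
  assumes "xs \<in> bar_cells G n"
  shows "bar_basis (prime_field p) xs \<in> carrier (C n)"
  using assms p_gt_1 by (auto simp: chains_iff bar_basis_def F.res_one_eq F.res_zero_eq)

lemma pair_basis: "pair f (bar_basis (prime_field p) xs) = f xs mod int p"
  by (subst pair_eq_sum[of "{xs}"]) (auto simp: bar_basis_def F.res_one_eq F.res_zero_eq)

lemma face_cell:
  assumes "xs \<in> bar_cells G n" "i \<le> n" "n \<ge> 1"
  shows "bar_face G i xs \<in> bar_cells G (n - 1)"
proof -
  have len: "length xs = n" and sub: "set xs \<subseteq> carrier G" using assms by (auto simp: bar_cells_def)
  consider "i = 0" | "i = n" "i > 0" | "0 < i" "i < n" using assms by linarith
  then show ?thesis
  proof cases
    case 1
    then show ?thesis using len sub by (cases xs) (auto simp: bar_cells_def bar_face_def)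
  next
    case 2
    then show ?thesis using len sub by (auto simp: bar_cells_def bar_face_def dest: in_set_butlastD)
  next
    case 3
    then have "xs ! (i - 1) \<in> carrier G" "xs ! i \<in> carrier G"
      using len sub by (auto intro!: subsetD[OF sub] nth_mem)
    then show ?thesis using 3 len sub
      by (auto simp: bar_cells_def bar_face_def dest!: in_set_takeD in_set_dropD)
  qed
qed

lemma sign_scalar: "(\<ominus>\<^bsub>prime_field p\<^esub> \<one>\<^bsub>prime_field p\<^esub>) [^]\<^bsub>prime_field p\<^esub> (i :: nat) = (- 1) ^ i mod int p"
proof -
  have "\<ominus>\<^bsub>prime_field p\<^esub> \<one>\<^bsub>prime_field p\<^esub> = (- 1) mod int p"
    by (simp add: F.res_neg_eq F.res_one_eq)
  then show ?thesis by (simp only: F.pow_cong)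
qed

lemma boundary_cell:
  assumes "xs \<in> bar_cells G n" "n \<ge> 1"
  shows "bar_boundary_cell (prime_field p) G n xs \<in> carrier (C (n - 1))"
    and "[pair f (bar_boundary_cell (prime_field p) G n xs) = bar_coboundary G n f xs] (mod int p)"
proof -
  let ?F = "\<lambda>i. ((- 1) ^ i mod int p) \<odot>\<^bsub>C (n - 1)\<^esub> bar_basis (prime_field p) (bar_face G i xs)"
  have F: "?F \<in> {0..n} \<rightarrow> carrier (C (n - 1))"
    using assms by (auto intro!: chains_smult_closed basis_closed face_cell simp del: One_nat_def)
  have eq: "bar_boundary_cell (prime_field p) G n xs = (\<Oplus>\<^bsub>C (n - 1)\<^esub>i\<in>{0..n}. ?F i)"
    by (simp add: bar_boundary_cell_def sign_scalar)
  show "bar_boundary_cell (prime_field p) G n xs \<in> carrier (C (n - 1))"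
    unfolding eq using F by (intro C.M.finsum_closed) auto
  have "[pair f (\<Oplus>\<^bsub>C (n - 1)\<^esub>i\<in>{0..n}. ?F i) = (\<Sum>i\<in>{0..n}. pair f (?F i))] (mod int p)"
    using F by (intro pair_finsum) auto
  also have "[(\<Sum>i\<in>{0..n}. pair f (?F i)) = (\<Sum>i\<in>{0..n}. (- 1) ^ i * f (bar_face G i xs))] (mod int p)"
  proof (intro cong_sum)
    fix i assume i: "i \<in> {0..n}"
    have "[pair f (?F i) = ((- 1) ^ i mod int p) * pair f (bar_basis (prime_field p) (bar_face G i xs))] (mod int p)"
      using assms i by (intro pair_smult basis_closed face_cell) auto
    then show "[pair f (?F i) = (- 1) ^ i * f (bar_face G i xs)] (mod int p)"
      by (simp add: pair_basis cong_def mod_simps)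
  qed
  finally show "[pair f (bar_boundary_cell (prime_field p) G n xs) = bar_coboundary G n f xs] (mod int p)"
    unfolding eq bar_coboundary_def atMost_atLeast0 .
qed

lemma boundary_closed:
  assumes "c \<in> carrier (C n)" "n \<ge> 1"
  shows "bar_boundary (prime_field p) G n c \<in> carrier (C (n - 1))"
  unfolding bar_boundary_def F.res_zero_eq
  by (intro C.M.finsum_closed Pi_I chains_smult_closed boundary_cell)
     (use assms in \<open>auto simp: chains_iff\<close>)

lemma pair_boundary:
  assumes c: "c \<in> carrier (C n)" and n: "n \<ge> 1"
  shows "pair f (bar_boundary (prime_field p) G n c) = pair (bar_coboundary G n f) c"
proof -
  let ?X = "{xs. c xs \<noteq> 0}"
  let ?F = "\<lambda>xs. c xs \<odot>\<^bsub>C (n - 1)\<^esub> bar_boundary_cell (prime_field p) G n xs"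
  have X: "finite ?X" "\<And>xs. xs \<in> ?X \<Longrightarrow> xs \<in> bar_cells G n" using c by (auto simp: chains_iff)
  have "[pair f (\<Oplus>\<^bsub>C (n - 1)\<^esub>xs\<in>?X. ?F xs) = (\<Sum>xs\<in>?X. pair f (?F xs))] (mod int p)"
    using X n by (intro pair_finsum Pi_I chains_smult_closed boundary_cell) auto
  also have "[(\<Sum>xs\<in>?X. pair f (?F xs)) = (\<Sum>xs\<in>?X. c xs * bar_coboundary G n f xs)] (mod int p)"
  proof (intro cong_sum)
    fix xs assume xs: "xs \<in> ?X"
    have "[pair f (?F xs) = c xs * pair f (bar_boundary_cell (prime_field p) G n xs)] (mod int p)"
      using X(2)[OF xs] n by (intro pair_smult boundary_cell) auto
    also have "[c xs * pair f (bar_boundary_cell (prime_field p) G n xs) = c xs * bar_coboundary G n f xs] (mod int p)"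
      using X(2)[OF xs] n by (intro cong_mult boundary_cell) auto
    finally show "[pair f (?F xs) = c xs * bar_coboundary G n f xs] (mod int p)" .
  qed
  finally have "[pair f (bar_boundary (prime_field p) G n c) = pair (bar_coboundary G n f) c] (mod int p)"
    by (simp add: bar_boundary_def F.res_zero_eq chain_pairing_def cong_def)
  then show ?thesis using pair_range[of f] pair_range[of "bar_coboundary G n f"] by (simp add: cong_def)
qed

lemma boundary_hom:
  assumes n: "n \<ge> 1"
  shows "mod_hom (prime_field p) (C n) (C (n - 1)) (bar_boundary (prime_field p) G n)"
proof -
  have "bar_boundary (prime_field p) G n (c \<oplus>\<^bsub>C n\<^esub> d)
      = bar_boundary (prime_field p) G n c \<oplus>\<^bsub>C (n - 1)\<^esub> bar_boundary (prime_field p) G n d"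
    if c: "c \<in> carrier (C n)" and d: "d \<in> carrier (C n)" for c d
  proof (rule chain_eqI)
    fix f
    have "[pair f (bar_boundary (prime_field p) G n (c \<oplus>\<^bsub>C n\<^esub> d))
       = pair (bar_coboundary G n f) c + pair (bar_coboundary G n f) d] (mod int p)"
      using c d n by (simp add: pair_boundary pair_add chains_add_closed)
    moreover have "[pair f (bar_boundary (prime_field p) G n c \<oplus>\<^bsub>C (n - 1)\<^esub> bar_boundary (prime_field p) G n d)
       = pair (bar_coboundary G n f) c + pair (bar_coboundary G n f) d] (mod int p)"
      using c d n pair_add[OF boundary_closed boundary_closed, of c n d f] by (simp add: pair_boundary)
    ultimately show "[pair f (bar_boundary (prime_field p) G n (c \<oplus>\<^bsub>C n\<^esub> d)) =
       pair f (bar_boundary (prime_field p) G n c \<oplus>\<^bsub>C (n - 1)\<^esub> bar_boundary (prime_field p) G n d)] (mod int p)"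
      by (simp add: cong_def)
  qed (use c d n in \<open>auto intro!: boundary_closed chains_add_closed simp del: One_nat_def\<close>)
  moreover have "bar_boundary (prime_field p) G n (a \<odot>\<^bsub>C n\<^esub> c)
      = a \<odot>\<^bsub>C (n - 1)\<^esub> bar_boundary (prime_field p) G n c"
    if c: "c \<in> carrier (C n)" for a c
  proof (rule chain_eqI)
    fix f
    have "[pair f (bar_boundary (prime_field p) G n (a \<odot>\<^bsub>C n\<^esub> c))
       = a * pair (bar_coboundary G n f) c] (mod int p)"
      using c n by (simp add: pair_boundary pair_smult chains_smult_closed)
    moreover have "[pair f (a \<odot>\<^bsub>C (n - 1)\<^esub> bar_boundary (prime_field p) G n c)
       = a * pair (bar_coboundary G n f) c] (mod int p)"
      using c n pair_smult[OF boundary_closed, of c n f a] by (simp add: pair_boundary)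
    ultimately show "[pair f (bar_boundary (prime_field p) G n (a \<odot>\<^bsub>C n\<^esub> c)) =
       pair f (a \<odot>\<^bsub>C (n - 1)\<^esub> bar_boundary (prime_field p) G n c)] (mod int p)"
      by (simp add: cong_def)
  qed (use c n in \<open>auto intro!: boundary_closed chains_smult_closed simp del: One_nat_def\<close>)
  ultimately show ?thesis
    unfolding mod_hom_def mod_hom_axioms_def LinearCombinations.module_hom_def
    using chains_module boundary_closed[OF _ n] by auto
qed

lemma chain_induct [consumes 1, case_names zero add]:
  assumes c: "c \<in> carrier (C n)"
    and zero: "P \<zero>\<^bsub>C n\<^esub>"
    and add: "\<And>a xs d. xs \<in> bar_cells G n \<Longrightarrow> a \<in> {0..<int p} \<Longrightarrow> d \<in> carrier (C n) \<Longrightarrow> P d \<Longrightarrow>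
       P ((a \<odot>\<^bsub>C n\<^esub> bar_basis (prime_field p) xs) \<oplus>\<^bsub>C n\<^esub> d)"
  shows "P c"
proof -
  have "finite X \<Longrightarrow> \<forall>c\<in>carrier (C n). {xs. c xs \<noteq> 0} \<subseteq> X \<longrightarrow> P c" for X
  proof (induction X rule: finite_induct)
    case empty
    have "c = \<zero>\<^bsub>C n\<^esub>" if "{xs. c xs \<noteq> 0} \<subseteq> {}" for c :: "'a list \<Rightarrow> int"
      using that by (auto simp: chains_zero)
    then show ?case using zero by blast
  next
    case (insert x X)
    show ?case
    proof (intro ballI impI)
      fix c assume c: "c \<in> carrier (C n)" and sub: "{xs. c xs \<noteq> 0} \<subseteq> insert x X"
      show "P c"
      proof (cases "c x = 0")
        case True
        then have "{xs. c xs \<noteq> 0} \<subseteq> X" using sub by auto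
        then show ?thesis using insert.IH c by blast
      next
        case False
        define d where "d = c(x := 0)"
        have "{xs. d xs \<noteq> 0} \<subseteq> {xs. c xs \<noteq> 0}" by (auto simp: d_def)
        then have d: "d \<in> carrier (C n)"
          using c finite_subset[of "{xs. d xs \<noteq> 0}"] p_pos by (auto simp: chains_iff d_def)
        have "{xs. d xs \<noteq> 0} \<subseteq> X" using sub by (auto simp: d_def)
        then have "P d" using insert.IH d by blast
        moreover have "c = (c x \<odot>\<^bsub>C n\<^esub> bar_basis (prime_field p) x) \<oplus>\<^bsub>C n\<^esub> d"
          using c by (auto simp: chains_iff chains_add chains_smult bar_basis_def
             F.res_one_eq F.res_zero_eq d_def fun_eq_iff)
        ultimately show ?thesis
          using add[of x "c x" d] False c d by (auto simp: chains_iff)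
      qed
    qed
  qed
  then show ?thesis using c by (auto simp: chains_iff)
qed

lemma coboundary_1: "bar_coboundary G 1 f [g] = 0"
  by (simp add: bar_coboundary_def bar_face_def)

lemma coboundary_2: "bar_coboundary G 2 f [g, h] = f [h] - f [g \<otimes> h] + f [g]"
  by (simp add: bar_coboundary_def bar_face_def numeral_2_eq_2)

lemma coboundary_3:
  "bar_coboundary G 3 f [g, h, k] = f [h, k] - f [g \<otimes> h, k] + f [g, h \<otimes> k] - f [g, h]"
  by (simp add: bar_coboundary_def bar_face_def numeral_3_eq_3)

lemma cells_1: "xs \<in> bar_cells G (Suc 0) \<longleftrightarrow> (\<exists>g\<in>carrier G. xs = [g])"
  by (auto simp: bar_cells_def length_Suc_conv)

lemma cells_2: "xs \<in> bar_cells G 2 \<longleftrightarrow> (\<exists>g\<in>carrier G. \<exists>h\<in>carrier G. xs = [g, h])"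
  by (auto simp: bar_cells_def length_Suc_conv numeral_2_eq_2)

lemma cells_3: "xs \<in> bar_cells G 3 \<longleftrightarrow>
    (\<exists>g\<in>carrier G. \<exists>h\<in>carrier G. \<exists>k\<in>carrier G. xs = [g, h, k])"
  by (auto simp: bar_cells_def length_Suc_conv numeral_3_eq_3)

lemma boundary_boundary:
  assumes "r \<in> {1, 2}" "c \<in> carrier (C (r + 1))"
  shows "bar_boundary (prime_field p) G r (bar_boundary (prime_field p) G (r + 1) c) = \<zero>\<^bsub>C (r - 1)\<^esub>"
proof (rule chain_eqI)
  fix f
  have cl: "bar_boundary (prime_field p) G (r + 1) c \<in> carrier (C r)"
    using boundary_closed[OF assms(2)] by simp
  show "bar_boundary (prime_field p) G r (bar_boundary (prime_field p) G (r + 1) c) \<in> carrier (C (r - 1))"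
    using assms boundary_closed[OF cl] by auto
  have "bar_coboundary G (r + 1) (bar_coboundary G r f) xs = 0" if "xs \<in> bar_cells G (r + 1)" for xs
  proof (cases "r = 1")
    case True
    then have "r + 1 = 2" by simp
    then show ?thesis using True that
      by (auto simp: cells_2 coboundary_1 coboundary_2 simp del: One_nat_def)
  next
    case False
    then have "r = 2" "r + 1 = 3" using assms(1) by simp_all
    then show ?thesis using that
      by (auto simp: cells_3 coboundary_2 coboundary_3 m_assoc)
  qed
  then have "pair (bar_coboundary G (r + 1) (bar_coboundary G r f)) c = pair (\<lambda>_. 0) c"
    using assms by (intro pair_cong) auto
  then show "[pair f (bar_boundary (prime_field p) G r (bar_boundary (prime_field p) G (r + 1) c))
      = pair f \<zero>\<^bsub>C (r - 1)\<^esub>] (mod int p)"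
    using assms cl by (auto simp: pair_boundary pair_zero) (auto simp: chain_pairing_def)
qed simp

end

section \<open>Homology classes in degrees one and two\<close>

context prime_bar_complex
begin

abbreviation "cycles r \<equiv> (C r)\<lparr>carrier := bar_cycles (prime_field p) G r\<rparr>"
abbreviation "bd r \<equiv> bar_boundary (prime_field p) G r"
abbreviation "cell xs \<equiv> bar_basis (prime_field p) xs"

lemma cycles_submodule:
  assumes "r \<ge> 1"
  shows "submodule (prime_field p) (bar_cycles (prime_field p) G r) (C r)"
proof -
  interpret mod_hom "prime_field p" "C r" "C (r - 1)" "bd r" by (rule boundary_hom[OF assms])
  have "bar_cycles (prime_field p) G r = ker" using assms by (auto simp: bar_cycles_def ker_def simp del: One_nat_def)
  then show ?thesis using ker_is_submodule by simp
qed

lemma cycles_vectorspace: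
  assumes "r \<ge> 1"
  shows "vectorspace (prime_field p) (cycles r)"
  using C.submodule_is_module[OF cycles_submodule[OF assms]] F.is_field by (simp add: vectorspace_def)

lemma boundaries_submodule:
  assumes "r \<in> {1, 2}"
  shows "submodule (prime_field p) (bar_boundaries (prime_field p) G r) (cycles r)"
proof -
  interpret mod_hom "prime_field p" "C (r + 1)" "C r" "bd (r + 1)"
    using boundary_hom[of "r + 1"] by simp
  have "bar_boundaries (prime_field p) G r = im" unfolding bar_boundaries_def im_def ..
  then have B: "submodule (prime_field p) (bar_boundaries (prime_field p) G r) (C r)"
    using im_is_submodule by simp
  have "bar_boundaries (prime_field p) G r \<subseteq> bar_cycles (prime_field p) G r"
    using boundary_boundary[OF assms] boundary_closed[of _ "r + 1"]
    by (auto simp: bar_boundaries_def bar_cycles_def)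
  then show ?thesis
    using B cycles_vectorspace[of r] assms by (auto simp: submodule_def vectorspace_def)
qed

lemma cycles_sub: "bar_cycles (prime_field p) G r \<subseteq> carrier (C r)"
  by (auto simp: bar_cycles_def)

lemma cycles_finsum:
  assumes r: "r \<ge> 1" and X: "finite X" "F \<in> X \<rightarrow> bar_cycles (prime_field p) G r"
  shows "(\<Oplus>\<^bsub>cycles r\<^esub>x\<in>X. F x) = (\<Oplus>\<^bsub>C r\<^esub>x\<in>X. F x)"
proof -
  have "mod_hom (prime_field p) (cycles r) (C r) (\<lambda>x. x)"
    using cycles_vectorspace[OF r] chains_module cycles_sub
    by (auto simp: mod_hom_def mod_hom_axioms_def LinearCombinations.module_hom_def vectorspace_def)
  then interpret mod_hom "prime_field p" "cycles r" "C r" "\<lambda>x. x" .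
  show ?thesis using hom_finsum[OF X(1), of F] X(2) by simp
qed

text \<open>The order of the quantifiers matters: the same chain \<open>e\<close> serves all cochains \<open>f\<close>, so that the
congruences express an equality of chains.\<close>

lemma homology_coordinates:
  assumes r: "r \<in> {1, 2}" and fin: "finite_betti r p G"
  obtains rep \<kappa> where
    "\<And>i. i < betti r p G \<Longrightarrow> rep i \<in> bar_cycles (prime_field p) G r"
    "\<And>i c. i < betti r p G \<Longrightarrow> c \<in> bar_cycles (prime_field p) G r \<Longrightarrow> \<kappa> i c \<in> {0..<int p}"
    "\<And>i c d. i < betti r p G \<Longrightarrow> c \<in> bar_cycles (prime_field p) G r \<Longrightarrow>
       d \<in> bar_cycles (prime_field p) G r \<Longrightarrow> \<kappa> i (c \<oplus>\<^bsub>C r\<^esub> d) = (\<kappa> i c + \<kappa> i d) mod int p"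
    "\<And>i a c. i < betti r p G \<Longrightarrow> c \<in> bar_cycles (prime_field p) G r \<Longrightarrow> a \<in> {0..<int p} \<Longrightarrow>
       \<kappa> i (a \<odot>\<^bsub>C r\<^esub> c) = (a * \<kappa> i c) mod int p"
    "\<And>i e. i < betti r p G \<Longrightarrow> e \<in> carrier (C (r + 1)) \<Longrightarrow> \<kappa> i (bd (r + 1) e) = 0"
    "\<And>i j. i < betti r p G \<Longrightarrow> j < betti r p G \<Longrightarrow> \<kappa> i (rep j) = (if i = j then 1 else 0)"
    "\<And>c. c \<in> bar_cycles (prime_field p) G r \<Longrightarrow> \<exists>e\<in>carrier (C (r + 1)). \<forall>f.
       [pair f c = pair (bar_coboundary G (r + 1) f) e + (\<Sum>i<betti r p G. \<kappa> i c * pair f (rep i))] (mod int p)"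
proof -
  have r1: "r \<ge> 1" using r by auto
  have dim: "vectorspace.dim (prime_field p) (quotient_module (cycles r) (bar_boundaries (prime_field p) G r))
      = betti r p G" by (simp add: betti_def group_homology_def)
  have fin': "vectorspace.fin_dim (prime_field p)
      (quotient_module (cycles r) (bar_boundaries (prime_field p) G r))"
    using fin by (simp add: finite_betti_def group_homology_def)
  show ?thesis
  proof (rule quotient_coordinates[OF cycles_vectorspace[OF r1] boundaries_submodule[OF r] fin', unfolded dim])
    fix rep \<kappa>
    assume K:
      "\<And>i. i < betti r p G \<Longrightarrow> rep i \<in> carrier (cycles r)"
      "\<And>i x. x \<in> carrier (cycles r) \<Longrightarrow> i < betti r p G \<Longrightarrow> \<kappa> i x \<in> carrier (prime_field p)"
      "\<And>i x y. x \<in> carrier (cycles r) \<Longrightarrow> y \<in> carrier (cycles r) \<Longrightarrow> i < betti r p G \<Longrightarrow>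
         \<kappa> i (x \<oplus>\<^bsub>cycles r\<^esub> y) = \<kappa> i x \<oplus>\<^bsub>prime_field p\<^esub> \<kappa> i y"
      "\<And>i a x. a \<in> carrier (prime_field p) \<Longrightarrow> x \<in> carrier (cycles r) \<Longrightarrow> i < betti r p G \<Longrightarrow>
         \<kappa> i (a \<odot>\<^bsub>cycles r\<^esub> x) = a \<otimes>\<^bsub>prime_field p\<^esub> \<kappa> i x"
      "\<And>i x. x \<in> bar_boundaries (prime_field p) G r \<Longrightarrow> i < betti r p G \<Longrightarrow> \<kappa> i x = \<zero>\<^bsub>prime_field p\<^esub>"
      "\<And>i j. i < betti r p G \<Longrightarrow> j < betti r p G \<Longrightarrow>
         \<kappa> i (rep j) = (if i = j then \<one>\<^bsub>prime_field p\<^esub> else \<zero>\<^bsub>prime_field p\<^esub>)"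
      "\<And>x. x \<in> carrier (cycles r) \<Longrightarrow> \<exists>n\<in>bar_boundaries (prime_field p) G r. x = n \<oplus>\<^bsub>cycles r\<^esub>
         (\<Oplus>\<^bsub>cycles r\<^esub>i\<in>{..<betti r p G}. \<kappa> i x \<odot>\<^bsub>cycles r\<^esub> rep i)"
    show thesis
    proof (rule that[of rep \<kappa>])
      fix c assume c: "c \<in> bar_cycles (prime_field p) G r"
      let ?b = "betti r p G"
      let ?F = "\<lambda>i. \<kappa> i c \<odot>\<^bsub>C r\<^esub> rep i"
      interpret S: submodule "prime_field p" "bar_cycles (prime_field p) G r" "C r"
        by (rule cycles_submodule[OF r1])
      have F: "?F \<in> {..<?b} \<rightarrow> bar_cycles (prime_field p) G r"
        using K(1,2) c by auto
      then have F': "?F \<in> {..<?b} \<rightarrow> carrier (C r)" using cycles_sub by blast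
      obtain e where e: "e \<in> carrier (C (r + 1))"
        "c = bd (r + 1) e \<oplus>\<^bsub>C r\<^esub> (\<Oplus>\<^bsub>C r\<^esub>i\<in>{..<?b}. ?F i)"
        using K(7)[of c] c cycles_finsum[OF r1 _ F] by (auto simp: bar_boundaries_def)
      have "[pair f c = pair (bar_coboundary G (r + 1) f) e + (\<Sum>i<?b. \<kappa> i c * pair f (rep i))] (mod int p)" for f
      proof -
        have "bd (r + 1) e \<in> carrier (C r)" using boundary_closed[OF e(1)] by simp
        then have "[pair f (bd (r + 1) e \<oplus>\<^bsub>C r\<^esub> (\<Oplus>\<^bsub>C r\<^esub>i\<in>{..<?b}. ?F i))
            = pair f (bd (r + 1) e) + pair f (\<Oplus>\<^bsub>C r\<^esub>i\<in>{..<?b}. ?F i)] (mod int p)"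
          using F' by (intro pair_add C.M.finsum_closed)
        then have "[pair f c = pair f (bd (r + 1) e) + pair f (\<Oplus>\<^bsub>C r\<^esub>i\<in>{..<?b}. ?F i)] (mod int p)"
          by (simp only: e(2)[symmetric])
        also have "[pair f (bd (r + 1) e) + pair f (\<Oplus>\<^bsub>C r\<^esub>i\<in>{..<?b}. ?F i)
            = pair f (bd (r + 1) e) + (\<Sum>i<?b. pair f (?F i))] (mod int p)"
          using F' by (intro cong_add cong_refl pair_finsum) auto
        also have "[pair f (bd (r + 1) e) + (\<Sum>i<?b. pair f (?F i))
            = pair f (bd (r + 1) e) + (\<Sum>i<?b. \<kappa> i c * pair f (rep i))] (mod int p)"
          using K(1) cycles_sub by (intro cong_add cong_refl cong_sum pair_smult) auto
        also have "pair f (bd (r + 1) e) = pair (bar_coboundary G (r + 1) f) e"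
          using e(1) by (intro pair_boundary) auto
        finally show ?thesis .
      qed
      then show "\<exists>e\<in>carrier (C (r + 1)). \<forall>f.
         [pair f c = pair (bar_coboundary G (r + 1) f) e + (\<Sum>i<?b. \<kappa> i c * pair f (rep i))] (mod int p)"
        using e(1) by blast
    qed (use K in \<open>auto simp: carrier_F F.res_add_eq F.res_mult_eq F.res_zero_eq F.res_one_eq bar_boundaries_def\<close>)
  qed
qed

text \<open>The two faces of a one-cell are both the empty tuple and cancel.\<close>

lemma cycles_1: "bar_cycles (prime_field p) G 1 = carrier (C 1)"
proof -
  have "bd 1 c = \<zero>\<^bsub>C 0\<^esub>" if c: "c \<in> carrier (C 1)" for c
  proof (rule chain_eqI)
    show "bd 1 c \<in> carrier (C 0)" using boundary_closed[OF c] by simp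
    have "pair (bar_coboundary G 1 f) c = pair (\<lambda>_. 0) c" for f
      using c by (intro pair_cong) (auto simp: cells_1 coboundary_1[simplified])
    then show "[pair f (bd 1 c) = pair f \<zero>\<^bsub>C 0\<^esub>] (mod int p)" for f
      using pair_boundary[OF c, of f] by (simp add: pair_zero) (simp add: chain_pairing_def)
  qed simp
  then show ?thesis by (auto simp: bar_cycles_def)
qed

lemma cell_add:
  assumes "g \<in> carrier G" "h \<in> carrier G"
  shows "cell [g] \<oplus>\<^bsub>C 1\<^esub> cell [h] = bd 2 (cell [g, h]) \<oplus>\<^bsub>C 1\<^esub> cell [g \<otimes> h]"
proof -
  have c2: "cell [g, h] \<in> carrier (C 2)" using assms by (intro basis_closed) (auto simp: cells_2)
  have c1: "cell [x] \<in> carrier (C 1)" if "x \<in> carrier G" for x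
    using that by (intro basis_closed) (auto simp: cells_1)
  have b: "bd 2 (cell [g, h]) \<in> carrier (C 1)" using boundary_closed[OF c2] by simp
  show ?thesis
  proof (rule chain_eqI)
    fix f
    have "[pair f (cell [g] \<oplus>\<^bsub>C 1\<^esub> cell [h]) = f [g] + f [h]] (mod int p)"
      using pair_add[OF c1 c1, of g h f] assms by (simp add: pair_basis cong_def mod_simps)
    moreover have "[pair f (bd 2 (cell [g, h]) \<oplus>\<^bsub>C 1\<^esub> cell [g \<otimes> h]) = f [g] + f [h]] (mod int p)"
      using pair_add[OF b c1, of "g \<otimes> h" f] assms pair_boundary[OF c2, of f]
      by (simp add: pair_basis cong_def mod_simps coboundary_2 add.commute)
    ultimately show "[pair f (cell [g] \<oplus>\<^bsub>C 1\<^esub> cell [h]) =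
      pair f (bd 2 (cell [g, h]) \<oplus>\<^bsub>C 1\<^esub> cell [g \<otimes> h])] (mod int p)"
      by (simp add: cong_def)
  qed (use assms c1 b in \<open>auto intro!: chains_add_closed simp del: One_nat_def\<close>)
qed

text \<open>By \<open>cell_add\<close> the class of \<open>[g]\<close> is additive in \<open>g\<close>, so the classes of generators of the group span
the first homology.\<close>

lemma finite_betti_1:
  notes One_nat_def [simp del]
  assumes S: "finite S" "S \<subseteq> carrier G" "generate G S = carrier G"
  shows "finite_betti 1 p G"
proof -
  let ?B = "bar_boundaries (prime_field p) G 1"
  let ?Q = "quotient_module (cycles 1) ?B"
  let ?T = "\<lambda>x. ?B +>\<^bsub>cycles 1\<^esub> x"
  have sub: "submodule (prime_field p) ?B (cycles 1)" by (rule boundaries_submodule) simp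
  interpret Q: vectorspace "prime_field p" ?Q
    using module_quotient[OF sub] F.is_field by (simp add: vectorspace_def)
  interpret T: mod_hom "prime_field p" "cycles 1" ?Q ?T by (rule quotient_map_hom[OF sub])
  have c1: "cell [x] \<in> carrier (cycles 1)" if "x \<in> carrier G" for x
    using that basis_closed[of "[x]" 1] by (simp add: cycles_1 cells_1 [folded One_nat_def])
  define A where "A = (\<lambda>s. ?T (cell [s])) ` S"
  have A: "finite A" "A \<subseteq> carrier ?Q" unfolding A_def using S T.f_im[OF c1] by auto
  interpret A: submodule "prime_field p" "Q.span A" ?Q using A by (intro Q.span_is_submodule)
  have add: "?T (cell [g \<otimes> h]) = ?T (cell [g]) \<oplus>\<^bsub>?Q\<^esub> ?T (cell [h])"
    if "g \<in> carrier G" "h \<in> carrier G" for g h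
  proof -
    have "bd 2 (cell [g, h]) \<in> ?B"
      using that basis_closed[of "[g, h]" 2] by (auto simp: bar_boundaries_def cells_2 Suc_1 simp del: One_nat_def)
    moreover have "cell [g] \<oplus>\<^bsub>C 1\<^esub> cell [h] \<in> carrier (cycles 1)"
      using c1 that chains_add_closed[of "cell [g]" 1 "cell [h]"] by (simp add: cycles_1)
    ultimately have "?T (cell [g] \<oplus>\<^bsub>cycles 1\<^esub> cell [h]) = ?T (cell [g \<otimes> h])"
      using cell_add[OF that] that c1
      by (subst quotient_map_eq_iff[OF sub]) (auto intro!: bexI[of _ "bd 2 (cell [g, h])"])
    then show ?thesis using T.f_add[OF c1[OF that(1)] c1[OF that(2)]] by (rule trans[OF sym])
  qed
  have one: "?T (cell [\<one>]) = \<zero>\<^bsub>?Q\<^esub>"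
    using add[of \<one> \<one>] T.f_im[OF c1[of \<one>]] Q.M.add.r_cancel_one'[of "?T (cell [\<one>])" "?T (cell [\<one>])"]
    by simp
  have gen: "?T (cell [g]) \<in> Q.span A" if "g \<in> generate G S" for g
    using that
  proof (induction rule: generate.induct)
    case one
    then show ?case using \<open>?T (cell [\<one>]) = _\<close> by simp
  next
    case (incl h)
    then have "?T (cell [h]) \<in> A" by (simp add: A_def)
    then show ?case using A(2) Q.span_mem by blast
  next
    case (inv h)
    then have h: "h \<in> carrier G" "?T (cell [h]) \<in> A" using S by (auto simp: A_def)
    then have hs: "?T (cell [h]) \<in> Q.span A" using A(2) Q.span_mem by blast
    have "?T (cell [h]) \<oplus>\<^bsub>?Q\<^esub> ?T (cell [inv h]) = \<zero>\<^bsub>?Q\<^esub>"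
      using add[of h "inv h"] one h by simp
    then have "?T (cell [inv h]) = \<ominus>\<^bsub>?Q\<^esub> ?T (cell [h])"
      using T.f_im[OF c1] h(1) by (metis Q.M.add.inv_equality Q.M.a_comm inv_closed)
    also have "\<dots> = (\<ominus>\<^bsub>prime_field p\<^esub> \<one>\<^bsub>prime_field p\<^esub>) \<odot>\<^bsub>?Q\<^esub> ?T (cell [h])"
      using T.f_im[OF c1] h(1) by (metis Q.smult_minus_1)
    also have "\<dots> \<in> Q.span A" using hs by (intro A.smult_closed) auto
    finally show ?case .
  next
    case (eng g h)
    then have "g \<in> carrier G" "h \<in> carrier G" using S(3) by auto
    then show ?case using add[of g h] eng by simp
  qed
  have "?T c \<in> Q.span A" if "c \<in> carrier (C 1)" for c
    using that
  proof (induction rule: chain_induct)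
    case zero
    then show ?case using T.f0_is_0 by simp
  next
    case (add a xs d)
    then obtain g where g: "g \<in> carrier G" "xs = [g]" by (auto simp: cells_1 [folded One_nat_def])
    have a: "a \<in> carrier (prime_field p)" using add by (simp add: carrier_F)
    have d: "d \<in> carrier (cycles 1)" using add by (simp add: cycles_1)
    have "?T ((a \<odot>\<^bsub>cycles 1\<^esub> cell [g]) \<oplus>\<^bsub>cycles 1\<^esub> d) = (a \<odot>\<^bsub>?Q\<^esub> ?T (cell [g])) \<oplus>\<^bsub>?Q\<^esub> ?T d"
    proof -
      have "a \<odot>\<^bsub>cycles 1\<^esub> cell [g] \<in> carrier (cycles 1)"
        using c1[OF g(1)] by (simp add: cycles_1 chains_smult_closed)
      then show ?thesis using T.f_add[OF _ d] T.f_smult[OF a c1[OF g(1)]] by (simp only:)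
    qed
    moreover have "\<dots> \<in> Q.span A" using add gen[of g] g S a by auto
    ultimately show ?case using g by simp
  qed
  moreover have "carrier (cycles 1) = carrier (C 1)" by (simp add: cycles_1)
  ultimately have "carrier ?Q \<subseteq> Q.span A"
    unfolding carrier_quotient[OF sub] by blast
  then have "Q.span A = carrier ?Q" using A.subset by blast
  then have "Q.fin_dim" unfolding Q.fin_dim_def using A by blast
  then show ?thesis by (simp add: finite_betti_def group_homology_def)
qed

end

section \<open>Homomorphisms and two-cocycles modulo a prime\<close>

text \<open>Values are represented in \<open>{0..<p}\<close>, and the value outside the carrier is fixed to be 0. Thus
distinct members are distinct homomorphisms, and the cardinality is meaningful.\<close>

definition mod_homs :: "nat \<Rightarrow> ('g, 'm) monoid_scheme \<Rightarrow> ('g \<Rightarrow> int) set"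
  where "mod_homs p H = {\<eta>. (\<forall>g. \<eta> g \<in> {0..<int p}) \<and> (\<forall>g. g \<notin> carrier H \<longrightarrow> \<eta> g = 0) \<and>
     (\<forall>g\<in>carrier H. \<forall>h\<in>carrier H. \<eta> (g \<otimes>\<^bsub>H\<^esub> h) = (\<eta> g + \<eta> h) mod int p)}"

context prime_bar_complex
begin

lemma pair_hom_boundary:
  assumes \<eta>: "\<eta> \<in> mod_homs p G" and e: "e \<in> carrier (C 2)"
  shows "pair (bar_coboundary G 2 (\<lambda>xs. \<eta> (hd xs))) e = 0"
proof -
  have "pair (bar_coboundary G 2 (\<lambda>xs. \<eta> (hd xs))) e = pair (\<lambda>_. 0) e"
    using e
  proof (rule pair_cong)
    fix xs assume "xs \<in> bar_cells G 2"
    then obtain g h where "g \<in> carrier G" "h \<in> carrier G" "xs = [g, h]" by (auto simp: cells_2)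
    moreover from this have "\<eta> h - \<eta> (g \<otimes> h) + \<eta> g = int p * ((\<eta> g + \<eta> h) div int p)"
      using \<eta> by (simp add: mod_homs_def minus_mult_div_eq_mod[symmetric])
    ultimately show "[bar_coboundary G 2 (\<lambda>xs. \<eta> (hd xs)) xs = 0] (mod int p)"
      by (simp add: coboundary_2 cong_def)
  qed
  then show ?thesis by (simp add: chain_pairing_def)
qed

lemma cell_1_closed: "g \<in> carrier G \<Longrightarrow> cell [g] \<in> carrier (C 1)"
  by (intro basis_closed) (auto simp: cells_1)

lemma pair_functional:
  assumes add: "\<And>c d. c \<in> carrier (C n) \<Longrightarrow> d \<in> carrier (C n) \<Longrightarrow> L (c \<oplus>\<^bsub>C n\<^esub> d) = (L c + L d) mod int p"
    and smult: "\<And>a c. c \<in> carrier (C n) \<Longrightarrow> a \<in> {0..<int p} \<Longrightarrow> L (a \<odot>\<^bsub>C n\<^esub> c) = (a * L c) mod int p"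
    and c: "c \<in> carrier (C n)"
  shows "[pair (\<lambda>xs. L (cell xs)) c = L c] (mod int p)"
  using c
proof (induction rule: chain_induct)
  case zero
  have "L (0 \<odot>\<^bsub>C n\<^esub> \<zero>\<^bsub>C n\<^esub>) = (0 * L \<zero>\<^bsub>C n\<^esub>) mod int p"
    using p_pos by (intro smult) auto
  moreover have "0 \<odot>\<^bsub>C n\<^esub> \<zero>\<^bsub>C n\<^esub> = \<zero>\<^bsub>C n\<^esub>"
    by (simp add: chains_smult chains_zero)
  ultimately show ?case by (simp add: pair_zero cong_def)
next
  case (add a xs d)
  let ?L = "\<lambda>xs. L (cell xs)"
  have cl: "cell xs \<in> carrier (C n)" "a \<odot>\<^bsub>C n\<^esub> cell xs \<in> carrier (C n)"
    using add by (auto intro!: basis_closed chains_smult_closed)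
  have "[pair ?L ((a \<odot>\<^bsub>C n\<^esub> cell xs) \<oplus>\<^bsub>C n\<^esub> d) = pair ?L (a \<odot>\<^bsub>C n\<^esub> cell xs) + pair ?L d] (mod int p)"
    using cl add by (intro pair_add)
  also have "[pair ?L (a \<odot>\<^bsub>C n\<^esub> cell xs) + pair ?L d = a * pair ?L (cell xs) + L d] (mod int p)"
    using cl add by (intro cong_add pair_smult)
  also have "[a * pair ?L (cell xs) + L d = a * L (cell xs) + L d] (mod int p)"
    by (intro cong_add cong_mult cong_refl) (simp add: pair_basis cong_def)
  also have "[a * L (cell xs) + L d = L ((a \<odot>\<^bsub>C n\<^esub> cell xs) \<oplus>\<^bsub>C n\<^esub> d)] (mod int p)"
    using cl add by (simp add: assms(1) smult cong_def mod_simps)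
  finally show ?case .
qed

text \<open>The coordinates of the class of \<open>[g]\<close> are homomorphisms in \<open>g\<close>. The last property says that
\<open>[g] - (\<Sum>i. \<kappa> i g * rep i)\<close> is a boundary, tested against cochains.\<close>

lemma first_homology_coordinates:
  assumes fin: "finite_betti 1 p G"
  obtains rep \<kappa> where
    "\<And>i. i < betti 1 p G \<Longrightarrow> rep i \<in> carrier (C 1)"
    "\<And>i g h. i < betti 1 p G \<Longrightarrow> g \<in> carrier G \<Longrightarrow> h \<in> carrier G \<Longrightarrow>
       \<kappa> i (g \<otimes> h) = (\<kappa> i g + \<kappa> i h) mod int p"
    "\<And>i j. i < betti 1 p G \<Longrightarrow> j < betti 1 p G \<Longrightarrow>
       [pair (\<lambda>xs. \<kappa> i (hd xs)) (rep j) = (if i = j then 1 else 0)] (mod int p)"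
    "\<And>g. g \<in> carrier G \<Longrightarrow> \<exists>e\<in>carrier (C 2). \<forall>f.
       [f [g] = pair (bar_coboundary G 2 f) e + (\<Sum>i<betti 1 p G. \<kappa> i g * pair f (rep i))] (mod int p)"
proof (rule homology_coordinates[OF insertI1 fin, unfolded cycles_1 one_add_one])
  define b where "b = betti 1 p G"
  fix rep \<kappa>
  assume "\<And>i. i < betti 1 p G \<Longrightarrow> rep i \<in> carrier (C 1)"
    "\<And>i c. i < betti 1 p G \<Longrightarrow> c \<in> carrier (C 1) \<Longrightarrow> \<kappa> i c \<in> {0..<int p}"
    "\<And>i c d. i < betti 1 p G \<Longrightarrow> c \<in> carrier (C 1) \<Longrightarrow> d \<in> carrier (C 1) \<Longrightarrow>
       \<kappa> i (c \<oplus>\<^bsub>C 1\<^esub> d) = (\<kappa> i c + \<kappa> i d) mod int p"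
    "\<And>i a c. i < betti 1 p G \<Longrightarrow> c \<in> carrier (C 1) \<Longrightarrow> a \<in> {0..<int p} \<Longrightarrow>
       \<kappa> i (a \<odot>\<^bsub>C 1\<^esub> c) = (a * \<kappa> i c) mod int p"
    "\<And>i e. i < betti 1 p G \<Longrightarrow> e \<in> carrier (C 2) \<Longrightarrow> \<kappa> i (bd 2 e) = 0"
    "\<And>i j. i < betti 1 p G \<Longrightarrow> j < betti 1 p G \<Longrightarrow> \<kappa> i (rep j) = (if i = j then 1 else 0)"
    "\<And>c. c \<in> carrier (C 1) \<Longrightarrow> \<exists>e\<in>carrier (C 2). \<forall>f.
       [pair f c = pair (bar_coboundary G 2 f) e + (\<Sum>i<betti 1 p G. \<kappa> i c * pair f (rep i))] (mod int p)"
  note K = this[folded b_def]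
  have \<kappa>_mult: "\<kappa> i (cell [g \<otimes> h]) = (\<kappa> i (cell [g]) + \<kappa> i (cell [h])) mod int p"
    if "i < b" "g \<in> carrier G" "h \<in> carrier G" for i g h
  proof -
    have gh: "cell [g, h] \<in> carrier (C 2)" using that by (intro basis_closed) (auto simp: cells_2)
    have bgh: "bd 2 (cell [g, h]) \<in> carrier (C 1)" using boundary_closed[OF gh] by simp
    have "\<kappa> i (cell [g] \<oplus>\<^bsub>C 1\<^esub> cell [h]) = \<kappa> i (bd 2 (cell [g, h]) \<oplus>\<^bsub>C 1\<^esub> cell [g \<otimes> h])"
      using cell_add that by simp
    then show ?thesis
      using K(2)[of i "cell [g \<otimes> h]"] K(3,5) that gh bgh cell_1_closed by simp
  qed
  show thesis
  proof (rule that[of rep "\<lambda>i g. \<kappa> i (cell [g])"], unfold b_def[symmetric])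
    fix i j assume i: "i < b" and j: "j < b"
    have "pair (\<lambda>xs. \<kappa> i (cell [hd xs])) (rep j) = pair (\<lambda>xs. \<kappa> i (cell xs)) (rep j)"
      using K(1)[OF j] by (rule pair_cong) (auto simp: cells_1)
    also have "[\<dots> = \<kappa> i (rep j)] (mod int p)"
      using i K(1)[OF j] K(3,4) by (intro pair_functional) auto
    finally show "[pair (\<lambda>xs. \<kappa> i (cell [hd xs])) (rep j) = (if i = j then 1 else 0)] (mod int p)"
      using i j by (simp only: K(6))
  next
    fix g assume "g \<in> carrier G"
    from K(7)[OF cell_1_closed[OF this]]
    show "\<exists>e\<in>carrier (C 2). \<forall>f. [f [g] = pair (bar_coboundary G 2 f) e
      + (\<Sum>i<b. \<kappa> i (cell [g]) * pair f (rep i))] (mod int p)"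
      by (simp add: pair_basis)
  qed (fact K(1), fact \<kappa>_mult)
qed

text \<open>The homomorphisms are exactly the linear combinations of the coordinates \<open>\<kappa> i\<close>; the coefficients of a
homomorphism are its values on the representatives \<open>rep i\<close>, for a homomorphism vanishes on boundaries.\<close>

lemma card_mod_homs:
  assumes fin: "finite_betti 1 p G"
  shows "finite (mod_homs p G)" and "card (mod_homs p G) = p ^ betti 1 p G"
proof -
  define b where "b = betti 1 p G"
  obtain rep \<kappa> where K:
    "\<And>i. i < b \<Longrightarrow> rep i \<in> carrier (C 1)"
    "\<And>i g h. i < b \<Longrightarrow> g \<in> carrier G \<Longrightarrow> h \<in> carrier G \<Longrightarrow>
       \<kappa> i (g \<otimes> h) = (\<kappa> i g + \<kappa> i h) mod int p"
    "\<And>i j. i < b \<Longrightarrow> j < b \<Longrightarrow>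
       [pair (\<lambda>xs. \<kappa> i (hd xs)) (rep j) = (if i = j then 1 else 0)] (mod int p)"
    "\<And>g. g \<in> carrier G \<Longrightarrow> \<exists>e\<in>carrier (C 2). \<forall>f.
       [f [g] = pair (bar_coboundary G 2 f) e + (\<Sum>i<b. \<kappa> i g * pair f (rep i))] (mod int p)"
    unfolding b_def by (rule first_homology_coordinates[OF fin]) blast
  define hom where "hom t g = (if g \<in> carrier G then (\<Sum>i<b. t i * \<kappa> i g) mod int p else 0)"
    for t :: "nat \<Rightarrow> int" and g
  define co where "co \<eta> = restrict (\<lambda>i. pair (\<lambda>xs. \<eta> (hd xs)) (rep i)) {..<b}" for \<eta>
  have "bij_betw hom ({..<b} \<rightarrow>\<^sub>E {0..<int p}) (mod_homs p G)"
  proof (rule bij_betw_byWitness[where f' = co])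
    show "\<forall>t\<in>{..<b} \<rightarrow>\<^sub>E {0..<int p}. co (hom t) = t"
    proof
      fix t assume t: "t \<in> {..<b} \<rightarrow>\<^sub>E {0..<int p}"
      show "co (hom t) = t"
      proof
        fix j
        show "co (hom t) j = t j"
        proof (cases "j < b")
          case True
          have "pair (\<lambda>xs. hom t (hd xs)) (rep j) = pair (\<lambda>xs. \<Sum>i<b. t i * \<kappa> i (hd xs)) (rep j)"
            using K(1)[OF True] by (rule pair_cong) (auto simp: cells_1 hom_def cong_def)
          also have "[\<dots> = (\<Sum>i<b. t i * pair (\<lambda>xs. \<kappa> i (hd xs)) (rep j))] (mod int p)"
            by (rule pair_sum_left)
          also have "[(\<Sum>i<b. t i * pair (\<lambda>xs. \<kappa> i (hd xs)) (rep j))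
              = (\<Sum>i<b. t i * (if i = j then 1 else 0))] (mod int p)"
            using True K(3) by (intro cong_sum cong_mult cong_refl) auto
          also have "(\<Sum>i<b. t i * (if i = j then 1 else 0)) = (\<Sum>i<b. if i = j then t i else 0)"
            by (intro sum.cong) auto
          also have "\<dots> = t j" using True by simp
          finally show ?thesis
            using t True by (auto simp: co_def cong_def PiE_iff pair_mod)
        next
          case False
          then show ?thesis using t by (auto simp: co_def PiE_iff extensional_def)
        qed
      qed
    qed
    show "\<forall>\<eta>\<in>mod_homs p G. hom (co \<eta>) = \<eta>"
    proof
      fix \<eta> assume \<eta>: "\<eta> \<in> mod_homs p G"
      show "hom (co \<eta>) = \<eta>"
      proof
        fix g
        show "hom (co \<eta>) g = \<eta> g"
        proof (cases "g \<in> carrier G")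
          case True
          let ?f = "\<lambda>xs. \<eta> (hd xs)"
          obtain e where e: "e \<in> carrier (C 2)"
            "\<forall>f. [f [g] = pair (bar_coboundary G 2 f) e + (\<Sum>i<b. \<kappa> i g * pair f (rep i))] (mod int p)"
            using K(4)[OF True] by (rule bexE)
          from this(2) have "[?f [g] = pair (bar_coboundary G 2 ?f) e + (\<Sum>i<b. \<kappa> i g * pair ?f (rep i))] (mod int p)"
            by (rule spec)
          then have "[\<eta> g = (\<Sum>i<b. co \<eta> i * \<kappa> i g)] (mod int p)"
            by (simp add: pair_hom_boundary[OF \<eta> e(1)] co_def mult.commute)
          then show ?thesis using \<eta> True by (simp add: hom_def cong_def mod_homs_def)
        next
          case False
          then show ?thesis using \<eta> by (simp add: hom_def mod_homs_def)
        qed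
      qed
    qed
    show "hom ` ({..<b} \<rightarrow>\<^sub>E {0..<int p}) \<subseteq> mod_homs p G"
    proof
      fix \<eta> assume "\<eta> \<in> hom ` ({..<b} \<rightarrow>\<^sub>E {0..<int p})"
      then obtain t where t: "\<eta> = hom t" by auto
      have "hom t (g \<otimes> h) = (hom t g + hom t h) mod int p" if "g \<in> carrier G" "h \<in> carrier G" for g h
      proof -
        have "[(\<Sum>i<b. t i * \<kappa> i (g \<otimes> h))
            = (\<Sum>i<b. t i * \<kappa> i g + t i * \<kappa> i h)] (mod int p)"
          using that by (intro cong_sum) (simp add: K(2) cong_def mod_simps algebra_simps)
        then show ?thesis using that by (simp add: hom_def cong_def mod_simps sum.distrib)
      qed
      then show "\<eta> \<in> mod_homs p G" using p_pos by (auto simp: mod_homs_def t) (auto simp: hom_def)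
    qed
    show "co ` mod_homs p G \<subseteq> {..<b} \<rightarrow>\<^sub>E {0..<int p}"
      by (intro image_subsetI) (simp add: co_def restrict_PiE_iff pair_range)
  qed
  moreover have "finite ({..<b} \<rightarrow>\<^sub>E {0..<int p})" by (intro finite_PiE) auto
  moreover have "card ({..<b} \<rightarrow>\<^sub>E {0..<int p}) = p ^ b" by (simp add: card_PiE)
  ultimately show "finite (mod_homs p G)" "card (mod_homs p G) = p ^ betti 1 p G"
    by (auto simp: bij_betw_finite bij_betw_same_card b_def dest: bij_betw_same_card)
qed

definition cocycle_2 :: "('a list \<Rightarrow> int) \<Rightarrow> bool"
  where "cocycle_2 f \<longleftrightarrow> (\<forall>g\<in>carrier G. \<forall>h\<in>carrier G. \<forall>k\<in>carrier G.
     [f [g, h] + f [g \<otimes> h, k] = f [h, k] + f [g, h \<otimes> k]] (mod int p))"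

text \<open>A cocycle that vanishes on representatives \<open>z i\<close> of a basis of the second homology vanishes on all
two-cycles. For each \<open>g\<close> fix a two-chain \<open>d g\<close> whose boundary is \<open>[g]\<close> minus its combination of
representatives, and put \<open>\<psi> g = f (d g)\<close>. Since the coordinates are additive, \<open>d g + d h - d (g h) - [g, h]\<close>
is a cycle, and applying \<open>f\<close> to it shows that \<open>\<psi>\<close> splits \<open>f\<close>. Finiteness of the first homology provides
the representatives to which each \<open>[g]\<close> is reduced.\<close>

lemma cocycle_splits:
  assumes fin1: "finite_betti 1 p G" and fin2: "finite_betti 2 p G"
  obtains z where "\<And>i. i < betti 2 p G \<Longrightarrow> z i \<in> carrier (C 2)"
    "\<And>f. cocycle_2 f \<Longrightarrow> (\<And>i. i < betti 2 p G \<Longrightarrow> pair f (z i) = 0) \<Longrightarrow>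
       \<exists>\<psi>. (\<forall>g. \<psi> g \<in> {0..<int p}) \<and> (\<forall>g. g \<notin> carrier G \<longrightarrow> \<psi> g = 0) \<and>
         (\<forall>g\<in>carrier G. \<forall>h\<in>carrier G. [\<psi> g + \<psi> h - \<psi> (g \<otimes> h) = f [g, h]] (mod int p))"
proof -
  define b where "b = betti 1 p G"
  define b' where "b' = betti 2 p G"
  obtain rep \<kappa> where K:
    "\<And>i. i < b \<Longrightarrow> rep i \<in> carrier (C 1)"
    "\<And>i g h. i < b \<Longrightarrow> g \<in> carrier G \<Longrightarrow> h \<in> carrier G \<Longrightarrow>
       \<kappa> i (g \<otimes> h) = (\<kappa> i g + \<kappa> i h) mod int p"
    "\<And>g. g \<in> carrier G \<Longrightarrow> \<exists>e\<in>carrier (C 2). \<forall>f.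
       [f [g] = pair (bar_coboundary G 2 f) e + (\<Sum>i<b. \<kappa> i g * pair f (rep i))] (mod int p)"
    unfolding b_def by (rule first_homology_coordinates[OF fin1]) blast
  have two: "(2::nat) \<in> {1, 2}" and three: "2 + 1 = (3::nat)" by simp_all
  obtain z \<mu> where Z:
    "\<And>i. i < b' \<Longrightarrow> z i \<in> bar_cycles (prime_field p) G 2"
    "\<And>c. c \<in> bar_cycles (prime_field p) G 2 \<Longrightarrow> \<exists>e\<in>carrier (C 3). \<forall>f.
       [pair f c = pair (bar_coboundary G 3 f) e + (\<Sum>i<b'. \<mu> i c * pair f (z i))] (mod int p)"
  proof (rule homology_coordinates[OF two fin2, unfolded three, folded b'_def], goal_cases)
    case (1 z \<mu>)
    show ?case by (rule that[of z \<mu>]) (fact 1(2), fact 1(8))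
  qed
  have "\<forall>g\<in>carrier G. \<exists>e. e \<in> carrier (C 2) \<and> (\<forall>f.
      [f [g] = pair (bar_coboundary G 2 f) e + (\<Sum>i<b. \<kappa> i g * pair f (rep i))] (mod int p))"
    using K(3) by (simp only: Bex_def) blast
  from bchoice[OF this] obtain d where d': "\<forall>g\<in>carrier G. d g \<in> carrier (C 2) \<and> (\<forall>f.
      [f [g] = pair (bar_coboundary G 2 f) (d g) + (\<Sum>i<b. \<kappa> i g * pair f (rep i))] (mod int p))" ..
  then have d: "\<And>g. g \<in> carrier G \<Longrightarrow> d g \<in> carrier (C 2)"
    "\<And>g f. g \<in> carrier G \<Longrightarrow> [f [g] = pair (bar_coboundary G 2 f) (d g)
      + (\<Sum>i<b. \<kappa> i g * pair f (rep i))] (mod int p)"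
    by simp_all
  show ?thesis
  proof (rule that[of z], unfold b'_def[symmetric])
    fix i assume "i < b'"
    then show "z i \<in> carrier (C 2)" using Z(1) cycles_sub by blast
  next
    fix f assume f: "cocycle_2 f" and fz: "\<And>i. i < b' \<Longrightarrow> pair f (z i) = 0"
    have vanish: "pair f c = 0" if c: "c \<in> bar_cycles (prime_field p) G 2" for c
    proof -
      obtain e where e: "e \<in> carrier (C 3)"
        "[pair f c = pair (bar_coboundary G 3 f) e + (\<Sum>i<b'. \<mu> i c * pair f (z i))] (mod int p)"
        using Z(2)[OF c] by blast
      have "pair (bar_coboundary G 3 f) e = pair (\<lambda>_. 0) e"
        using e(1)
      proof (rule pair_cong)
        fix xs assume "xs \<in> bar_cells G 3"
        then obtain g h k where ghk: "g \<in> carrier G" "h \<in> carrier G" "k \<in> carrier G" "xs = [g, h, k]"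
          by (auto simp: cells_3)
        then have "[f [g, h] + f [g \<otimes> h, k] = f [h, k] + f [g, h \<otimes> k]] (mod int p)"
          using f unfolding cocycle_2_def by blast
        then have "[(f [h, k] + f [g, h \<otimes> k]) - (f [g, h] + f [g \<otimes> h, k]) = 0] (mod int p)"
          by (simp add: cong_diff_iff_cong_0 cong_sym)
        moreover have "bar_coboundary G 3 f xs = (f [h, k] + f [g, h \<otimes> k]) - (f [g, h] + f [g \<otimes> h, k])"
          by (simp add: ghk(4) coboundary_3)
        ultimately show "[bar_coboundary G 3 f xs = 0] (mod int p)" by simp
      qed
      then have "[pair f c = 0] (mod int p)" using e(2) fz by (simp add: chain_pairing_def)
      then show ?thesis by (simp add: cong_def pair_mod)
    qed
    define \<psi> where "\<psi> g = (if g \<in> carrier G then pair f (d g) else 0)" for g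
    have "[\<psi> g + \<psi> h - \<psi> (g \<otimes> h) = f [g, h]] (mod int p)"
      if g: "g \<in> carrier G" and h: "h \<in> carrier G" for g h
    proof -
      have gh: "g \<otimes> h \<in> carrier G" using g h by simp
      have cgh: "cell [g, h] \<in> carrier (C 2)" using g h by (intro basis_closed) (auto simp: cells_2)
      \<comment> \<open>the cycle \<open>d g + d h - d (g h) - [g, h]\<close>\<close>
      define w where "w = (d g \<oplus>\<^bsub>C 2\<^esub> d h) \<oplus>\<^bsub>C 2\<^esub> ((- 1) \<odot>\<^bsub>C 2\<^esub> (d (g \<otimes> h) \<oplus>\<^bsub>C 2\<^esub> cell [g, h]))"
      have w: "w \<in> carrier (C 2)"
        unfolding w_def using d(1) g h gh cgh by (intro chains_add_closed chains_smult_closed)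
      have pw: "[pair f' w = pair f' (d g) + pair f' (d h) - (pair f' (d (g \<otimes> h)) + f' [g, h])] (mod int p)" for f'
      proof -
        have 1: "[pair f' (d g \<oplus>\<^bsub>C 2\<^esub> d h) = pair f' (d g) + pair f' (d h)] (mod int p)"
          using d(1) g h by (intro pair_add)
        have 2: "[pair f' (d (g \<otimes> h) \<oplus>\<^bsub>C 2\<^esub> cell [g, h]) = pair f' (d (g \<otimes> h)) + f' [g, h]] (mod int p)"
          using pair_add[OF d(1)[OF gh] cgh, of f'] by (simp add: pair_basis cong_def mod_simps)
        have 3: "[pair f' ((- 1) \<odot>\<^bsub>C 2\<^esub> (d (g \<otimes> h) \<oplus>\<^bsub>C 2\<^esub> cell [g, h]))
            = (- 1) * pair f' (d (g \<otimes> h) \<oplus>\<^bsub>C 2\<^esub> cell [g, h])] (mod int p)"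
          using d(1) gh cgh by (intro pair_smult chains_add_closed)
        have 4: "[pair f' w = pair f' (d g \<oplus>\<^bsub>C 2\<^esub> d h) + pair f' ((- 1) \<odot>\<^bsub>C 2\<^esub> (d (g \<otimes> h) \<oplus>\<^bsub>C 2\<^esub> cell [g, h]))] (mod int p)"
          unfolding w_def using d(1) g h gh cgh by (intro pair_add chains_add_closed chains_smult_closed)
        have "[pair f' w = (pair f' (d g) + pair f' (d h)) + (- 1) * (pair f' (d (g \<otimes> h)) + f' [g, h])] (mod int p)"
          using cong_trans[OF 4 cong_add[OF 1 cong_trans[OF 3 cong_mult[OF cong_refl 2]]]] .
        then show ?thesis unfolding mult_minus1 diff_conv_add_uminus .
      qed
      have "bd 2 w = \<zero>\<^bsub>C 1\<^esub>"
      proof (rule chain_eqI)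
        show "bd 2 w \<in> carrier (C 1)" using boundary_closed[OF w] by simp
        fix f'
        let ?s = "\<lambda>x. \<Sum>i<b. \<kappa> i x * pair f' (rep i)"
        have D: "[pair (bar_coboundary G 2 f') (d x) = f' [x] - ?s x] (mod int p)"
          if "x \<in> carrier G" for x
          using cong_diff[OF cong_sym[OF d(2)[OF that, of f']] cong_refl, of "?s x"] by simp
        have S: "[?s (g \<otimes> h) = ?s g + ?s h] (mod int p)"
          unfolding sum.distrib[symmetric] using g h
          by (intro cong_sum) (simp add: K(2) cong_def mod_simps algebra_simps)
        have "[pair (bar_coboundary G 2 f') w = (f' [g] - ?s g) + (f' [h] - ?s h)
            - ((f' [g \<otimes> h] - (?s g + ?s h)) + (f' [h] - f' [g \<otimes> h] + f' [g]))] (mod int p)"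
          using pw[of "bar_coboundary G 2 f'"] unfolding coboundary_2
          by (rule cong_trans)
             (intro cong_add cong_diff cong_refl D g h cong_trans[OF D[OF gh] cong_diff[OF cong_refl S]])
        then have "[pair (bar_coboundary G 2 f') w = 0] (mod int p)" by simp
        then show "[pair f' (bd 2 w) = pair f' \<zero>\<^bsub>C 1\<^esub>] (mod int p)"
          using pair_boundary[OF w, of f'] by (simp add: pair_zero)
      qed simp
      then have "w \<in> bar_cycles (prime_field p) G 2" using w by (simp add: bar_cycles_def)
      then have "[0 = pair f (d g) + pair f (d h) - (pair f (d (g \<otimes> h)) + f [g, h])] (mod int p)"
        using pw[of f] vanish by simp
      from cong_sym[OF cong_add[OF this cong_refl[of "f [g, h]"]]]
      show ?thesis using g h gh by (simp add: \<psi>_def add_diff_eq)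
    qed
    moreover have "\<psi> g \<in> {0..<int p}" for g using pair_range p_pos by (auto simp: \<psi>_def)
    ultimately show "\<exists>\<psi>. (\<forall>g. \<psi> g \<in> {0..<int p}) \<and> (\<forall>g. g \<notin> carrier G \<longrightarrow> \<psi> g = 0) \<and>
         (\<forall>g\<in>carrier G. \<forall>h\<in>carrier G. [\<psi> g + \<psi> h - \<psi> (g \<otimes> h) = f [g, h]] (mod int p))"
      by (intro exI[of _ \<psi>]) (auto simp: \<psi>_def)
  qed
qed

end

section \<open>Counting crossed homomorphisms\<close>

text \<open>A counting form of the rank-nullity theorem: \<open>D\<close> plays the role of subtraction and \<open>K\<close> that of the kernel
of \<open>L\<close>. Subtracting a fixed member embeds each fibre of \<open>L\<close> into \<open>K\<close>.\<close>

lemma card_le_fibres: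
  assumes fin: "finite W" "finite K" and L: "L ` V \<subseteq> W"
    and D: "\<And>f g. f \<in> V \<Longrightarrow> g \<in> V \<Longrightarrow> L f = L g \<Longrightarrow> D f g \<in> K"
    and inj: "\<And>f g h. f \<in> V \<Longrightarrow> g \<in> V \<Longrightarrow> h \<in> V \<Longrightarrow> D f h = D g h \<Longrightarrow> f = g"
  shows "finite V \<and> card V \<le> card W * card K"
proof -
  define X where "X w = {f \<in> V. L f = w}" for w
  have X: "finite (X w) \<and> card (X w) \<le> card K" for w
  proof (cases "X w = {}")
    case True
    then show ?thesis by simp
  next
    case False
    then obtain h where h: "h \<in> V" "L h = w" by (auto simp: X_def)
    have "inj_on (\<lambda>f. D f h) (X w)" using inj h by (auto simp: X_def inj_on_def)
    moreover have "(\<lambda>f. D f h) ` X w \<subseteq> K" using D h by (auto simp: X_def)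
    ultimately show ?thesis using fin by (meson inj_on_finite card_inj_on_le)
  qed
  have V: "V = (\<Union>w\<in>W. X w)" using L by (auto simp: X_def)
  have "card (\<Union>w\<in>W. X w) \<le> (\<Sum>w\<in>W. card (X w))" by (intro card_UN_le fin)
  also have "\<dots> \<le> (\<Sum>w\<in>W. card K)" using X by (intro sum_mono) auto
  finally show ?thesis using V X fin by auto
qed

locale mod_p_coordinates = prime_bar_complex +
  fixes n :: nat and \<pi> :: "nat \<Rightarrow> 'a \<Rightarrow> int"
  assumes coord_mult: "\<And>i g h. i < n \<Longrightarrow> g \<in> carrier G \<Longrightarrow> h \<in> carrier G \<Longrightarrow>
      [\<pi> i (g \<otimes> h) = \<pi> i g + \<pi> i h] (mod int p)"
begin

text \<open>The value of the square-free monomial \<open>x\<^sup>U\<close> at the image of \<open>g\<close> in \<open>F\<^sub>p\<^sup>n\<close>.\<close>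

definition monomial :: "nat set \<Rightarrow> 'a \<Rightarrow> int"
  where "monomial U g = (\<Prod>i\<in>U. \<pi> i g)"

lemma monomial_mult:
  assumes "U \<subseteq> {..<n}" "g \<in> carrier G" "h \<in> carrier G"
  shows "[monomial U (g \<otimes> h) = (\<Sum>V\<in>Pow U. monomial V g * monomial (U - V) h)] (mod int p)"
proof -
  have "finite U" using assms(1) finite_subset by blast
  have "[monomial U (g \<otimes> h) = (\<Prod>i\<in>U. \<pi> i g + \<pi> i h)] (mod int p)"
    unfolding monomial_def using assms by (intro cong_prod coord_mult) auto
  then show ?thesis using \<open>finite U\<close> by (simp add: monomial_def prod_add)
qed

text \<open>The coefficient of \<open>x\<^sup>S\<close> in the translate by \<open>g\<close> of the polynomial \<open>\<Sum>U\<in>T. \<phi> U h * x\<^sup>U\<close>: expanding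
\<open>(x + \<pi> g)\<^sup>U\<close>, the monomial \<open>x\<^sup>S\<close> occurs with coefficient \<open>\<pi> g\<close> to the power \<open>U - S\<close>.\<close>

definition crossed_sum :: "nat set set \<Rightarrow> nat set \<Rightarrow> (nat set \<Rightarrow> 'a \<Rightarrow> int) \<Rightarrow> 'a \<Rightarrow> 'a \<Rightarrow> int"
  where "crossed_sum T S \<phi> g h = (\<Sum>U | U \<in> T \<and> S \<subseteq> U. monomial (U - S) g * \<phi> U h)"

text \<open>A crossed homomorphism from \<open>G\<close> to the span of the monomials \<open>x\<^sup>S\<close> with \<open>S \<in> T\<close>, given by its
coefficient functions \<open>\<phi> S\<close>. When \<open>T\<close> is not closed under subsets, this span is to be read as a
quotient module. The value 0 for irrelevant arguments makes the representation unique.\<close>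

definition crossed_homs :: "nat set set \<Rightarrow> (nat set \<Rightarrow> 'a \<Rightarrow> int) set"
  where "crossed_homs T = {\<phi>. (\<forall>S g. \<phi> S g \<in> {0..<int p}) \<and>
     (\<forall>S g. S \<notin> T \<or> g \<notin> carrier G \<longrightarrow> \<phi> S g = 0) \<and>
     (\<forall>S\<in>T. \<forall>g\<in>carrier G. \<forall>h\<in>carrier G.
        [\<phi> S (g \<otimes> h) = \<phi> S g + crossed_sum T S \<phi> g h] (mod int p))}"

definition mod_diff :: "(nat set \<Rightarrow> 'a \<Rightarrow> int) \<Rightarrow> (nat set \<Rightarrow> 'a \<Rightarrow> int) \<Rightarrow> nat set \<Rightarrow> 'a \<Rightarrow> int"
  where "mod_diff \<phi> \<psi> S g = (\<phi> S g - \<psi> S g) mod int p"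

lemma crossed_sum_diff:
  "[crossed_sum T S (mod_diff \<phi> \<psi>) g h = crossed_sum T S \<phi> g h - crossed_sum T S \<psi> g h] (mod int p)"
proof -
  have "[crossed_sum T S (mod_diff \<phi> \<psi>) g h
      = (\<Sum>U | U \<in> T \<and> S \<subseteq> U. monomial (U - S) g * (\<phi> U h - \<psi> U h))] (mod int p)"
    unfolding crossed_sum_def mod_diff_def by (intro cong_sum cong_mult cong_refl) (simp add: cong_def)
  then show ?thesis by (simp add: crossed_sum_def right_diff_distrib sum_subtractf)
qed

lemma crossed_homs_diff:
  assumes "\<phi> \<in> crossed_homs T" "\<psi> \<in> crossed_homs T"
  shows "mod_diff \<phi> \<psi> \<in> crossed_homs T"
proof -
  have "[mod_diff \<phi> \<psi> S (g \<otimes> h) = mod_diff \<phi> \<psi> S g + crossed_sum T S (mod_diff \<phi> \<psi>) g h] (mod int p)"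
    if "S \<in> T" "g \<in> carrier G" "h \<in> carrier G" for S g h
  proof -
    have "[\<phi> S (g \<otimes> h) - \<psi> S (g \<otimes> h)
        = (\<phi> S g + crossed_sum T S \<phi> g h) - (\<psi> S g + crossed_sum T S \<psi> g h)] (mod int p)"
      using assms that by (intro cong_diff) (auto simp: crossed_homs_def)
    also have "(\<phi> S g + crossed_sum T S \<phi> g h) - (\<psi> S g + crossed_sum T S \<psi> g h)
        = (\<phi> S g - \<psi> S g) + (crossed_sum T S \<phi> g h - crossed_sum T S \<psi> g h)" by simp
    also have "[(\<phi> S g - \<psi> S g) + (crossed_sum T S \<phi> g h - crossed_sum T S \<psi> g h)
        = mod_diff \<phi> \<psi> S g + crossed_sum T S (mod_diff \<phi> \<psi>) g h] (mod int p)"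
      by (intro cong_add cong_sym[OF crossed_sum_diff]) (simp add: mod_diff_def cong_def)
    finally show ?thesis by (simp add: mod_diff_def cong_def)
  qed
  then show ?thesis using assms p_pos by (auto simp: crossed_homs_def) (auto simp: mod_diff_def)
qed

lemma mod_diff_inj:
  assumes "\<phi> \<in> crossed_homs T" "\<psi> \<in> crossed_homs T" "mod_diff \<phi> \<chi> = mod_diff \<psi> \<chi>"
  shows "\<phi> = \<psi>"
proof (intro ext)
  fix S g
  have "[\<phi> S g - \<chi> S g = \<psi> S g - \<chi> S g] (mod int p)"
    using fun_cong[OF fun_cong[OF assms(3), of S], of g] by (simp add: mod_diff_def cong_def)
  then have "[\<phi> S g = \<psi> S g] (mod int p)"
    using cong_add[OF _ cong_refl[of "\<chi> S g" "int p"]] by fastforce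
  then show "\<phi> S g = \<psi> S g"
    using assms(1,2) by (simp add: crossed_homs_def cong_def)
qed

lemma crossed_homs_empty: "crossed_homs {} = {\<lambda>_ _. 0}"
  using p_pos by (auto simp: crossed_homs_def fun_eq_iff)

text \<open>This is associativity of the action: the condition on \<open>T\<close> ensures that every intermediate set
\<open>S \<subset> U \<subseteq> W\<close> in the expansion of \<open>monomial (W - S) (g \<otimes> h)\<close> is available in \<open>T\<close>. The term \<open>U = S\<close> is
split off, since \<open>S\<close> itself does not belong to \<open>T\<close>.\<close>

lemma crossed_sum_cocycle:
  assumes T: "finite T" "T \<subseteq> Pow {..<n}"
    and min: "\<And>U. U \<in> T \<Longrightarrow> \<not> U \<subseteq> S"
    and conv: "\<And>U W. W \<in> T \<Longrightarrow> S \<subset> U \<Longrightarrow> U \<subseteq> W \<Longrightarrow> U \<in> T"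
    and \<phi>: "\<phi> \<in> crossed_homs T"
    and g: "g \<in> carrier G" and h: "h \<in> carrier G" and k: "k \<in> carrier G"
  shows "[crossed_sum T S \<phi> g h + crossed_sum T S \<phi> (g \<otimes> h) k
       = crossed_sum T S \<phi> h k + crossed_sum T S \<phi> g (h \<otimes> k)] (mod int p)"
proof -
  let ?A = "{U. U \<in> T \<and> S \<subseteq> U}"
  have fA: "finite ?A" using T by simp
  have "[crossed_sum T S \<phi> (g \<otimes> h) k = (\<Sum>W\<in>?A. (\<Sum>V\<in>Pow (W - S). monomial V g * monomial (W - S - V) h) * \<phi> W k)] (mod int p)"
    unfolding crossed_sum_def using g h T by (intro cong_sum cong_mult cong_refl monomial_mult) auto
  also have "(\<Sum>W\<in>?A. (\<Sum>V\<in>Pow (W - S). monomial V g * monomial (W - S - V) h) * \<phi> W k)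
      = (\<Sum>W\<in>?A. monomial (W - S) h * \<phi> W k
          + (\<Sum>U | U \<in> ?A \<and> U \<subseteq> W. monomial (U - S) g * (monomial (W - U) h * \<phi> W k)))"
  proof (rule sum.cong)
    fix W assume W: "W \<in> ?A"
    have fW: "finite W" using W T finite_subset by blast
    have "(\<Sum>V\<in>Pow (W - S). monomial V g * monomial (W - S - V) h)
        = monomial (W - S) h + (\<Sum>V\<in>Pow (W - S) - {{}}. monomial V g * monomial (W - S - V) h)"
      using fW by (subst sum.remove[of _ "{}"]) (auto simp: monomial_def)
    also have "(\<Sum>V\<in>Pow (W - S) - {{}}. monomial V g * monomial (W - S - V) h)
        = (\<Sum>U | U \<in> ?A \<and> U \<subseteq> W. monomial (U - S) g * monomial (W - U) h)"
    proof (rule sum.reindex_bij_witness[where i = "\<lambda>U. U - S" and j = "\<lambda>V. S \<union> V"])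
      fix V assume V: "V \<in> Pow (W - S) - {{}}"
      then have "S \<subset> S \<union> V" "S \<union> V \<subseteq> W" using W by auto
      then show "S \<union> V \<in> {U. U \<in> ?A \<and> U \<subseteq> W}" using conv[of W "S \<union> V"] W by auto
      show "S \<union> V - S = V" using V by auto
      have "W - (S \<union> V) = W - S - V" by auto
      then show "monomial (S \<union> V - S) g * monomial (W - (S \<union> V)) h = monomial V g * monomial (W - S - V) h"
        using \<open>S \<union> V - S = V\<close> by simp
    next
      fix U assume U: "U \<in> {U. U \<in> ?A \<and> U \<subseteq> W}"
      then show "S \<union> (U - S) = U" by auto
      show "U - S \<in> Pow (W - S) - {{}}" using U min by auto
    qed
    finally show "(\<Sum>V\<in>Pow (W - S). monomial V g * monomial (W - S - V) h) * \<phi> W k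
        = monomial (W - S) h * \<phi> W k
          + (\<Sum>U | U \<in> ?A \<and> U \<subseteq> W. monomial (U - S) g * (monomial (W - U) h * \<phi> W k))"
      by (simp add: distrib_right sum_distrib_right mult.assoc)
  qed simp
  also have "\<dots> = crossed_sum T S \<phi> h k
      + (\<Sum>W\<in>?A. \<Sum>U | U \<in> ?A \<and> U \<subseteq> W. monomial (U - S) g * (monomial (W - U) h * \<phi> W k))"
    by (simp add: sum.distrib crossed_sum_def)
  also have "(\<Sum>W\<in>?A. \<Sum>U | U \<in> ?A \<and> U \<subseteq> W. monomial (U - S) g * (monomial (W - U) h * \<phi> W k))
      = (\<Sum>U\<in>?A. \<Sum>W | W \<in> ?A \<and> U \<subseteq> W. monomial (U - S) g * (monomial (W - U) h * \<phi> W k))"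
    by (rule sum.swap_restrict[OF fA fA])
  also have "\<dots> = (\<Sum>U\<in>?A. monomial (U - S) g * crossed_sum T U \<phi> h k)"
  proof (intro sum.cong refl)
    fix U assume U: "U \<in> ?A"
    then have "{W. W \<in> ?A \<and> U \<subseteq> W} = {W. W \<in> T \<and> U \<subseteq> W}" by auto
    then show "(\<Sum>W | W \<in> ?A \<and> U \<subseteq> W. monomial (U - S) g * (monomial (W - U) h * \<phi> W k))
        = monomial (U - S) g * crossed_sum T U \<phi> h k"
      by (simp add: crossed_sum_def sum_distrib_left)
  qed
  finally have 1: "[crossed_sum T S \<phi> (g \<otimes> h) k = crossed_sum T S \<phi> h k
      + (\<Sum>U\<in>?A. monomial (U - S) g * crossed_sum T U \<phi> h k)] (mod int p)" .
  have "[crossed_sum T S \<phi> g (h \<otimes> k)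
      = (\<Sum>U\<in>?A. monomial (U - S) g * (\<phi> U h + crossed_sum T U \<phi> h k))] (mod int p)"
    unfolding crossed_sum_def[of T S \<phi> g "h \<otimes> k"] using \<phi> h k
    by (intro cong_sum cong_mult cong_refl) (auto simp: crossed_homs_def)
  also have "(\<Sum>U\<in>?A. monomial (U - S) g * (\<phi> U h + crossed_sum T U \<phi> h k))
      = crossed_sum T S \<phi> g h + (\<Sum>U\<in>?A. monomial (U - S) g * crossed_sum T U \<phi> h k)"
    by (simp add: distrib_left sum.distrib crossed_sum_def[of T S \<phi> g h])
  finally have 2: "[crossed_sum T S \<phi> g (h \<otimes> k) = crossed_sum T S \<phi> g h
      + (\<Sum>U\<in>?A. monomial (U - S) g * crossed_sum T U \<phi> h k)] (mod int p)" .
  from cong_trans[OF cong_add[OF cong_refl[of "crossed_sum T S \<phi> g h"] 1]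
         cong_sym[OF cong_trans[OF cong_add[OF cong_refl[of "crossed_sum T S \<phi> h k"] 2]]]]
  show ?thesis by (simp add: add.left_commute)
qed

text \<open>Adding the monomial \<open>x\<^sup>S\<close> to the module. The members of \<open>crossed_homs T\<close> that lift are those whose
obstruction \<open>crossed_sum T S \<phi>\<close> splits, up to sign; they include the common kernel of \<open>b\<^sub>2\<close>
functionals, and the lifts of each of them form a coset of the homomorphisms. If no member of \<open>T\<close> contains \<open>S\<close>, then the
obstruction is zero.\<close>

lemma crossed_homs_extend:
  assumes T: "finite T" "T \<subseteq> Pow {..<n}" and S: "S \<subseteq> {..<n}" "S \<notin> T"
    and min: "\<And>U. U \<in> T \<Longrightarrow> \<not> U \<subseteq> S"
    and conv: "\<And>U W. W \<in> T \<Longrightarrow> S \<subset> U \<Longrightarrow> U \<subseteq> W \<Longrightarrow> U \<in> T"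
    and betti: "finite_betti 1 p G" "finite_betti 2 p G"
    and fin: "finite (crossed_homs T)"
  shows "finite (crossed_homs (insert S T))"
    and "card (crossed_homs T) * p ^ betti 1 p G \<le> card (crossed_homs (insert S T)) * p ^ betti 2 p G"
    and "(\<And>U. U \<in> T \<Longrightarrow> \<not> S \<subseteq> U) \<Longrightarrow>
           card (crossed_homs T) * p ^ betti 1 p G \<le> card (crossed_homs (insert S T))"
proof -
  let ?T' = "insert S T"
  have sumT: "crossed_sum ?T' U \<phi> g h = crossed_sum T U \<phi> g h" if "U \<in> T" for U \<phi> g h
    unfolding crossed_sum_def using min[OF that] by (intro sum.cong) auto
  have sumS: "crossed_sum ?T' S \<phi> g h = \<phi> S h + crossed_sum T S \<phi> g h" for \<phi> g h
  proof -
    have "{U. U \<in> ?T' \<and> S \<subseteq> U} = insert S {U. U \<in> T \<and> S \<subseteq> U}" by auto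
    then show ?thesis using S T by (simp add: crossed_sum_def monomial_def)
  qed
  have sum_upd: "crossed_sum T U (\<phi>(S := \<chi>)) g h = crossed_sum T U \<phi> g h" for U \<phi> \<chi> g h
    unfolding crossed_sum_def using S by (intro sum.cong) auto
  have restrict: "\<phi>(S := \<lambda>_. 0) \<in> crossed_homs T" if "\<phi> \<in> crossed_homs ?T'" for \<phi>
    using that S p_pos by (auto simp: crossed_homs_def sum_upd sumT)
  have extend: "\<phi>(S := \<chi>) \<in> crossed_homs ?T'"
    if "\<phi> \<in> crossed_homs T" "\<And>g. \<chi> g \<in> {0..<int p}" "\<And>g. g \<notin> carrier G \<Longrightarrow> \<chi> g = 0"
      "\<And>g h. g \<in> carrier G \<Longrightarrow> h \<in> carrier G \<Longrightarrow>
         [\<chi> (g \<otimes> h) = \<chi> g + (\<chi> h + crossed_sum T S \<phi> g h)] (mod int p)" for \<phi> \<chi>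
    using that S by (auto simp: crossed_homs_def sum_upd sumT sumS)
  note homs = card_mod_homs[OF betti(1)]
  let ?kernel = "(\<lambda>\<eta>. (\<lambda>U. if U = S then \<eta> else (\<lambda>_. 0))) ` mod_homs p G"
  have "finite (crossed_homs ?T') \<and> card (crossed_homs ?T') \<le> card (crossed_homs T) * card ?kernel"
  proof (rule card_le_fibres[where L = "\<lambda>\<phi>. \<phi>(S := \<lambda>_. 0)" and D = mod_diff])
    show "finite (crossed_homs T)" by (rule fin)
    show "finite ?kernel" using homs by simp
    show "(\<lambda>\<phi>. \<phi>(S := \<lambda>_. 0)) ` crossed_homs ?T' \<subseteq> crossed_homs T" using restrict by auto
    show "\<phi> = \<psi>" if "\<phi> \<in> crossed_homs ?T'" "\<psi> \<in> crossed_homs ?T'" "mod_diff \<phi> \<chi> = mod_diff \<psi> \<chi>" for \<phi> \<psi> \<chi>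
      using mod_diff_inj that by blast
    fix \<phi> \<psi> assume \<phi>: "\<phi> \<in> crossed_homs ?T'" and \<psi>: "\<psi> \<in> crossed_homs ?T'"
      and eq: "\<phi>(S := \<lambda>_. 0) = \<psi>(S := \<lambda>_. 0)"
    let ?d = "mod_diff \<phi> \<psi>"
    have d: "?d \<in> crossed_homs ?T'" using \<phi> \<psi> by (rule crossed_homs_diff)
    have zero: "?d U = (\<lambda>_. 0)" if "U \<noteq> S" for U
      using fun_cong[OF eq, of U] that by (auto simp: mod_diff_def)
    have "crossed_sum T S ?d g h = 0" for g h
      unfolding crossed_sum_def
    proof (intro sum.neutral ballI)
      fix U assume "U \<in> {U. U \<in> T \<and> S \<subseteq> U}"
      then have "?d U = (\<lambda>_. 0)" using zero[of U] S by blast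
      then show "monomial (U - S) g * ?d U h = 0" by simp
    qed
    then have "?d S \<in> mod_homs p G"
      using d sumS by (auto simp: crossed_homs_def mod_homs_def cong_def)
    moreover have "?d = (\<lambda>U. if U = S then ?d S else (\<lambda>_. 0))" using zero by auto
    ultimately show "?d \<in> ?kernel" by blast
  qed
  then show fin': "finite (crossed_homs ?T')" by blast

  define obs where "obs \<phi> xs = - crossed_sum T S \<phi> (xs ! 0) (xs ! 1)" for \<phi> and xs :: "'a list"
  define splits where "splits \<phi> \<psi> \<longleftrightarrow> (\<forall>g. \<psi> g \<in> {0..<int p}) \<and> (\<forall>g. g \<notin> carrier G \<longrightarrow> \<psi> g = 0) \<and>
     (\<forall>g\<in>carrier G. \<forall>h\<in>carrier G. [\<psi> g + \<psi> h - \<psi> (g \<otimes> h) = obs \<phi> [g, h]] (mod int p))" for \<phi> \<psi>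
  \<comment> \<open>\<open>Lf\<close> is the set of those systems that extend to \<open>S\<close>\<close>
  define Lf where "Lf = {\<phi> \<in> crossed_homs T. \<exists>\<psi>. splits \<phi> \<psi>}"
  define lift where "lift \<phi> = (SOME \<psi>. splits \<phi> \<psi>)" for \<phi>
  have lift: "splits \<phi> (lift \<phi>)" if "\<phi> \<in> Lf" for \<phi>
    using that someI_ex[of "splits \<phi>"] by (auto simp: Lf_def lift_def)
  have lower: "card Lf * p ^ betti 1 p G \<le> card (crossed_homs ?T')"
  proof -
    let ?E = "\<lambda>(\<phi>, \<eta>). \<phi>(S := \<lambda>g. (lift \<phi> g + \<eta> g) mod int p)"
    have "?E (\<phi>, \<eta>) \<in> crossed_homs ?T'" if \<phi>: "\<phi> \<in> Lf" and \<eta>: "\<eta> \<in> mod_homs p G" for \<phi> \<eta>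
      unfolding prod.case
    proof (rule extend)
      show "\<phi> \<in> crossed_homs T" using \<phi> by (simp add: Lf_def)
      show "(lift \<phi> g + \<eta> g) mod int p \<in> {0..<int p}" for g using p_pos by simp
      show "(lift \<phi> g + \<eta> g) mod int p = 0" if "g \<notin> carrier G" for g
        using lift[OF \<phi>] \<eta> that by (simp add: splits_def mod_homs_def)
      fix g h assume g: "g \<in> carrier G" and h: "h \<in> carrier G"
      have "[lift \<phi> g + lift \<phi> h - lift \<phi> (g \<otimes> h) = - crossed_sum T S \<phi> g h] (mod int p)"
        using lift[OF \<phi>] g h by (simp add: splits_def obs_def)
      from cong_diff[OF cong_refl[of "lift \<phi> g + lift \<phi> h"] this]
      have "[lift \<phi> (g \<otimes> h) = lift \<phi> g + lift \<phi> h + crossed_sum T S \<phi> g h] (mod int p)" by simp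
      moreover have "[\<eta> (g \<otimes> h) = \<eta> g + \<eta> h] (mod int p)"
        using \<eta> g h by (simp add: mod_homs_def cong_def)
      ultimately have "[lift \<phi> (g \<otimes> h) + \<eta> (g \<otimes> h)
          = (lift \<phi> g + lift \<phi> h + crossed_sum T S \<phi> g h) + (\<eta> g + \<eta> h)] (mod int p)" by (rule cong_add)
      then have 1: "[lift \<phi> (g \<otimes> h) + \<eta> (g \<otimes> h)
          = (lift \<phi> g + \<eta> g) + ((lift \<phi> h + \<eta> h) + crossed_sum T S \<phi> g h)] (mod int p)"
        by (simp add: algebra_simps)
      have 2: "[(lift \<phi> g + \<eta> g) mod int p + ((lift \<phi> h + \<eta> h) mod int p + crossed_sum T S \<phi> g h)
          = (lift \<phi> g + \<eta> g) + ((lift \<phi> h + \<eta> h) + crossed_sum T S \<phi> g h)] (mod int p)"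
        by (intro cong_add cong_refl) (simp_all add: cong_def)
      show "[(lift \<phi> (g \<otimes> h) + \<eta> (g \<otimes> h)) mod int p = (lift \<phi> g + \<eta> g) mod int p
          + ((lift \<phi> h + \<eta> h) mod int p + crossed_sum T S \<phi> g h)] (mod int p)"
        using cong_trans[OF 1 cong_sym[OF 2]] by (simp only: cong_def mod_mod_trivial)
    qed
    then have "?E ` (Lf \<times> mod_homs p G) \<subseteq> crossed_homs ?T'" by auto
    moreover have "inj_on ?E (Lf \<times> mod_homs p G)"
    proof (rule inj_onI)
      fix x y assume x: "x \<in> Lf \<times> mod_homs p G" and y: "y \<in> Lf \<times> mod_homs p G" and eq: "?E x = ?E y"
      obtain \<phi> \<eta> \<phi>' \<eta>' where xy: "x = (\<phi>, \<eta>)" "y = (\<phi>', \<eta>')" by (cases x, cases y)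
      have "\<phi> U = \<phi>' U" for U
      proof (cases "U = S")
        case True
        then show ?thesis using x y xy S by (auto simp: Lf_def crossed_homs_def fun_eq_iff)
      next
        case False
        then show ?thesis using fun_cong[OF eq, of U] xy by simp
      qed
      then have \<phi>: "\<phi> = \<phi>'" by blast
      have "\<eta> g = \<eta>' g" for g
      proof -
        have "[lift \<phi> g + \<eta> g = lift \<phi> g + \<eta>' g] (mod int p)"
          using fun_cong[OF fun_cong[OF eq, of S], of g] xy \<phi> by (simp add: cong_def)
        then have "[\<eta> g = \<eta>' g] (mod int p)" by (simp add: cong_add_lcancel)
        then show ?thesis using x y xy by (simp add: mod_homs_def cong_def)
      qed
      then show "x = y" using xy \<phi> by auto
    qed
    ultimately have "card (Lf \<times> mod_homs p G) \<le> card (crossed_homs ?T')"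
      using fin' by (intro card_inj_on_le)
    then show ?thesis using homs by (simp add: card_cartesian_product)
  qed

  obtain z where z: "\<And>i. i < betti 2 p G \<Longrightarrow> z i \<in> carrier (C 2)"
    "\<And>f. cocycle_2 f \<Longrightarrow> (\<And>i. i < betti 2 p G \<Longrightarrow> pair f (z i) = 0) \<Longrightarrow>
       \<exists>\<psi>. (\<forall>g. \<psi> g \<in> {0..<int p}) \<and> (\<forall>g. g \<notin> carrier G \<longrightarrow> \<psi> g = 0) \<and>
         (\<forall>g\<in>carrier G. \<forall>h\<in>carrier G. [\<psi> g + \<psi> h - \<psi> (g \<otimes> h) = f [g, h]] (mod int p))"
  proof (rule cocycle_splits[OF betti], goal_cases)
    case (1 z)
    show ?case by (rule that[of z]) (fact 1(2), fact 1(3))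
  qed
  have obs: "cocycle_2 (obs \<phi>)" if \<phi>: "\<phi> \<in> crossed_homs T" for \<phi>
  proof -
    have "[crossed_sum T S \<phi> g h + crossed_sum T S \<phi> (g \<otimes> h) k
         = crossed_sum T S \<phi> h k + crossed_sum T S \<phi> g (h \<otimes> k)] (mod int p)"
      if "g \<in> carrier G" "h \<in> carrier G" "k \<in> carrier G" for g h k
      by (rule crossed_sum_cocycle[OF T _ _ \<phi> that]) (fact min, fact conv)
    from this[THEN cong_minus_minus_iff[THEN iffD2]]
    show ?thesis by (simp add: cocycle_2_def obs_def)
  qed
  let ?W = "{..<betti 2 p G} \<rightarrow>\<^sub>E {0..<int p}"
  have upper: "finite (crossed_homs T) \<and> card (crossed_homs T) \<le> card ?W * card Lf"
  proof (rule card_le_fibres[where L = "\<lambda>\<phi>. restrict (\<lambda>i. pair (obs \<phi>) (z i)) {..<betti 2 p G}" and D = mod_diff])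
    show "finite ?W" by (intro finite_PiE) auto
    show "finite Lf" using fin by (simp add: Lf_def)
    show "(\<lambda>\<phi>. restrict (\<lambda>i. pair (obs \<phi>) (z i)) {..<betti 2 p G}) ` crossed_homs T \<subseteq> ?W"
      by (intro image_subsetI) (simp add: restrict_PiE_iff pair_range)
    show "\<phi> = \<psi>" if "\<phi> \<in> crossed_homs T" "\<psi> \<in> crossed_homs T" "mod_diff \<phi> \<chi> = mod_diff \<psi> \<chi>" for \<phi> \<psi> \<chi>
      using mod_diff_inj that by blast
    fix \<phi> \<psi> assume \<phi>: "\<phi> \<in> crossed_homs T" and \<psi>: "\<psi> \<in> crossed_homs T"
      and eq: "restrict (\<lambda>i. pair (obs \<phi>) (z i)) {..<betti 2 p G} = restrict (\<lambda>i. pair (obs \<psi>) (z i)) {..<betti 2 p G}"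
    have d: "mod_diff \<phi> \<psi> \<in> crossed_homs T" using \<phi> \<psi> by (rule crossed_homs_diff)
    have "pair (obs (mod_diff \<phi> \<psi>)) (z i) = 0" if i: "i < betti 2 p G" for i
    proof -
      have "pair (obs (mod_diff \<phi> \<psi>)) (z i) = pair (\<lambda>xs. obs \<phi> xs - obs \<psi> xs) (z i)"
      proof (rule pair_cong[OF z(1)[OF i]])
        fix xs
        show "[obs (mod_diff \<phi> \<psi>) xs = obs \<phi> xs - obs \<psi> xs] (mod int p)"
          using crossed_sum_diff[of T S \<phi> \<psi> "xs ! 0" "xs ! 1", THEN cong_minus_minus_iff[THEN iffD2]]
          by (simp add: obs_def)
      qed
      also have "[\<dots> = pair (obs \<phi>) (z i) - pair (obs \<psi>) (z i)] (mod int p)" by (rule pair_diff)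
      also have "pair (obs \<phi>) (z i) - pair (obs \<psi>) (z i) = 0" using fun_cong[OF eq, of i] i by simp
      finally show ?thesis by (simp add: cong_def pair_mod)
    qed
    then show "mod_diff \<phi> \<psi> \<in> Lf"
      using z(2)[OF obs[OF d]] d by (simp add: Lf_def splits_def)
  qed
  have "card ?W = p ^ betti 2 p G" by (simp add: card_PiE)
  then have "card (crossed_homs T) * p ^ betti 1 p G \<le> p ^ betti 2 p G * (card Lf * p ^ betti 1 p G)"
    using upper by simp
  also have "\<dots> \<le> p ^ betti 2 p G * card (crossed_homs ?T')" using lower by (intro mult_left_mono) auto
  finally show "card (crossed_homs T) * p ^ betti 1 p G \<le> card (crossed_homs ?T') * p ^ betti 2 p G"
    by (simp add: mult.commute)
  assume "\<And>U. U \<in> T \<Longrightarrow> \<not> S \<subseteq> U"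
  then have "{U. U \<in> T \<and> S \<subseteq> U} = {}" by auto
  then have "crossed_sum T S \<phi> g h = 0" for \<phi> g h by (simp only: crossed_sum_def sum.empty)
  then have "splits \<phi> (\<lambda>_. 0)" for \<phi> using p_pos by (simp add: splits_def obs_def)
  then have "Lf = crossed_homs T" by (auto simp: Lf_def)
  then show "card (crossed_homs T) * p ^ betti 1 p G \<le> card (crossed_homs ?T')" using lower by simp
qed

text \<open>Induction on \<open>T\<close>, removing a member \<open>S\<close> of least size: what remains is still closed under enlarging sets.
Only the sets with fewer than \<open>l\<close> elements cost \<open>b\<^sub>2\<close>, because a set with \<open>l\<close> elements is
maximal.\<close>

lemma card_crossed_homs:
  assumes betti: "finite_betti 1 p G" "finite_betti 2 p G"
    and T: "T \<subseteq> {S. S \<subseteq> {..<n} \<and> card S \<le> l}"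
    and up: "\<And>S U. S \<in> T \<Longrightarrow> S \<subseteq> U \<Longrightarrow> U \<subseteq> {..<n} \<Longrightarrow> card U \<le> l \<Longrightarrow> U \<in> T"
  shows "finite (crossed_homs T) \<and> p ^ (betti 1 p G * card T)
      \<le> card (crossed_homs T) * p ^ (betti 2 p G * card {S \<in> T. card S < l})"
proof -
  have "finite T" using T by (rule finite_subset) simp
  then show ?thesis using T up
  proof (induction "card T" arbitrary: T)
    case 0
    then show ?case by (simp add: crossed_homs_empty)
  next
    case (Suc m)
    have "T \<noteq> {}" using Suc.hyps by auto
    then obtain S where S: "S \<in> T" "\<And>U. U \<in> T \<Longrightarrow> card S \<le> card U"
      using ex_has_least_nat[of "\<lambda>S. S \<in> T" _ card] by auto
    define T0 where "T0 = T - {S}"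
    have T0: "finite T0" "T0 \<subseteq> Pow {..<n}" "S \<notin> T0" "insert S T0 = T" "card T0 = m"
      using Suc S by (auto simp: T0_def)
    have Sn: "S \<subseteq> {..<n}" "card S \<le> l" using S Suc.prems by auto
    have finU: "finite U" if "U \<in> T" for U using that T0(4,2) Sn finite_subset by blast
    have min: "\<not> U \<subseteq> S" if "U \<in> T0" for U
    proof
      assume "U \<subseteq> S"
      moreover have "card S \<le> card U" using S that by (auto simp: T0_def)
      ultimately have "U = S" using finU[OF S(1)] by (metis card_seteq)
      then show False using that by (simp add: T0_def)
    qed
    have up0: "U \<in> T0" if "W \<in> T0" "W \<subseteq> U" "U \<subseteq> {..<n}" "card U \<le> l" for U W
    proof -
      have "U \<noteq> S" using min that by auto
      then show ?thesis using Suc.prems(3)[of W U] that by (auto simp: T0_def)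
    qed
    have "finite (crossed_homs T0) \<and> p ^ (betti 1 p G * card T0)
      \<le> card (crossed_homs T0) * p ^ (betti 2 p G * card {S \<in> T0. card S < l})"
    proof (rule Suc.hyps(1))
      show "m = card T0" "finite T0" using T0 by simp_all
      show "T0 \<subseteq> {S. S \<subseteq> {..<n} \<and> card S \<le> l}" using Suc.prems(2) by (auto simp: T0_def)
    qed (rule up0)
    then have IH: "finite (crossed_homs T0)" "p ^ (betti 1 p G * card T0)
      \<le> card (crossed_homs T0) * p ^ (betti 2 p G * card {S \<in> T0. card S < l})"
      by blast+
    have conv: "U \<in> T0" if "W \<in> T0" "S \<subset> U" "U \<subseteq> W" for U W
    proof -
      have W: "W \<in> T" "W \<subseteq> {..<n}" "card W \<le> l" using that(1) Suc.prems(2) by (auto simp: T0_def)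
      have "card U \<le> card W" using finU[OF W(1)] that(3) by (rule card_mono)
      then show ?thesis using Suc.prems(3)[OF S(1), of U] that W by (auto simp: T0_def)
    qed
    have cT: "card T = Suc (card T0)" using Suc.hyps(2) T0(5) by simp
    note extend = crossed_homs_extend[OF T0(1,2) Sn(1) T0(3) _ _ betti IH(1), unfolded T0(4)]
    have ext: "finite (crossed_homs T)"
      "card (crossed_homs T0) * p ^ betti 1 p G \<le> card (crossed_homs T) * p ^ betti 2 p G"
      by (rule extend(1), fact min, fact conv) (rule extend(2), fact min, fact conv)
    show ?case
    proof (cases "card S < l")
      case True
      have "{U \<in> T. card U < l} = insert S {U \<in> T0. card U < l}" using T0(4) True by auto
      then have c: "card {U \<in> T. card U < l} = Suc (card {U \<in> T0. card U < l})"
        using T0 by simp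
      have "p ^ (betti 1 p G * card T) = p ^ (betti 1 p G * card T0) * p ^ betti 1 p G"
        by (simp add: cT power_add mult.commute)
      also have "\<dots> \<le> (card (crossed_homs T0) * p ^ (betti 2 p G * card {S \<in> T0. card S < l})) * p ^ betti 1 p G"
        using IH(2) by (rule mult_le_mono1)
      also have "\<dots> = (card (crossed_homs T0) * p ^ betti 1 p G) * p ^ (betti 2 p G * card {S \<in> T0. card S < l})"
        by (simp only: mult_ac)
      also have "\<dots> \<le> (card (crossed_homs T) * p ^ betti 2 p G) * p ^ (betti 2 p G * card {S \<in> T0. card S < l})"
        using ext(2) by (rule mult_le_mono1)
      also have "\<dots> = card (crossed_homs T) * p ^ (betti 2 p G * card {S \<in> T. card S < l})"
        unfolding c by (simp add: power_add)
      finally show ?thesis using ext(1) by simp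
    next
      case False
      then have Sl: "card S = l" using Sn by simp
      have eq: "{U \<in> T. card U < l} = {U \<in> T0. card U < l}" using T0(4) False by auto
      have nosup: "\<not> S \<subseteq> U" if "U \<in> T0" for U
      proof
        assume "S \<subseteq> U"
        moreover have "U \<in> T" "card U \<le> card S" using that Suc.prems(2) Sl by (auto simp: T0_def)
        ultimately have "S = U" using finU by (metis card_seteq)
        then show False using that by (simp add: T0_def)
      qed
      have ext3: "card (crossed_homs T0) * p ^ betti 1 p G \<le> card (crossed_homs T)"
        by (rule extend(3), fact min, fact conv, fact nosup)
      have "p ^ (betti 1 p G * card T) = p ^ (betti 1 p G * card T0) * p ^ betti 1 p G"
        by (simp add: cT power_add mult.commute)
      also have "\<dots> \<le> (card (crossed_homs T0) * p ^ (betti 2 p G * card {S \<in> T0. card S < l})) * p ^ betti 1 p G"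
        using IH(2) by (rule mult_le_mono1)
      also have "\<dots> = (card (crossed_homs T0) * p ^ betti 1 p G) * p ^ (betti 2 p G * card {S \<in> T0. card S < l})"
        by (simp only: mult_ac)
      also have "\<dots> \<le> card (crossed_homs T) * p ^ (betti 2 p G * card {S \<in> T0. card S < l})"
        using ext3 by (rule mult_le_mono1)
      finally show ?thesis using ext(1) eq by simp
    qed
  qed
qed

end

section \<open>Restriction to the kernel of the coordinates\<close>

locale mod_p_quotient = mod_p_coordinates +
  fixes K :: "'a set"
  assumes K_def: "K = {g \<in> carrier G. \<forall>i<n. [\<pi> i g = 0] (mod int p)}"
    and coord_surj: "\<And>v. \<exists>g\<in>carrier G. \<forall>i<n. [\<pi> i g = v i] (mod int p)"
begin

lemma coord_cancel:
  assumes "i < n" "g \<in> carrier G" "h \<in> carrier G"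
  shows "[\<pi> i (inv g \<otimes> h) = \<pi> i h - \<pi> i g] (mod int p)"
proof -
  have "[\<pi> i (g \<otimes> (inv g \<otimes> h)) = \<pi> i g + \<pi> i (inv g \<otimes> h)] (mod int p)"
    using assms by (intro coord_mult) auto
  moreover have "g \<otimes> (inv g \<otimes> h) = h" using assms by (simp add: m_assoc[symmetric])
  ultimately have "[\<pi> i h = \<pi> i g + \<pi> i (inv g \<otimes> h)] (mod int p)" by simp
  from cong_diff[OF cong_sym[OF this] cong_refl[of "\<pi> i g"]] show ?thesis by simp
qed

lemma K_carrier: "K \<subseteq> carrier G"
  by (auto simp: K_def)

lemma same_coset:
  assumes "g \<in> carrier G" "h \<in> carrier G" "\<And>i. i < n \<Longrightarrow> [\<pi> i g = \<pi> i h] (mod int p)"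
  shows "inv g \<otimes> h \<in> K"
proof -
  have "[\<pi> i (inv g \<otimes> h) = 0] (mod int p)" if i: "i < n" for i
    using cong_trans[OF coord_cancel[OF i assms(1,2)] cong_diff[OF cong_sym[OF assms(3)[OF i]] cong_refl]]
    by simp
  then show ?thesis using assms by (simp add: K_def)
qed

lemma monomial_K:
  assumes "k \<in> K" "U \<subseteq> {..<n}"
  shows "[monomial U k = (if U = {} then 1 else 0)] (mod int p)"
proof (cases "U = {}")
  case False
  have fU: "finite U" using assms finite_subset by blast
  obtain i where i: "i \<in> U" using False by blast
  have "int p dvd \<pi> i k" using assms i by (auto simp: K_def cong_0_iff)
  then have "int p dvd monomial U k" unfolding monomial_def using i fU by (meson dvd_prodI dvd_trans)
  then show ?thesis using False by (simp add: cong_0_iff)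
qed (simp add: monomial_def)

lemma crossed_homs_left_K:
  assumes \<phi>: "\<phi> \<in> crossed_homs T" and T: "T \<subseteq> Pow {..<n}" and S: "S \<in> T"
    and k: "k \<in> K" and h: "h \<in> carrier G"
  shows "[\<phi> S (k \<otimes> h) = \<phi> S k + \<phi> S h] (mod int p)"
proof -
  have fT: "finite T" using T finite_subset by blast
  have "[crossed_sum T S \<phi> k h = (\<Sum>U | U \<in> T \<and> S \<subseteq> U. (if U = S then 1 else 0) * \<phi> U h)] (mod int p)"
    unfolding crossed_sum_def
  proof (intro cong_sum cong_mult cong_refl)
    fix U assume U: "U \<in> {U. U \<in> T \<and> S \<subseteq> U}"
    then have "U - S = {} \<longleftrightarrow> U = S" "U - S \<subseteq> {..<n}" using T by auto
    then show "[monomial (U - S) k = (if U = S then 1 else 0)] (mod int p)"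
      using monomial_K[OF k, of "U - S"] by simp
  qed
  also have "(\<Sum>U | U \<in> T \<and> S \<subseteq> U. (if U = S then 1 else 0) * \<phi> U h)
      = (\<Sum>U | U \<in> T \<and> S \<subseteq> U. if U = S then \<phi> U h else 0)"
    by (intro sum.cong) auto
  also have "\<dots> = \<phi> S h" using S fT by simp
  finally have "[\<phi> S k + crossed_sum T S \<phi> k h = \<phi> S k + \<phi> S h] (mod int p)"
    by (intro cong_add cong_refl)
  moreover have "[\<phi> S (k \<otimes> h) = \<phi> S k + crossed_sum T S \<phi> k h] (mod int p)"
    using \<phi> S k h K_carrier by (auto simp: crossed_homs_def)
  ultimately show ?thesis by (rule cong_trans[rotated])
qed

lemma crossed_homs_value:
  assumes "\<phi> \<in> crossed_homs T"
  shows "[\<phi> S g = 0] (mod int p) \<longleftrightarrow> \<phi> S g = 0"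
  using assms by (simp add: crossed_homs_def cong_def)

text \<open>Conjugating \<open>k\<close> by \<open>g\<close> translates the polynomial \<open>\<Sum>S. \<phi> S k * x\<^sup>S\<close> by \<open>\<pi> g\<close>. As its value at
the origin is zero for all \<open>k\<close>, the polynomial vanishes everywhere; and a square-free polynomial that
vanishes at the indicator vectors of all sets is zero, by induction on \<open>S\<close>.\<close>

lemma vanishes_on_K:
  assumes \<phi>: "\<phi> \<in> crossed_homs T" and T: "T \<subseteq> Pow {..<n}" "{} \<in> T"
    and zero: "\<And>k. k \<in> K \<Longrightarrow> \<phi> {} k = 0" and k: "k \<in> K"
  shows "\<phi> S k = 0"
proof (cases "S \<in> T")
  case False
  then show ?thesis using \<phi> by (simp add: crossed_homs_def)
next
  case True
  have fT: "finite T" using T finite_subset by blast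
  have fS: "finite S" using True T(1) finite_subset by blast
  then show ?thesis using True
  proof (induction S rule: finite_psubset_induct)
    case (psubset S)
    obtain g where g: "g \<in> carrier G" "\<And>i. i < n \<Longrightarrow> [\<pi> i g = (if i \<in> S then 1 else 0)] (mod int p)"
      using coord_surj[of "\<lambda>i. if i \<in> S then 1 else 0"] by auto
    have kG: "k \<in> carrier G" using k K_carrier by blast
    \<comment> \<open>\<open>\<phi> {} k\' = 0\<close> is the value of the polynomial at the indicator vector of \<open>S\<close>\<close>
    define k' where "k' = g \<otimes> k \<otimes> inv g"
    have k'G: "k' \<in> carrier G" using g kG by (simp add: k'_def)
    have k'g: "k' \<otimes> g = g \<otimes> k" using g kG by (simp add: k'_def m_assoc)
    have "[\<pi> i k' = 0] (mod int p)" if i: "i < n" for i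
    proof -
      have "[\<pi> i k' + \<pi> i g = \<pi> i g + \<pi> i k] (mod int p)"
        using coord_mult[OF i k'G g(1)] coord_mult[OF i g(1) kG] k'g by (metis cong_trans cong_sym)
      moreover have "[\<pi> i k = 0] (mod int p)" using k i by (simp add: K_def)
      then have "[\<pi> i g + \<pi> i k = \<pi> i g + 0] (mod int p)" by (intro cong_add cong_refl)
      ultimately have "[\<pi> i g + \<pi> i k' = \<pi> i g + 0] (mod int p)"
        using cong_trans by (simp only: add.commute[of "\<pi> i k'"]) blast
      then show ?thesis by (simp only: cong_add_lcancel)
    qed
    then have k'K: "k' \<in> K" using k'G by (simp add: K_def)
    have "[\<phi> {} (g \<otimes> k) = \<phi> {} g] (mod int p)"
      using crossed_homs_left_K[OF \<phi> T(1,2) k'K g(1)] zero[OF k'K] k'g by simp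
    moreover have "[\<phi> {} (g \<otimes> k) = \<phi> {} g + crossed_sum T {} \<phi> g k] (mod int p)"
      using \<phi> T g kG by (auto simp: crossed_homs_def)
    ultimately have "[\<phi> {} g + crossed_sum T {} \<phi> g k = \<phi> {} g + 0] (mod int p)"
      unfolding cong_def by simp
    then have "[crossed_sum T {} \<phi> g k = 0] (mod int p)" by (simp only: cong_add_lcancel)
    moreover have "[crossed_sum T {} \<phi> g k = (\<Sum>U\<in>T. if U = S then \<phi> U k else 0)] (mod int p)"
    proof -
      have "[(\<Sum>U\<in>T. monomial U g * \<phi> U k) = (\<Sum>U\<in>T. if U = S then \<phi> U k else 0)] (mod int p)"
      proof (rule cong_sum)
        fix U assume U: "U \<in> T"
        have fU: "finite U" using U T(1) finite_subset by blast
        consider "U = S" | "U \<subset> S" | "\<not> U \<subseteq> S" by blast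
        then show "[monomial U g * \<phi> U k = (if U = S then \<phi> U k else 0)] (mod int p)"
        proof cases
          case 1
          have "[monomial U g = (\<Prod>i\<in>U. 1)] (mod int p)"
            unfolding monomial_def
          proof (rule cong_prod)
            fix i assume "i \<in> U"
            then show "[\<pi> i g = 1] (mod int p)" using g(2)[of i] 1 U T(1) by auto
          qed
          from cong_mult[OF this cong_refl[of "\<phi> U k"]] show ?thesis using 1 by simp
        next
          case 2
          then have "U \<noteq> S" by blast
          then show ?thesis using psubset.IH[OF 2] U by simp
        next
          case 3
          then obtain i where i: "i \<in> U" "i \<notin> S" by blast
          then have "int p dvd \<pi> i g" using g(2)[of i] U T(1) by (auto simp: cong_0_iff)
          then have "int p dvd monomial U g" unfolding monomial_def
            using i fU by (meson dvd_prodI dvd_trans)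
          then show ?thesis using 3 by (auto simp: cong_0_iff)
        qed
      qed
      then show ?thesis by (simp add: crossed_sum_def)
    qed
    ultimately have "[\<phi> S k = 0] (mod int p)"
      using psubset.prems fT by (simp add: cong_def)
    then show ?case using crossed_homs_value[OF \<phi>] by simp
  qed
qed

definition unit_lift :: "nat \<Rightarrow> 'a"
  where "unit_lift i = (SOME g. g \<in> carrier G \<and> (\<forall>j<n. [\<pi> j g = (if j = i then 1 else 0)] (mod int p)))"

lemma unit_lift:
  shows "unit_lift i \<in> carrier G"
    and "j < n \<Longrightarrow> [\<pi> j (unit_lift i) = (if j = i then 1 else 0)] (mod int p)"
  using someI_ex[of "\<lambda>g. g \<in> carrier G \<and> (\<forall>j<n. [\<pi> j g = (if j = i then 1 else 0)] (mod int p))"]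
    coord_surj[of "\<lambda>j. if j = i then 1 else 0"]
  unfolding unit_lift_def by blast+

lemma monomial_unit_lift:
  assumes "U \<subseteq> {..<n}"
  shows "[monomial U (unit_lift i) = (if U \<subseteq> {i} then 1 else 0)] (mod int p)"
proof (cases "U \<subseteq> {i}")
  case True
  then consider "U = {}" | "U = {i}" by blast
  then show ?thesis using unit_lift(2)[of i i] assms by cases (auto simp: monomial_def)
next
  case False
  then obtain j where j: "j \<in> U" "j \<noteq> i" by blast
  have fU: "finite U" using assms finite_subset by blast
  have "int p dvd \<pi> j (unit_lift i)" using unit_lift(2)[of j i] j assms by (auto simp: cong_0_iff)
  then have "int p dvd monomial U (unit_lift i)"
    unfolding monomial_def using j fU by (meson dvd_prodI dvd_trans)
  then show ?thesis using False by (simp add: cong_0_iff)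
qed

lemma crossed_homs_unit_lift:
  assumes \<phi>: "\<phi> \<in> crossed_homs T" and T: "T \<subseteq> Pow {..<n}" and S: "S \<in> T" and h: "h \<in> carrier G"
  shows "[\<phi> S (unit_lift i \<otimes> h) = \<phi> S (unit_lift i) + \<phi> S h
      + (if i \<in> S then 0 else \<phi> (insert i S) h)] (mod int p)"
proof -
  have fT: "finite T" using T finite_subset by blast
  let ?A = "{U. U \<in> T \<and> S \<subseteq> U}"
  have "[crossed_sum T S \<phi> (unit_lift i) h = (\<Sum>U\<in>?A. (if U - S \<subseteq> {i} then 1 else 0) * \<phi> U h)] (mod int p)"
    unfolding crossed_sum_def using T by (intro cong_sum cong_mult cong_refl monomial_unit_lift) auto
  also have "(\<Sum>U\<in>?A. (if U - S \<subseteq> {i} then 1 else 0) * \<phi> U h) = (\<Sum>U\<in>{S, insert i S}. \<phi> U h)"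
  proof (rule sum.mono_neutral_cong)
    show "finite ?A" using fT by simp
    show "(if U - S \<subseteq> {i} then 1 else 0) * \<phi> U h = 0" if "U \<in> ?A - {S, insert i S}" for U
    proof -
      have "\<not> U - S \<subseteq> {i}" using that by auto
      then show ?thesis by simp
    qed
    show "\<phi> U h = 0" if "U \<in> {S, insert i S} - ?A" for U
      using that \<phi> S by (auto simp: crossed_homs_def)
    show "(if U - S \<subseteq> {i} then 1 else 0) * \<phi> U h = \<phi> U h" if "U \<in> ?A \<inter> {S, insert i S}" for U
      using that by auto
  qed auto
  also have "\<dots> = \<phi> S h + (if i \<in> S then 0 else \<phi> (insert i S) h)"
  proof (cases "i \<in> S")
    case True
    then show ?thesis by (simp add: insert_absorb)
  next
    case False
    then have "S \<noteq> insert i S" by blast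
    then show ?thesis using False by simp
  qed
  finally have "[\<phi> S (unit_lift i) + crossed_sum T S \<phi> (unit_lift i) h
      = \<phi> S (unit_lift i) + (\<phi> S h + (if i \<in> S then 0 else \<phi> (insert i S) h))] (mod int p)"
    by (intro cong_add cong_refl)
  moreover have "[\<phi> S (unit_lift i \<otimes> h) = \<phi> S (unit_lift i) + crossed_sum T S \<phi> (unit_lift i) h] (mod int p)"
    using \<phi> S h unit_lift(1) by (auto simp: crossed_homs_def)
  ultimately have "[\<phi> S (unit_lift i \<otimes> h)
      = \<phi> S (unit_lift i) + (\<phi> S h + (if i \<in> S then 0 else \<phi> (insert i S) h))] (mod int p)"
    by (rule cong_trans[rotated])
  then show ?thesis by (simp only: add.assoc)
qed

text \<open>The kernel of restriction to \<open>K\<close>. Its members take the value 0 on \<open>K\<close> and are thus inflated from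
crossed homomorphisms of the quotient \<open>G/K\<close>.\<close>

definition inflated :: "nat set set \<Rightarrow> (nat set \<Rightarrow> 'a \<Rightarrow> int) set"
  where "inflated T = {\<phi> \<in> crossed_homs T. \<forall>k\<in>K. \<phi> {} k = 0}"

context
  fixes T :: "nat set set" and \<phi> :: "nat set \<Rightarrow> 'a \<Rightarrow> int"
  assumes T: "T \<subseteq> Pow {..<n}" "{} \<in> T" and \<phi>: "\<phi> \<in> inflated T"
begin

lemma inflated_crossed: "\<phi> \<in> crossed_homs T"
  using \<phi> by (simp add: inflated_def)

lemma inflated_K: "k \<in> K \<Longrightarrow> \<phi> S k = 0"
  using vanishes_on_K[OF inflated_crossed T] \<phi> by (simp add: inflated_def)

lemma inflated_coset:
  assumes "g \<in> carrier G" "h \<in> carrier G" "\<And>i. i < n \<Longrightarrow> [\<pi> i g = \<pi> i h] (mod int p)"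
  shows "\<phi> S g = \<phi> S h"
proof (cases "S \<in> T")
  case False
  then show ?thesis using inflated_crossed by (simp add: crossed_homs_def)
next
  case True
  define k where "k = inv g \<otimes> h"
  have k: "k \<in> K" unfolding k_def using assms by (rule same_coset)
  have h: "h = g \<otimes> k" using assms by (simp add: k_def m_assoc[symmetric])
  have "crossed_sum T S \<phi> g k = 0" using inflated_K[OF k] by (simp add: crossed_sum_def)
  moreover have "k \<in> carrier G" using k K_carrier by blast
  then have "[\<phi> S (g \<otimes> k) = \<phi> S g + crossed_sum T S \<phi> g k] (mod int p)"
    using inflated_crossed True assms(1) unfolding crossed_homs_def by blast
  ultimately have "[\<phi> S h = \<phi> S g] (mod int p)" using h by simp
  then show ?thesis using inflated_crossed by (simp add: crossed_homs_def cong_def)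
qed

text \<open>The lifts of the \<open>i\<close>-th and the \<open>j\<close>-th unit vector commute modulo \<open>K\<close>. Comparing the two products
equates the partial derivative in direction \<open>i\<close> of the value at the \<open>j\<close>-th lift with the one obtained by
exchanging \<open>i\<close> and \<open>j\<close>.\<close>

lemma inflated_symmetric:
  assumes S: "S \<in> T"
  shows "(if i \<in> S then 0 else \<phi> (insert i S) (unit_lift j))
       = (if j \<in> S then 0 else \<phi> (insert j S) (unit_lift i))" (is "?a = ?b")
proof -
  let ?i = "unit_lift i" and ?j = "unit_lift j"
  have "\<phi> S (?i \<otimes> ?j) = \<phi> S (?j \<otimes> ?i)"
  proof (rule inflated_coset)
    fix m assume m: "m < n"
    have "[\<pi> m (?i \<otimes> ?j) = \<pi> m ?i + \<pi> m ?j] (mod int p)"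
      and "[\<pi> m (?j \<otimes> ?i) = \<pi> m ?j + \<pi> m ?i] (mod int p)"
      using m unit_lift(1) by (auto intro: coord_mult)
    then show "[\<pi> m (?i \<otimes> ?j) = \<pi> m (?j \<otimes> ?i)] (mod int p)"
      by (simp add: cong_def add.commute)
  qed (simp_all add: unit_lift(1))
  moreover have "[\<phi> S (?i \<otimes> ?j) = \<phi> S ?i + \<phi> S ?j + ?a] (mod int p)"
    by (rule crossed_homs_unit_lift[OF inflated_crossed T(1) S unit_lift(1)])
  moreover have "[\<phi> S (?j \<otimes> ?i) = \<phi> S ?j + \<phi> S ?i + ?b] (mod int p)"
    by (rule crossed_homs_unit_lift[OF inflated_crossed T(1) S unit_lift(1)])
  ultimately have "[\<phi> S ?i + \<phi> S ?j + ?a = \<phi> S ?j + \<phi> S ?i + ?b] (mod int p)"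
    unfolding cong_def by simp
  then have "[\<phi> S ?i + \<phi> S ?j + ?a = \<phi> S ?i + \<phi> S ?j + ?b] (mod int p)" by (simp only: add.commute[of "\<phi> S ?j"])
  then have "[?a = ?b] (mod int p)" by (simp only: cong_add_lcancel)
  moreover have "?a \<in> {0..<int p}" "?b \<in> {0..<int p}"
    using inflated_crossed p_pos by (auto simp: crossed_homs_def)
  ultimately show ?thesis by (simp add: cong_def)
qed

text \<open>For \<open>p = 2\<close> the square of a lifted unit vector lies in \<open>K\<close>.\<close>

lemma inflated_two:
  assumes "p = 2"
  shows "\<phi> {i} (unit_lift i) = 0"
proof -
  let ?i = "unit_lift i"
  have "[\<pi> m (?i \<otimes> ?i) = 0] (mod int p)" if m: "m < n" for m
  proof -
    have "[\<pi> m (?i \<otimes> ?i) = \<pi> m ?i + \<pi> m ?i] (mod int p)"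
      using m unit_lift(1) by (intro coord_mult)
    also have "[\<pi> m ?i + \<pi> m ?i = 0] (mod int p)" unfolding assms by (simp add: cong_0_iff)
    finally show ?thesis .
  qed
  then have "?i \<otimes> ?i \<in> K" using unit_lift(1) by (simp add: K_def)
  then have "[0 = \<phi> {} ?i + \<phi> {} ?i + \<phi> {i} ?i] (mod int p)"
    using crossed_homs_unit_lift[OF inflated_crossed T unit_lift(1), of i i] inflated_K by simp
  then have "[\<phi> {i} ?i = 0] (mod int p)"
    unfolding assms by (simp add: cong_def)
  then show ?thesis using crossed_homs_value[OF inflated_crossed] by simp
qed

text \<open>By \<open>inflated_symmetric\<close> the values at the lifted unit vectors are governed by few parameters: for \<open>i \<in> S\<close>
only \<open>S = {i}\<close> can contribute, and for \<open>i \<notin> S\<close> the value \<open>\<phi> S (unit_lift i)\<close> depends only on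
\<open>insert i S\<close>, so it can be moved to the least element of that set. Once these values vanish, \<open>\<phi>\<close> vanishes on
the subgroup that the lifts generate together with \<open>K\<close>, which is all of \<open>G\<close>.\<close>

lemma inflated_zero:
  assumes down: "\<And>S U. S \<in> T \<Longrightarrow> U \<subseteq> S \<Longrightarrow> U \<in> T"
    and exchange: "\<And>S i j. S \<in> T \<Longrightarrow> i \<in> {..<n} - S \<Longrightarrow> j \<in> S \<Longrightarrow> insert i (S - {j}) \<in> T"
    and diag: "\<And>i. i < n \<Longrightarrow> {i} \<in> T \<Longrightarrow> \<phi> {i} (unit_lift i) = 0"
    and param: "\<And>S i. i < n \<Longrightarrow> S \<in> T \<Longrightarrow> i \<notin> S \<Longrightarrow> i = Min (insert i S) \<Longrightarrow> \<phi> S (unit_lift i) = 0"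
  shows "\<phi> = (\<lambda>_ _. 0)"
proof -
  have unit: "\<phi> S (unit_lift i) = 0" if S: "S \<in> T" and i: "i < n" for S i
  proof (cases "i \<in> S")
    case True
    show ?thesis
    proof (cases "S = {i}")
      case True
      then show ?thesis using diag i S by blast
    next
      case False
      then obtain j where j: "j \<in> S" "j \<noteq> i" using True by blast
      have "S - {j} \<in> T" using down[OF S] by blast
      from inflated_symmetric[OF this, of j i] show ?thesis
        using j True by (simp add: insert_absorb)
    qed
  next
    case False
    have fS: "finite S" using S T(1) finite_subset by blast
    define m where "m = Min (insert i S)"
    have m: "m \<in> insert i S" unfolding m_def using fS by (intro Min_in) auto
    show ?thesis
    proof (cases "m = i")
      case True
      then show ?thesis using param[OF i S False] by (simp add: m_def)
    next
      case ne: False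
      then have mS: "m \<in> S" using m by blast
      have mn: "m < n" using mS S T(1) by blast
      have "S - {m} \<in> T" using down[OF S] by blast
      note sym = inflated_symmetric[OF this, of m i]
      have iT: "insert i (S - {m}) \<in> T" using exchange[OF S _ mS] i False by blast
      have "insert m (insert i (S - {m})) = insert i S" using mS by auto
      then have "\<phi> (insert i (S - {m})) (unit_lift m) = 0"
        using param[OF mn iT] ne by (simp add: m_def)
      then show ?thesis using sym mS False by (simp add: insert_absorb)
    qed
  qed
  \<comment> \<open>the sum of the coordinates, taken in \<open>{0..<p}\<close>; dividing by a lifted unit vector lowers it\<close>
  define N where "N g = (\<Sum>i<n. nat (\<pi> i g mod int p))" for g
  have "\<forall>S. \<phi> S g = 0" if "g \<in> carrier G" for g
    using that
  proof (induction "N g" arbitrary: g rule: less_induct)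
    case less
    show ?case
    proof (cases "\<exists>i<n. \<not> [\<pi> i g = 0] (mod int p)")
      case False
      then have "g \<in> K" using less.prems by (auto simp: K_def)
      then show ?thesis using inflated_K by blast
    next
      case True
      then obtain i where i: "i < n" "\<pi> i g mod int p \<noteq> 0" by (auto simp: cong_def)
      define g' where "g' = inv (unit_lift i) \<otimes> g"
      have g': "g' \<in> carrier G" "unit_lift i \<otimes> g' = g"
        using less.prems unit_lift(1)[of i] by (simp_all add: g'_def m_assoc[symmetric])
      have coord: "[\<pi> j g' = \<pi> j g - (if j = i then 1 else 0)] (mod int p)" if "j < n" for j
        unfolding g'_def using coord_cancel[OF that unit_lift(1) less.prems, of i]
          cong_diff[OF cong_refl unit_lift(2)[OF that, of i]] cong_trans by blast
      have "N g' < N g"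
        unfolding N_def
      proof (rule sum_strict_mono_ex1)
        have eq: "\<pi> i g' mod int p = \<pi> i g mod int p - 1"
        proof -
          have "\<pi> i g' mod int p = (\<pi> i g mod int p - 1) mod int p"
            using coord[OF i(1)] by (simp add: cong_def mod_simps)
          moreover have "0 \<le> \<pi> i g mod int p" "\<pi> i g mod int p < int p" using p_pos by auto
          ultimately show ?thesis using i(2) by simp
        qed
        have pos: "0 \<le> \<pi> i g mod int p" using p_pos by simp
        show "\<forall>j\<in>{..<n}. nat (\<pi> j g' mod int p) \<le> nat (\<pi> j g mod int p)"
        proof
          fix j assume "j \<in> {..<n}"
          then show "nat (\<pi> j g' mod int p) \<le> nat (\<pi> j g mod int p)"
            using coord[of j] eq by (cases "j = i") (auto simp: cong_def)
        qed
        show "\<exists>j\<in>{..<n}. nat (\<pi> j g' mod int p) < nat (\<pi> j g mod int p)"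
          using eq i pos by (intro bexI[of _ i]) auto
      qed simp
      then have IH: "\<phi> S g' = 0" for S using less.hyps g' by blast
      have "\<phi> S g = 0" for S
      proof (cases "S \<in> T")
        case True
        have "[\<phi> S g = 0] (mod int p)"
          using crossed_homs_unit_lift[OF inflated_crossed T(1) True g'(1), of i]
          unfolding g'(2) unit[OF True i(1)] IH by simp
        then show ?thesis using crossed_homs_value[OF inflated_crossed] by simp
      next
        case False
        then show ?thesis using inflated_crossed by (simp add: crossed_homs_def)
      qed
      then show ?thesis by blast
    qed
  qed
  moreover have "\<phi> S g = 0" if "g \<notin> carrier G" for S g
    using inflated_crossed that by (simp add: crossed_homs_def)
  ultimately show ?thesis by blast
qed

end

text \<open>The factor \<open>card (mod_homs \<dots>)\<close> counts restrictions to \<open>K\<close>, the power of \<open>p\<close> the parameters of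
\<open>inflated_zero\<close>. A nonempty set \<open>W\<close> stands for the pair of \<open>Min W\<close> and \<open>W - {Min W}\<close>.\<close>

lemma card_crossed_homs_le:
  fixes l :: nat
  assumes fin: "finite (mod_homs p (G\<lparr>carrier := K\<rparr>))"
  defines "T \<equiv> {S. S \<subseteq> {..<n} \<and> card S \<le> l}"
  shows "card (crossed_homs T) \<le> card (mod_homs p (G\<lparr>carrier := K\<rparr>))
     * p ^ (card {W. W \<subseteq> {..<n} \<and> card W \<in> {1..l + 1}} + (if p \<noteq> 2 \<and> l \<ge> 1 then n else 0))"
proof -
  have T: "T \<subseteq> Pow {..<n}" "{} \<in> T" by (auto simp: T_def)
  have fT: "finite S" if "S \<in> T" for S using that finite_subset[of S "{..<n}"] by (auto simp: T_def)
  define Q where "Q = {W. W \<subseteq> {..<n} \<and> card W \<in> {1..l + 1}}"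
  define E where "E = (if p \<noteq> 2 \<and> l \<ge> 1 then {..<n} else {})"
  have fQ: "finite Q" unfolding Q_def by (rule finite_subset[of _ "Pow {..<n}"]) auto
  have fE: "finite E" by (simp add: E_def)
  let ?PQ = "Q \<rightarrow>\<^sub>E {0..<int p}" and ?PE = "E \<rightarrow>\<^sub>E {0..<int p}"
  let ?L = "\<lambda>\<phi>. (restrict (\<lambda>W. \<phi> (W - {Min W}) (unit_lift (Min W))) Q, restrict (\<lambda>i. \<phi> {i} (unit_lift i)) E)"
  have infl: "finite (inflated T) \<and> card (inflated T) \<le> card (?PQ \<times> ?PE) * card {\<lambda>(S::nat set) (g::'a). 0::int}"
  proof (rule card_le_fibres[where L = ?L and D = mod_diff])
    show "finite (?PQ \<times> ?PE)" using fQ fE by (intro finite_cartesian_product finite_PiE) auto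
    show "?L ` inflated T \<subseteq> ?PQ \<times> ?PE"
      by (intro image_subsetI) (simp add: restrict_PiE_iff inflated_def crossed_homs_def)
    show "\<phi> = \<psi>" if "\<phi> \<in> inflated T" "\<psi> \<in> inflated T" "mod_diff \<phi> \<chi> = mod_diff \<psi> \<chi>" for \<phi> \<psi> \<chi>
      using mod_diff_inj that by (auto simp: inflated_def)
    fix \<phi> \<psi> assume \<phi>: "\<phi> \<in> inflated T" and \<psi>: "\<psi> \<in> inflated T" and eq: "?L \<phi> = ?L \<psi>"
    let ?d = "mod_diff \<phi> \<psi>"
    have d: "?d \<in> inflated T"
      using \<phi> \<psi> crossed_homs_diff by (auto simp: inflated_def) (auto simp: mod_diff_def)
    have eqQ: "\<phi> (W - {Min W}) (unit_lift (Min W)) = \<psi> (W - {Min W}) (unit_lift (Min W))"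
      if "W \<in> Q" for W using fun_cong[OF arg_cong[OF eq, of fst], of W] that by simp
    have eqE: "\<phi> {i} (unit_lift i) = \<psi> {i} (unit_lift i)"
      if "i \<in> E" for i using fun_cong[OF arg_cong[OF eq, of snd], of i] that by simp
    have "?d = (\<lambda>_ _. 0)"
    proof (rule inflated_zero[OF T d])
      show "U \<in> T" if "S \<in> T" "U \<subseteq> S" for S U
        using that card_mono[OF fT[OF that(1)] that(2)] by (auto simp: T_def)
      show "insert i (S - {j}) \<in> T" if "S \<in> T" "i \<in> {..<n} - S" "j \<in> S" for S i j
      proof -
        have "card (insert i (S - {j})) = card S"
          using fT[OF that(1)] that by (metis DiffD2 card_Suc_Diff1 card_insert_disjoint finite_Diff insert_Diff_single Diff_iff)
        then show ?thesis using that by (auto simp: T_def)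
      qed
      show "?d {i} (unit_lift i) = 0" if i: "i < n" "{i} \<in> T" for i
      proof (cases "p = 2")
        case True
        then show ?thesis using inflated_two[OF T d] by blast
      next
        case False
        then have "i \<in> E" using i by (simp add: E_def T_def)
        from eqE[OF this] show ?thesis by (simp add: mod_diff_def)
      qed
      show "?d S (unit_lift i) = 0" if "i < n" "S \<in> T" "i \<notin> S" "i = Min (insert i S)" for i S
      proof -
        have "insert i S \<in> Q" using that(1-3) fT[OF that(2)] by (auto simp: Q_def T_def)
        from eqQ[OF this] have "\<phi> (insert i S - {i}) (unit_lift i) = \<psi> (insert i S - {i}) (unit_lift i)"
          by (simp only: that(4)[symmetric])
        then show ?thesis using that(3) by (simp add: mod_diff_def)
      qed
    qed
    then show "?d \<in> {\<lambda>S g. 0}" by simp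
  qed simp
  let ?R = "\<lambda>\<phi> g. if g \<in> K then \<phi> {} g else 0"
  have "finite (crossed_homs T) \<and> card (crossed_homs T)
      \<le> card (mod_homs p (G\<lparr>carrier := K\<rparr>)) * card (inflated T)"
  proof (rule card_le_fibres[where L = ?R and D = mod_diff])
    show "finite (inflated T)" using infl by blast
    show "?R ` crossed_homs T \<subseteq> mod_homs p (G\<lparr>carrier := K\<rparr>)"
    proof
      fix \<eta> assume "\<eta> \<in> ?R ` crossed_homs T"
      then obtain \<phi> where \<phi>: "\<phi> \<in> crossed_homs T" "\<eta> = ?R \<phi>" by blast
      have "\<eta> (g \<otimes> h) = (\<eta> g + \<eta> h) mod int p" if g: "g \<in> K" and h: "h \<in> K" for g h
      proof -
        have gh: "g \<in> carrier G" "h \<in> carrier G" using g h K_carrier by auto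
        have "[\<pi> i (g \<otimes> h) = 0] (mod int p)" if i: "i < n" for i
        proof -
          have "[\<pi> i g + \<pi> i h = 0 + 0] (mod int p)" using g h i by (intro cong_add) (auto simp: K_def)
          then show ?thesis using coord_mult[OF i gh] cong_trans by fastforce
        qed
        then have "g \<otimes> h \<in> K" using gh by (simp add: K_def)
        then show ?thesis
          using crossed_homs_left_K[OF \<phi>(1) T g gh(2)] g h \<phi> by (simp add: cong_def crossed_homs_def)
      qed
      then show "\<eta> \<in> mod_homs p (G\<lparr>carrier := K\<rparr>)"
        using \<phi> p_pos by (auto simp: mod_homs_def) (auto simp: crossed_homs_def)
    qed
    show "\<phi> = \<psi>" if "\<phi> \<in> crossed_homs T" "\<psi> \<in> crossed_homs T" "mod_diff \<phi> \<chi> = mod_diff \<psi> \<chi>" for \<phi> \<psi> \<chi>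
      using mod_diff_inj that by blast
    fix \<phi> \<psi> assume \<phi>: "\<phi> \<in> crossed_homs T" and \<psi>: "\<psi> \<in> crossed_homs T" and eq: "?R \<phi> = ?R \<psi>"
    have "mod_diff \<phi> \<psi> {} k = 0" if "k \<in> K" for k
      using fun_cong[OF eq, of k] that by (simp add: mod_diff_def)
    then show "mod_diff \<phi> \<psi> \<in> inflated T"
      using crossed_homs_diff[OF \<phi> \<psi>] by (simp add: inflated_def)
  qed (rule fin)
  then have "card (crossed_homs T) \<le> card (mod_homs p (G\<lparr>carrier := K\<rparr>)) * card (inflated T)" by blast
  also have "\<dots> \<le> card (mod_homs p (G\<lparr>carrier := K\<rparr>)) * (p ^ (card Q + card E))"
    using infl fQ fE by (intro mult_left_mono) (simp_all add: card_cartesian_product card_PiE power_add)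
  also have "card E = (if p \<noteq> 2 \<and> l \<ge> 1 then n else 0)" by (simp add: E_def)
  finally show ?thesis by (simp only: Q_def)
qed

end

section \<open>Subgroups of finite index\<close>

text \<open>Schreier's lemma. With \<open>r\<close> choosing a representative of each coset, the elements
\<open>t \<otimes> s \<otimes> inv (r (t \<otimes> s))\<close>, for representatives \<open>t\<close> and generators or inverse generators \<open>s\<close>, generate \<open>K\<close>:
the product of such expressions along a word telescopes. The representative \<open>r \<one>\<close> need not be \<open>\<one>\<close>, so
the last step conjugates by it.\<close>

lemma (in group) finite_index_subgroup_generators:
  assumes S: "finite S" "S \<subseteq> carrier G" "generate G S = carrier G"
    and K: "subgroup K G" and fin: "finite (rcosets K)"
  shows "\<exists>Y. finite Y \<and> Y \<subseteq> K \<and> generate (G\<lparr>carrier := K\<rparr>) Y = K"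
proof -
  define r where "r g = (SOME x. x \<in> K #> g)" for g
  have KG: "K \<subseteq> carrier G" using K by (rule subgroup.subset)
  have r: "r g \<in> K #> g" if "g \<in> carrier G" for g
    unfolding r_def using rcos_self[OF that K] by (rule someI)
  have rG: "r g \<in> carrier G" if "g \<in> carrier G" for g
    using r[OF that] r_coset_subset_G[OF KG that] by blast
  have rc: "K #> r g = K #> g" if "g \<in> carrier G" for g
    using repr_independence[OF r[OF that] that K] by (rule sym)
  have r_cong: "r x = r y" if "K #> x = K #> y" for x y
    using that by (simp add: r_def)
  define R where "R = r ` carrier G"
  have RG: "t \<in> carrier G" if "t \<in> R" for t using that rG by (auto simp: R_def)
  have "r (r x) = r x" if "x \<in> carrier G" for x using rc[OF that] by (rule r_cong)
  then have rR: "r t = t" if "t \<in> R" for t using that by (auto simp: R_def)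
  have "R = (\<lambda>A. SOME x. x \<in> A) ` (rcosets K)"
    unfolding R_def r_def RCOSETS_def by blast
  then have fR: "finite R" using fin by simp
  define S' where "S' = S \<union> (\<lambda>s. inv s) ` S"
  define Y where "Y = (\<lambda>(t, s). t \<otimes> s \<otimes> inv (r (t \<otimes> s))) ` (R \<times> S')"
  have inK: "x \<otimes> inv (r x) \<in> K" if x: "x \<in> carrier G" for x
  proof -
    obtain k where k: "k \<in> K" "r x = k \<otimes> x" using r[OF x] by (auto simp: r_coset_def)
    have kG: "k \<in> carrier G" using k KG by blast
    have "x \<otimes> inv (r x) = inv k" using x kG k by (simp add: inv_mult_group m_assoc[symmetric])
    then show ?thesis using k K by (simp add: subgroup.m_inv_closed)
  qed
  have S'G: "S' \<subseteq> carrier G" using S by (auto simp: S'_def)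
  have YK: "Y \<subseteq> K" using inK RG S'G by (auto simp: Y_def)
  have fY: "finite Y" using fR S by (simp add: Y_def S'_def)
  have main: "\<forall>t\<in>R. t \<otimes> g \<otimes> inv (r (t \<otimes> g)) \<in> generate G Y" if "g \<in> generate G S" for g
    using that
  proof (induction rule: generate.induct)
    case one
    show ?case using RG rR by (simp add: generate.one)
  next
    case (incl h)
    then show ?case by (auto simp: Y_def S'_def intro!: generate.incl)
  next
    case (inv h)
    then show ?case by (auto simp: Y_def S'_def intro!: generate.incl)
  next
    case (eng g h)
    show ?case
    proof
      fix t assume t: "t \<in> R"
      have G: "t \<in> carrier G" "g \<in> carrier G" "h \<in> carrier G"
        using t RG eng.hyps generate_in_carrier[OF S(2)] by auto
      let ?u = "r (t \<otimes> g)"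
      have u: "?u \<in> R" "?u \<in> carrier G" using G rG by (auto simp: R_def)
      have tg: "t \<otimes> g \<in> carrier G" using G by simp
      have "K #> (?u \<otimes> h) = (K #> ?u) #> h" by (rule coset_mult_assoc[OF KG u(2) G(3), symmetric])
      also have "\<dots> = (K #> (t \<otimes> g)) #> h" by (simp only: rc[OF tg])
      also have "\<dots> = K #> (t \<otimes> g \<otimes> h)" by (rule coset_mult_assoc[OF KG tg G(3)])
      also have "t \<otimes> g \<otimes> h = t \<otimes> (g \<otimes> h)" using G by (simp only: m_assoc)
      finally have ru: "r (?u \<otimes> h) = r (t \<otimes> (g \<otimes> h))" by (rule r_cong)
      have "(t \<otimes> g \<otimes> inv ?u) \<otimes> (?u \<otimes> h \<otimes> inv (r (?u \<otimes> h))) \<in> generate G Y"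
        by (rule generate.eng[OF bspec[OF eng.IH(1) t] bspec[OF eng.IH(2) u(1)]])
      also have "(t \<otimes> g \<otimes> inv ?u) \<otimes> (?u \<otimes> h \<otimes> inv (r (?u \<otimes> h)))
          = t \<otimes> g \<otimes> (inv ?u \<otimes> ?u) \<otimes> h \<otimes> inv (r (?u \<otimes> h))"
        using G u(2) rG by (simp only: m_assoc m_closed inv_closed)
      also have "\<dots> = t \<otimes> (g \<otimes> h) \<otimes> inv (r (t \<otimes> (g \<otimes> h)))"
        using G u(2) rG by (simp add: ru m_assoc)
      finally show "t \<otimes> (g \<otimes> h) \<otimes> inv (r (t \<otimes> (g \<otimes> h))) \<in> generate G Y" .
    qed
  qed
  have "K \<subseteq> generate G Y"
  proof
    fix k assume k: "k \<in> K"
    let ?c = "r \<one>"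
    have c: "?c \<in> R" "?c \<in> K"
      using r[of \<one>] KG by (auto simp: R_def coset_mult_one)
    have cG: "?c \<in> carrier G" "k \<in> carrier G" using c k KG by auto
    let ?g = "inv ?c \<otimes> k \<otimes> ?c"
    have eq: "?c \<otimes> ?g = k \<otimes> ?c" using cG by (simp add: m_assoc[symmetric])
    have "k \<otimes> ?c \<in> K" using k c K by (simp add: subgroup.m_closed)
    then have "K #> (k \<otimes> ?c) = K #> \<one>"
      using coset_join2[OF _ K] KG by (simp add: subset_iff coset_mult_one)
    then have rk: "r (k \<otimes> ?c) = ?c" by (rule r_cong)
    have "?c \<otimes> ?g \<otimes> inv (r (?c \<otimes> ?g)) \<in> generate G Y"
      using main[of ?g] c cG S(3) by simp
    then have "k \<otimes> ?c \<otimes> inv ?c \<in> generate G Y" by (simp only: eq rk)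
    then show "k \<in> generate G Y" using cG by (simp add: m_assoc)
  qed
  moreover have "generate G Y \<subseteq> K" using generate_subgroup_incl[OF YK K] .
  ultimately have "generate (G\<lparr>carrier := K\<rparr>) Y = K"
    using generate_consistent[OF YK K] by simp
  then show ?thesis using fY YK by blast
qed

lemma elementary_abelian_coordinates:
  fixes G :: "('g, 'm) monoid_scheme" (structure)
  assumes K: "K \<lhd> G" and p: "p > 0" and el: "elementary_abelian_of_rank p n (G Mod K)"
  obtains \<pi> :: "nat \<Rightarrow> 'g \<Rightarrow> int"
  where "\<And>i g h. i < n \<Longrightarrow> g \<in> carrier G \<Longrightarrow> h \<in> carrier G \<Longrightarrow>
      [\<pi> i (g \<otimes>\<^bsub>G\<^esub> h) = \<pi> i g + \<pi> i h] (mod int p)"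
    and "K = {g \<in> carrier G. \<forall>i<n. [\<pi> i g = 0] (mod int p)}"
    and "\<And>v. \<exists>g\<in>carrier G. \<forall>i<n. [\<pi> i g = v i] (mod int p)"
proof -
  interpret normal K G by (fact K)
  let ?P = "product_group {..<n} (\<lambda>_. integer_mod_group p)"
  obtain f where f: "f \<in> iso (G Mod K) ?P"
    using el by (auto simp: elementary_abelian_of_rank_def is_iso_def)
  have fh: "f \<in> hom (G Mod K) ?P" and fb: "bij_betw f (carrier (G Mod K)) (carrier ?P)"
    using f by (auto simp: iso_def)
  have carP: "carrier ?P = {..<n} \<rightarrow>\<^sub>E {0..<int p}"
    using p by (simp add: carrier_product_group carrier_integer_mod_group)
  have carQ: "carrier (G Mod K) = (\<lambda>g. K #> g) ` carrier G"
    by (auto simp: FactGroup_def RCOSETS_def)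
  define \<pi> where "\<pi> i g = f (K #> g) i" for i g
  have "group ?P" by simp
  then have gh: "group_hom (G Mod K) ?P f"
    using fh factorgroup_is_group by (simp add: group_hom_def group_hom_axioms_def)
  have one: "f K = (\<lambda>i\<in>{..<n}. 0)"
    using group_hom.hom_one[OF gh] by (simp add: FactGroup_def)
  have coset_K: "K #> g = K \<longleftrightarrow> g \<in> K" if "g \<in> carrier G" for g
    using coset_join1[OF _ that is_subgroup] coset_join2[OF that is_subgroup] subset by blast
  show ?thesis
  proof (rule that[of \<pi>])
    fix i g h assume i: "i < n" and g: "g \<in> carrier G" and h: "h \<in> carrier G"
    have "f ((K #> g) \<otimes>\<^bsub>G Mod K\<^esub> (K #> h)) = f (K #> g) \<otimes>\<^bsub>?P\<^esub> f (K #> h)"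
      using fh g h carQ by (intro hom_mult) auto
    then have "f (K #> (g \<otimes> h)) = f (K #> g) \<otimes>\<^bsub>?P\<^esub> f (K #> h)"
      using rcos_sum[OF g h] by (simp add: FactGroup_def)
    then show "[\<pi> i (g \<otimes> h) = \<pi> i g + \<pi> i h] (mod int p)"
      using i by (simp add: \<pi>_def cong_def)
  next
    have "(\<forall>i<n. [\<pi> i g = 0] (mod int p)) \<longleftrightarrow> g \<in> K" if g: "g \<in> carrier G" for g
    proof -
      have fP: "f (K #> g) \<in> {..<n} \<rightarrow>\<^sub>E {0..<int p}"
        using bij_betw_apply[OF fb, of "K #> g"] g unfolding carP carQ by blast
      then have "(\<forall>i<n. [\<pi> i g = 0] (mod int p)) \<longleftrightarrow> f (K #> g) = (\<lambda>i\<in>{..<n}. 0)"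
        by (auto simp: \<pi>_def cong_def PiE_iff fun_eq_iff extensional_def)
      also have "\<dots> \<longleftrightarrow> f (K #> g) = f K" by (simp add: one)
      also have "\<dots> \<longleftrightarrow> K #> g = K"
      proof (rule inj_on_eq_iff[OF bij_betw_imp_inj_on[OF fb]])
        show "K #> g \<in> carrier (G Mod K)" using g carQ by blast
        have "K #> \<one> = K" using subset by (rule coset_mult_one)
        then show "K \<in> carrier (G Mod K)" unfolding carQ by (metis image_eqI one_closed)
      qed
      finally show ?thesis using coset_K[OF g] by blast
    qed
    then show "K = {g \<in> carrier G. \<forall>i<n. [\<pi> i g = 0] (mod int p)}" using subset by blast
  next
    fix v :: "nat \<Rightarrow> int"
    have "(\<lambda>i\<in>{..<n}. v i mod int p) \<in> carrier ?P" unfolding carP using p by (simp add: restrict_PiE_iff)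
    also have "carrier ?P = f ` (\<lambda>g. K #> g) ` carrier G"
      using bij_betw_imp_surj_on[OF fb] unfolding carQ by (rule sym)
    finally have "\<exists>g\<in>carrier G. (\<lambda>i\<in>{..<n}. v i mod int p) = f (K #> g)"
      unfolding image_image by (simp only: image_iff)
    then obtain g where g: "g \<in> carrier G" "(\<lambda>i\<in>{..<n}. v i mod int p) = f (K #> g)"
      by (rule bexE)
    have "[\<pi> i g = v i] (mod int p)" if "i < n" for i
      using that by (simp add: \<pi>_def g(2)[symmetric] cong_def)
    then show "\<exists>g\<in>carrier G. \<forall>i<n. [\<pi> i g = v i] (mod int p)" using g(1) by blast
  qed
qed

section \<open>Binomial sums\<close>

lemma card_subsets_of_sizes:
  assumes "finite J"
  shows "card {S. S \<subseteq> {..<n} \<and> card S \<in> J} = (\<Sum>r\<in>J. n choose r)"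
proof -
  have "{S. S \<subseteq> {..<n} \<and> card S \<in> J} = (\<Union>r\<in>J. {S. S \<subseteq> {..<n} \<and> card S = r})" by auto
  moreover have "card (\<Union>r\<in>J. {S. S \<subseteq> {..<n} \<and> card S = r}) = (\<Sum>r\<in>J. card {S. S \<subseteq> {..<n} \<and> card S = r})"
    using assms by (intro card_UN_disjoint) (auto intro: finite_subset[of _ "Pow {..<n}"])
  ultimately show ?thesis by (simp add: n_subsets)
qed

text \<open>With the term \<open>n\<close> replaced by \<open>\<Sum>r\<le>l. r * (n choose r)\<close> this is an identity, which follows from
\<open>(r + 1) * (n choose (r + 1)) = (n - r) * (n choose r)\<close>; the inequality keeps only the summand for
\<open>r = 1\<close>.\<close>

lemma weighted_binomial_sum:
  fixes l n :: nat
  assumes "l \<le> n"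
  shows "(\<Sum>r = 2..l + 1. int (n choose r) * (int r - 1)) + (\<Sum>r = 1..l + 1. int (n choose r))
      + (if l \<ge> 1 then int n else 0) \<le> int n * (\<Sum>r = 0..l. int (n choose r))"
  using assms
proof (induction l)
  case 0
  then show ?case by simp
next
  case (Suc l)
  have ab: "int (Suc k) * int (n choose Suc k) = (int n - int k) * int (n choose k)" if "k \<le> n" for k
  proof -
    have "Suc k * (n choose Suc k) = (n - k) * (n choose k)"
      by (metis binomial_absorb_comp binomial_absorption)
    then have "int (Suc k * (n choose Suc k)) = int ((n - k) * (n choose k))" by (simp only:)
    then show ?thesis using that by (simp only: of_nat_mult of_nat_diff)
  qed
  have step: "int (n choose (Suc l + 1)) * (int (Suc l + 1) - 1) + int (n choose (Suc l + 1))
      = int n * int (n choose Suc l) - int (Suc l) * int (n choose Suc l)"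
    using ab[of "Suc l"] Suc.prems by (simp add: algebra_simps)
  have "(if Suc l \<ge> 1 then int n else 0) \<le> (if l \<ge> 1 then int n else 0) + int (Suc l) * int (n choose Suc l)"
  proof (cases "l = 0")
    case False
    then show ?thesis by simp
  qed simp
  moreover have "(\<Sum>r = 2..Suc l + 1. int (n choose r) * (int r - 1))
      = (\<Sum>r = 2..l + 1. int (n choose r) * (int r - 1)) + int (n choose (Suc l + 1)) * (int (Suc l + 1) - 1)"
    by simp
  moreover have "(\<Sum>r = 1..Suc l + 1. int (n choose r))
      = (\<Sum>r = 1..l + 1. int (n choose r)) + int (n choose (Suc l + 1))" by simp
  moreover have "int n * (\<Sum>r = 0..Suc l. int (n choose r))
      = int n * (\<Sum>r = 0..l. int (n choose r)) + int n * int (n choose Suc l)"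
    by (simp add: distrib_left)
  ultimately show ?case using Suc step by linarith
qed

section \<open>First Betti numbers of elementary abelian covers\<close>

theorem theorem1p6:
  fixes G :: "('g, 'm) monoid_scheme" and K :: "'g set" and p n l :: nat
  assumes "finitely_generated_group G"
    and "prime p"
    and "finite_betti 2 p G"
    and "K \<lhd> G"
    and "finite (rcosets\<^bsub>G\<^esub> K)"
    and "elementary_abelian_of_rank p n (G Mod K)"
    and "l \<le> n"
  shows "int (betti 1 p (G\<lparr>carrier := K\<rparr>)) \<ge>
           (\<Sum>r = 2..l + 1. int (n choose r) * (int r - 1))
           + (int (betti 1 p G) - int n) * (\<Sum>r = 0..l. int (n choose r))
           - int (betti 2 p G) * (\<Sum>r\<in>{0..<l}. int (n choose r))
       \<and> (p = 2 \<longrightarrow>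
         int (betti 1 2 (G\<lparr>carrier := K\<rparr>)) \<ge>
           int (betti 1 2 G) * (\<Sum>r = 0..l. int (n choose r))
           - (\<Sum>r = 1..l + 1. int (n choose r))
           - int (betti 2 2 G) * (\<Sum>r\<in>{0..<l}. int (n choose r)))"
proof -
  interpret normal K G by (fact assms(4))
  let ?K = "G\<lparr>carrier := K\<rparr>"
  obtain S where S: "finite S" "S \<subseteq> carrier G" "generate G S = carrier G"
    using assms(1) by (auto simp: finitely_generated_group_def)
  obtain Y where Y: "finite Y" "Y \<subseteq> K" "generate ?K Y = K"
    using finite_index_subgroup_generators[OF S is_subgroup assms(5)] by blast
  have p1: "p > 1" using assms(2) prime_gt_1_nat by blast
  then have p0: "p > 0" by simp
  obtain \<pi> :: "nat \<Rightarrow> 'g \<Rightarrow> int" where \<pi>: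
    "\<And>i g h. i < n \<Longrightarrow> g \<in> carrier G \<Longrightarrow> h \<in> carrier G \<Longrightarrow> [\<pi> i (g \<otimes>\<^bsub>G\<^esub> h) = \<pi> i g + \<pi> i h] (mod int p)"
    "K = {g \<in> carrier G. \<forall>i<n. [\<pi> i g = 0] (mod int p)}"
    "\<And>v. \<exists>g\<in>carrier G. \<forall>i<n. [\<pi> i g = v i] (mod int p)"
  proof (rule elementary_abelian_coordinates[OF assms(4) p0 assms(6)], goal_cases)
    case (1 \<pi>)
    show ?case by (rule that[of \<pi>]) (fact 1(2), fact 1(3), fact 1(4))
  qed
  interpret q: mod_p_quotient G p n \<pi> K
    by unfold_locales (fact assms(2), fact \<pi>(1), fact \<pi>(2), fact \<pi>(3))
  interpret sub: prime_bar_complex ?K p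
    using subgroup_imp_group[OF is_subgroup] assms(2)
    by (simp add: prime_bar_complex_def prime_bar_complex_axioms_def)
  have b1: "finite_betti 1 p G" by (rule q.finite_betti_1[OF S])
  have bK: "finite_betti 1 p ?K" by (rule sub.finite_betti_1[of Y]) (use Y in simp_all)
  note homs = sub.card_mod_homs[OF bK]
  define T where "T = {S. S \<subseteq> {..<n} \<and> card S \<le> l}"
  define Q where "Q = {W. W \<subseteq> {..<n} \<and> card W \<in> {1..l + 1}}"
  define T' where "T' = {S \<in> T. card S < l}"
  \<comment> \<open>the diagonal parameters of the upper estimate\<close>
  define e where "e = (if p \<noteq> 2 \<and> l \<ge> 1 then n else 0)"
  have "p ^ (betti 1 p G * card T) \<le> card (q.crossed_homs T) * p ^ (betti 2 p G * card T')"
    unfolding T'_def by (rule q.card_crossed_homs[OF b1 assms(3), THEN conjunct2]) (auto simp: T_def)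
  also have "\<dots> \<le> (p ^ betti 1 p ?K * p ^ (card Q + e)) * p ^ (betti 2 p G * card T')"
    using q.card_crossed_homs_le[OF homs(1), of l] unfolding homs(2)
    by (intro mult_le_mono1) (simp only: T_def Q_def e_def)
  also have "\<dots> = p ^ (betti 1 p ?K + (card Q + e) + betti 2 p G * card T')"
    by (simp only: power_add)
  finally have main: "betti 1 p G * card T \<le> betti 1 p ?K + (card Q + e) + betti 2 p G * card T'"
    by (rule power_le_imp_le_exp[OF p1])
  have "T = {S. S \<subseteq> {..<n} \<and> card S \<in> {0..l}}" by (auto simp: T_def)
  then have T: "card T = (\<Sum>r = 0..l. n choose r)" using card_subsets_of_sizes[of "{0..l}" n] by simp
  have "T' = {S. S \<subseteq> {..<n} \<and> card S \<in> {0..<l}}" by (auto simp: T_def T'_def)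
  then have T': "card T' = (\<Sum>r\<in>{0..<l}. n choose r)" using card_subsets_of_sizes[of "{0..<l}" n] by simp
  have Q: "card Q = (\<Sum>r = 1..l + 1. n choose r)"
    using card_subsets_of_sizes[of "{1..l + 1}" n] by (simp add: Q_def)
  have main': "int (betti 1 p G) * (\<Sum>r = 0..l. int (n choose r)) \<le> int (betti 1 p ?K)
      + ((\<Sum>r = 1..l + 1. int (n choose r)) + int e) + int (betti 2 p G) * (\<Sum>r\<in>{0..<l}. int (n choose r))"
    using main[unfolded T T' Q] unfolding of_nat_le_iff[where 'a = int, symmetric] by simp
  show ?thesis
  proof
    have "int e \<le> (if l \<ge> 1 then int n else 0)" by (simp add: e_def)
    then have "(\<Sum>r = 2..l + 1. int (n choose r) * (int r - 1)) + (\<Sum>r = 1..l + 1. int (n choose r)) + int e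
        \<le> int n * (\<Sum>r = 0..l. int (n choose r))"
      using weighted_binomial_sum[OF assms(7)] by linarith
    then show "int (betti 1 p ?K) \<ge> (\<Sum>r = 2..l + 1. int (n choose r) * (int r - 1))
           + (int (betti 1 p G) - int n) * (\<Sum>r = 0..l. int (n choose r))
           - int (betti 2 p G) * (\<Sum>r\<in>{0..<l}. int (n choose r))"
      using main' unfolding left_diff_distrib by linarith
    show "p = 2 \<longrightarrow> int (betti 1 2 ?K) \<ge>
           int (betti 1 2 G) * (\<Sum>r = 0..l. int (n choose r))
           - (\<Sum>r = 1..l + 1. int (n choose r))
           - int (betti 2 2 G) * (\<Sum>r\<in>{0..<l}. int (n choose r))"
    proof
      assume p2: "p = 2"
      then have "e = 0" by (simp add: e_def)
      with main' show "int (betti 1 2 ?K) \<ge>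
           int (betti 1 2 G) * (\<Sum>r = 0..l. int (n choose r))
           - (\<Sum>r = 1..l + 1. int (n choose r))
           - int (betti 2 2 G) * (\<Sum>r\<in>{0..<l}. int (n choose r))"
        unfolding p2 by linarith
    qed
  qed
qed

end
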